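(* Let $\Omega=\{x\in\mathbb{R}^2:|x|<1\}$ be the unit disk, and let $\lambda_1(\alpha)$ denote the first eigenvalue of the fractional Laplacian $(-\Delta)^{\alpha/2}$ on $\Omega$. Then $$\lambda_1(\alpha)<2^\alpha\qquad\text{for all } \alpha\in(0,0.802).$$
   Context: For $u\in L^2(\mathbb{R}^d)$ the Fourier transform is $\widehat{u}(\xi)=(2\pi)^{-d/2}\int_{\mathbb{R}^d}u(x)e^{-ix\cdot\xi}\,dx$. For $\alpha>0$, the fractional Laplacian $(-\Delta)^{\alpha/2}$ is the Fourier multiplier operator given by $\big((-\Delta)^{\alpha/2}u\big)\widehat{\ }(\xi)=|\xi|^\alpha\widehat{u}(\xi)$. For a bounded domain $\Omega\subset\mathbb{R}^d$, set $$H^{\alpha/2}_0(\Omega)=\{u\in H^{\alpha/2}(\mathbb{R}^d): u=0 \text{ a.e. on } \mathbb{R}^d\setminus\Omega\}.$$ The operator $(-\Delta)^{\alpha/2}$ on $\Omega$ is understood with this Dirichlet (exterior) condition; it has discrete spectrum with weak eigenfunctions in $H^{\alpha/2}_0(\Omega)$. Its eigenvalues, in nondecreasing order and counted with multiplicity, are $\lambda_1(\alpha)\le\lambda_2(\alpha)\le\cdots$, and they are characterized by $$\lambda_n(\alpha)=\min_{S}\max\Big\{\int_{\mathbb{R}^d}|\xi|^\alpha|\widehat{u}(\xi)|^2\,d\xi : u\in S,\ \int_{\mathbb{R}^d}|u|^2\,dx=1\Big\},$$ where $S$ ranges over all $n$-dimensional subspaces of $H^{\alpha/2}_0(\Omega)$.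 Here $d=2$. *)

theory Defs
  imports "HOL-Analysis.Analysis"
begin

text \<open>
  Functions stand for their classes modulo equality almost everywhere; working with Borel
  measurable functions is no restriction, as every Lebesgue class has a Borel representative.
\<close>

definition square_integrable :: "('a::euclidean_space \<Rightarrow> complex) \<Rightarrow> bool" where
  "square_integrable u \<longleftrightarrow>
     u \<in> borel_measurable lborel \<and> integrable lborel (\<lambda>x. (cmod (u x))\<^sup>2)"

definition fourier_integral :: "('a::euclidean_space \<Rightarrow> complex) \<Rightarrow> 'a \<Rightarrow> complex" where
  "fourier_integral u \<xi> =
     complex_of_real ((2 * pi) powr (- (real DIM('a) / 2))) *
     (LINT x|lborel. u x * exp (- (\<i> * complex_of_real (x \<bullet> \<xi>))))"

text \<open>
  The Fourier integral of a square integrable function need not converge absolutely (and the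
  Bochner integral is then 0 by convention), so on the space of square integrable functions the
  integral is read in the usual sense of Plancherel: as the mean square limit of the integrals
  over the balls of radius \<open>R\<close>.  The limit is determined up to a null set, and
  coincides almost everywhere with \<^term>\<open>fourier_integral u\<close> if \<open>u\<close> is also integrable.
\<close>

definition has_fourier_transform ::
  "('a::euclidean_space \<Rightarrow> complex) \<Rightarrow> ('a \<Rightarrow> complex) \<Rightarrow> bool" where
  "has_fourier_transform u g \<longleftrightarrow>
     square_integrable g \<and>
     ((\<lambda>R::real. \<integral>\<^sup>+ \<xi>. ennreal
         ((cmod (fourier_integral (\<lambda>x. indicator (cball 0 R) x *\<^sub>R u x) \<xi> - g \<xi>))\<^sup>2)
         \<partial>lborel) \<longlongrightarrow> 0) at_top"

definition fourier_transform :: "('a::euclidean_space \<Rightarrow> complex) \<Rightarrow> 'a \<Rightarrow> complex" where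
  "fourier_transform u = (SOME g. has_fourier_transform u g)"

definition sobolev_space :: "real \<Rightarrow> ('a::euclidean_space \<Rightarrow> complex) set" where
  "sobolev_space s =
     {u. square_integrable u \<and>
         integrable lborel
           (\<lambda>\<xi>. (1 + (norm \<xi>)\<^sup>2) powr s * (cmod (fourier_transform u \<xi>))\<^sup>2)}"

definition sobolev_space_0 ::
  "real \<Rightarrow> 'a::euclidean_space set \<Rightarrow> ('a \<Rightarrow> complex) set" where
  "sobolev_space_0 s \<Omega> =
     {u \<in> sobolev_space s. AE x in lborel. x \<notin> \<Omega> \<longrightarrow> u x = 0}"

text \<open>
  The sesquilinear form of the Fourier multiplier with symbol \<open>|\<xi>|\<^sup>\<alpha>\<close>, that is, the pairing of
  the fractional Laplacian of \<open>u\<close> with \<open>v\<close>, transported to the Fourier side.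
\<close>

definition frac_laplacian_form ::
  "real \<Rightarrow> ('a::euclidean_space \<Rightarrow> complex) \<Rightarrow> ('a \<Rightarrow> complex) \<Rightarrow> complex" where
  "frac_laplacian_form \<alpha> u v =
     (LINT \<xi>|lborel. complex_of_real (norm \<xi> powr \<alpha>) *
        fourier_transform u \<xi> * cnj (fourier_transform v \<xi>))"

definition weak_eigenfunction ::
  "real \<Rightarrow> 'a::euclidean_space set \<Rightarrow> real \<Rightarrow> ('a \<Rightarrow> complex) \<Rightarrow> bool" where
  "weak_eigenfunction \<alpha> \<Omega> \<mu> u \<longleftrightarrow>
     u \<in> sobolev_space_0 (\<alpha> / 2) \<Omega> \<and>
     \<not> (AE x in lborel. u x = 0) \<and>
     (\<forall>v \<in> sobolev_space_0 (\<alpha> / 2) \<Omega>.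
        frac_laplacian_form \<alpha> u v =
        complex_of_real \<mu> * (LINT x|lborel. u x * cnj (v x)))"

definition dirichlet_eigenvalue :: "real \<Rightarrow> 'a::euclidean_space set \<Rightarrow> real \<Rightarrow> bool" where
  "dirichlet_eigenvalue \<alpha> \<Omega> \<mu> \<longleftrightarrow> (\<exists>u. weak_eigenfunction \<alpha> \<Omega> \<mu> u)"

text \<open>
  Only real numbers are considered as eigenvalues because the form is Hermitian.  The value is
  meaningful only when a smallest eigenvalue exists, as it does for bounded domains.
\<close>

definition first_eigenvalue :: "real \<Rightarrow> 'a::euclidean_space set \<Rightarrow> real" where
  "first_eigenvalue \<alpha> \<Omega> = (LEAST \<mu>. dirichlet_eigenvalue \<alpha> \<Omega> \<mu>)"

end

theory Submission
  imports Defs "HOL-Probability.Probability" "HOL-Complex_Analysis.Complex_Analysis" "HOL-Real_Asymp.Real_Asymp"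
begin

text \<open>
  The first eigenvalue is the minimum of the Rayleigh quotient
  \<open>\<integral>|\<xi>|\<^sup>\<alpha>|\<F> u|\<^sup>2 / \<integral>|u|\<^sup>2\<close> over \<open>H\<^sub>0\<close>, so it is enough to exhibit one function whose quotient is
  below \<open>2\<^sup>\<alpha>\<close>.  The argument has two independent halves.

  \<^emph>\<open>The minimum exists and is the smallest eigenvalue.\<close>  The direct method works
  here entirely on the Fourier side.  Functions that vanish outside a bounded set have Fourier
  integrals that are bounded and Lipschitz continuous in terms of the \<open>L\<^sup>2\<close> norm, so a minimizing sequence has
  a subsequence whose Fourier integrals converge pointwise.  The bound on the energy makes the high
  frequencies uniformly small, hence the Fourier integrals are Cauchy in \<open>L\<^sup>2\<close>, and by Plancherel's theorem so is
  the sequence itself (\<open>rellich\<close>).  Fatou's lemma shows that the limit is a minimizer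
  (\<open>rayleigh_minimizer\<close>), and expanding the quotient around a minimizer gives the weak eigenvalue
  equation (\<open>first_eigenvalue_le_rayleigh_quotient\<close>).  Plancherel's theorem is obtained by
  testing \<open>|\<F> u|\<^sup>2\<close>, which is the Fourier integral of the autocorrelation of \<open>u\<close>, against wide
  Gaussians (\<open>gaussian_parseval\<close>, \<open>plancherel\<close>).

  \<^emph>\<open>The trial function.\<close>  The function \<open>\<surd>(1 - |x|\<^sup>2)\<close> on the disk has the parabola
  \<open>\<pi>/2 (1 - s\<^sup>2)\<close> as its projection onto every line.  Its Fourier integral is therefore radial and given by a
  one-dimensional one; after an integration by parts it is, up to a constant, that of the ramp \<open>s\<close> on
  \<open>[-1, 1]\<close>, divided by the frequency (\<open>fourier_integral_cap\<close>).  In polar coordinates the energy of order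
  \<open>\<beta>\<close> becomes the integral of \<open>|k|\<close> to the power \<open>\<beta> - 1\<close> against the power spectrum of
  the ramp.  The exponent is negative for \<open>\<beta> < 1\<close>, so this is a Riesz potential energy, which can be
  computed from the autocorrelation of the ramp, a cubic polynomial in \<open>|z|\<close>
  (\<open>riesz_potential_parseval\<close>, \<open>cap_fourier_energy\<close>).

  For \<open>\<alpha> \<le> \<beta>\<close>, \<open>(|\<xi>|/2)\<^sup>\<alpha>\<close> is at most the convex combination of \<open>(|\<xi>|/2)\<^sup>\<beta>\<close> and \<open>1\<close> with weights \<open>\<alpha>/\<beta>\<close> and
  \<open>1 - \<alpha>/\<beta>\<close>.  Hence an energy below \<open>2\<^sup>\<beta>\<close> times the squared norm for a single
  \<open>\<beta>\<close> gives the bound for all smaller orders.  The choice \<open>\<beta> = 5/6\<close>, just above the range of the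
  theorem, leads to an inequality between Gamma values that holds with a margin of about a third of
  a percent (\<open>Gamma_ratio_bound\<close>).
\<close>

section \<open>Square integrable functions and the norm of \<open>L\<^sup>2\<close>\<close>

lemma square_integrable_borel [measurable_dest]: "square_integrable u \<Longrightarrow> u \<in> borel_measurable borel"
  by (simp add: square_integrable_def)

lemma square_integrable_dominated:
  fixes u :: "'a::euclidean_space \<Rightarrow> complex"
  assumes "u \<in> borel_measurable lborel" "integrable lborel f" "\<And>x. (cmod (u x))\<^sup>2 \<le> f x"
  shows "square_integrable u"
  unfolding square_integrable_def
proof
  show "integrable lborel (\<lambda>x. (cmod (u x))\<^sup>2)"
    by (rule Bochner_Integration.integrable_bound [OF assms(2)])
       (use assms in \<open>auto intro!: AE_I2 order_trans [OF assms(3)]\<close>)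
qed fact

lemma cmod_add_square_le: "(cmod (a + b))\<^sup>2 \<le> 2 * (cmod a)\<^sup>2 + 2 * (cmod b)\<^sup>2"
proof -
  have "(cmod (a + b))\<^sup>2 \<le> (cmod a + cmod b)\<^sup>2"
    by (intro power_mono norm_triangle_ineq) auto
  also have "\<dots> \<le> 2 * (cmod a)\<^sup>2 + 2 * (cmod b)\<^sup>2"
    using zero_le_power2 [of "cmod a - cmod b"] by (simp add: power2_eq_square algebra_simps)
  finally show ?thesis .
qed

lemma integrable_indicator_cball:
  "integrable lborel (\<lambda>x::'a::euclidean_space. c * indicator (cball 0 R) x :: real)"
  using emeasure_lborel_cball_finite [of "0::'a" R]
  by (intro integrable_mult_right integrable_real_indicator) auto

lemma integrable_bounded_support:
  fixes u :: "'a::euclidean_space \<Rightarrow> 'b::{banach, second_countable_topology}"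
  assumes [measurable]: "u \<in> borel_measurable borel"
    and "\<And>x. norm (u x) \<le> M" "\<And>x. x \<notin> cball 0 R \<Longrightarrow> u x = 0"
  shows "integrable lborel u"
proof (rule Bochner_Integration.integrable_bound)
  show "integrable lborel (\<lambda>x::'a. M * indicator (cball 0 R) x :: real)"
    by (rule integrable_indicator_cball)
  show "AE x in lborel. norm (u x) \<le> norm (M * indicator (cball 0 R) x :: real)"
    using assms(2,3) by (intro AE_I2) (metis abs_ge_self indicator_simps mult.right_neutral norm_zero abs_ge_zero order_trans real_norm_def)
qed simp

lemma square_integrable_bounded_support:
  fixes u :: "'a::euclidean_space \<Rightarrow> complex"
  assumes [measurable]: "u \<in> borel_measurable borel"
    and "\<And>x. cmod (u x) \<le> M" "\<And>x. x \<notin> cball 0 R \<Longrightarrow> u x = 0"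
  shows "square_integrable u"
  unfolding square_integrable_def
  by (intro conjI integrable_bounded_support [of _ "M\<^sup>2" R]) (use assms in \<open>auto intro!: power_mono\<close>)

lemma square_integrable_cmult:
  assumes "square_integrable u"
  shows "square_integrable (\<lambda>x. c * u x)"
  using assms unfolding square_integrable_def by (auto simp: norm_mult power_mult_distrib)

lemma square_integrable_add:
  assumes [measurable]: "square_integrable u" "square_integrable v"
  shows "square_integrable (\<lambda>x. u x + v x)"
  by (rule square_integrable_dominated
           [where f = "\<lambda>x. 2 * (cmod (u x))\<^sup>2 + 2 * (cmod (v x))\<^sup>2"])
     (use assms in \<open>auto simp: square_integrable_def intro!: cmod_add_square_le\<close>)

lemma square_integrable_diff:
  assumes "square_integrable u" "square_integrable v"
  shows "square_integrable (\<lambda>x. u x - v x)"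
  using square_integrable_add [OF assms(1) square_integrable_cmult [OF assms(2), of "-1"]] by simp

lemma cnj_borel_measurable [measurable]: "cnj \<in> borel_measurable borel"
  by (intro borel_measurable_continuous_onI continuous_intros)

lemma integrable_inner_product:
  assumes [measurable]: "square_integrable u" "square_integrable v"
  shows "integrable lborel (\<lambda>x. u x * cnj (v x))"
proof (rule Bochner_Integration.integrable_bound)
  show "integrable lborel (\<lambda>x. (cmod (u x))\<^sup>2 + (cmod (v x))\<^sup>2)"
    using assms by (auto simp: square_integrable_def)
  have "cmod (u x) * cmod (v x) \<le> (cmod (u x))\<^sup>2 + (cmod (v x))\<^sup>2" for x
    using sum_squares_bound [of "cmod (u x)" "cmod (v x)"]
      mult_nonneg_nonneg [OF norm_ge_zero norm_ge_zero, of "u x" "v x"] by linarith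
  then show "AE x in lborel. cmod (u x * cnj (v x)) \<le> norm ((cmod (u x))\<^sup>2 + (cmod (v x))\<^sup>2)"
    by (simp add: norm_mult)
qed measurable

definition l2_norm :: "('a::euclidean_space \<Rightarrow> complex) \<Rightarrow> real" where
  "l2_norm u = sqrt (LINT x|lborel. (cmod (u x))\<^sup>2)"

lemma l2_norm_nonneg [simp]: "0 \<le> l2_norm u"
  by (simp add: l2_norm_def)

lemma l2_norm_squared: "(l2_norm u)\<^sup>2 = (LINT x|lborel. (cmod (u x))\<^sup>2)"
  by (simp add: l2_norm_def)

text \<open>
  The expansion behind the Cauchy-Schwarz inequality and, applied also to weighted Fourier
  integrals, the first variation of the Rayleigh quotient.
\<close>

lemma l2_norm_expand:
  assumes "square_integrable u" "square_integrable v"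
  shows "(l2_norm (\<lambda>x. u x + c * v x))\<^sup>2 =
     (l2_norm u)\<^sup>2 + 2 * Re (cnj c * (LINT x|lborel. u x * cnj (v x))) + (cmod c)\<^sup>2 * (l2_norm v)\<^sup>2"
proof -
  have eq: "(cmod (a + c * b))\<^sup>2 = (cmod a)\<^sup>2 + 2 * Re (cnj c * (a * cnj b)) + (cmod c)\<^sup>2 * (cmod b)\<^sup>2" for a b
    unfolding cmod_power2 by (simp add: power2_eq_square algebra_simps)
  note int = integrable_inner_product [OF assms]
  have "(LINT x|lborel. (cmod (u x + c * v x))\<^sup>2) =
    (LINT x|lborel. (cmod (u x))\<^sup>2 + 2 * Re (cnj c * (u x * cnj (v x))) + (cmod c)\<^sup>2 * (cmod (v x))\<^sup>2)"
    by (simp only: eq)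
  also have "\<dots> = (LINT x|lborel. (cmod (u x))\<^sup>2) + 2 * (LINT x|lborel. Re (cnj c * (u x * cnj (v x))))
      + (cmod c)\<^sup>2 * (LINT x|lborel. (cmod (v x))\<^sup>2)"
  proof -
    have "integrable lborel (\<lambda>x. Re (cnj c * (u x * cnj (v x))))"
      by (intro integrable_Re integrable_mult_right int)
    then show ?thesis
      using assms by (simp only: square_integrable_def Bochner_Integration.integral_add
          Bochner_Integration.integrable_add integrable_mult_right integral_mult_right_zero)
  qed
  also have "(LINT x|lborel. Re (cnj c * (u x * cnj (v x)))) = Re (cnj c * (LINT x|lborel. u x * cnj (v x)))"
    using int by (simp only: integral_Re [OF integrable_mult_right [OF int]] integral_mult_right_zero)
  finally show ?thesis
    by (simp add: l2_norm_squared)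
qed

text \<open>
  The polynomial \<open>t \<mapsto> \<parallel>u - t \<langle>u, v\<rangle> v\<parallel>\<^sup>2\<close> is nonnegative; its coefficients give the bound.
\<close>

lemma l2_cauchy_schwarz:
  assumes "square_integrable u" "square_integrable v"
  shows "cmod (LINT x|lborel. u x * cnj (v x)) \<le> l2_norm u * l2_norm v"
proof -
  define B where "B = (LINT x|lborel. u x * cnj (v x))"
  have pos: "0 \<le> (l2_norm u)\<^sup>2 - 2 * t * (cmod B)\<^sup>2 + t\<^sup>2 * (cmod B)\<^sup>2 * (l2_norm v)\<^sup>2" for t :: real
  proof -
    have "Re (cnj (- (of_real t * B)) * B) = - t * (cmod B)\<^sup>2"
      unfolding cmod_power2 by (simp add: power2_eq_square algebra_simps)
    then have "(l2_norm (\<lambda>x. u x + (- (of_real t * B)) * v x))\<^sup>2 =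
        (l2_norm u)\<^sup>2 - 2 * t * (cmod B)\<^sup>2 + t\<^sup>2 * (cmod B)\<^sup>2 * (l2_norm v)\<^sup>2"
      unfolding l2_norm_expand [OF assms] B_def [symmetric]
      by (simp add: norm_mult power_mult_distrib)
    then show ?thesis
      by (metis zero_le_power2)
  qed
  have "(cmod B)\<^sup>2 \<le> (l2_norm u)\<^sup>2 * (l2_norm v)\<^sup>2"
  proof (cases "l2_norm v = 0")
    case True
    have "B = 0"
    proof (rule ccontr)
      assume "B \<noteq> 0"
      \<comment> \<open>At this \<open>t\<close> the polynomial, now linear, would be negative.\<close>
      then have "2 * (((l2_norm u)\<^sup>2 + 1) / (cmod B)\<^sup>2) * (cmod B)\<^sup>2 = 2 * ((l2_norm u)\<^sup>2 + 1)"
        by simp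
      then show False
        using pos [of "((l2_norm u)\<^sup>2 + 1) / (cmod B)\<^sup>2"] True zero_le_power2 [of "l2_norm u"]
        by (simp only: True) simp
    qed
    then show ?thesis by simp
  next
    case False
    then have V: "0 < (l2_norm v)\<^sup>2"
      by simp
    have "(1 / (l2_norm v)\<^sup>2)\<^sup>2 * (cmod B)\<^sup>2 * (l2_norm v)\<^sup>2 = (cmod B)\<^sup>2 / (l2_norm v)\<^sup>2"
      using V by (simp add: power2_eq_square)
    then have "(cmod B)\<^sup>2 / (l2_norm v)\<^sup>2 \<le> (l2_norm u)\<^sup>2"
      using pos [of "1 / (l2_norm v)\<^sup>2"] by simp
    then show ?thesis
      using V by (simp only: pos_divide_le_eq)
  qed
  then have "(cmod B)\<^sup>2 \<le> (l2_norm u * l2_norm v)\<^sup>2"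
    by (simp add: power_mult_distrib)
  then show ?thesis
    unfolding B_def by (rule power2_le_imp_le) simp
qed

lemma l2_norm_triangle:
  assumes "square_integrable u" "square_integrable v"
  shows "l2_norm (\<lambda>x. u x + v x) \<le> l2_norm u + l2_norm v"
proof -
  have "(l2_norm (\<lambda>x. u x + v x))\<^sup>2 \<le> (l2_norm u + l2_norm v)\<^sup>2"
    using l2_norm_expand [OF assms, of 1] l2_cauchy_schwarz [OF assms]
      complex_Re_le_cmod [of "LINT x|lborel. u x * cnj (v x)"]
    by (simp add: power2_eq_square algebra_simps)
  then show ?thesis
    by (rule power2_le_imp_le) simp
qed

lemma l2_norm_diff_commute: "l2_norm (\<lambda>x. u x - v x) = l2_norm (\<lambda>x. v x - u x)"
  by (simp add: l2_norm_def norm_minus_commute)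

lemma l2_norm_reverse_triangle:
  assumes "square_integrable u" "square_integrable v"
  shows "\<bar>l2_norm u - l2_norm v\<bar> \<le> l2_norm (\<lambda>x. u x - v x)"
  using l2_norm_triangle [OF assms(2) square_integrable_diff [OF assms]]
    l2_norm_triangle [OF assms(1) square_integrable_diff [OF assms(2,1)]]
    l2_norm_diff_commute [of u v]
  by simp

section \<open>The Fourier integral\<close>

notation fourier_integral ("\<F>")

lemma fourier_kernel_integrable:
  fixes u :: "'a::euclidean_space \<Rightarrow> complex"
  assumes "integrable lborel u"
  shows "integrable lborel (\<lambda>x. u x * exp (- (\<i> * complex_of_real (x \<bullet> \<xi>))))"
proof (rule Bochner_Integration.integrable_bound [OF assms])
  show "(\<lambda>x. u x * exp (- (\<i> * complex_of_real (x \<bullet> \<xi>)))) \<in> borel_measurable lborel"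
    using assms by measurable
qed (simp add: norm_mult norm_exp_i_times [of "- _", simplified])

lemma fourier_integral_measurable [measurable]:
  fixes u :: "'a::euclidean_space \<Rightarrow> complex"
  assumes [measurable]: "u \<in> borel_measurable borel"
  shows "\<F> u \<in> borel_measurable borel"
  unfolding fourier_integral_def [abs_def] by measurable

lemma fourier_integral_bound:
  fixes u :: "'a::euclidean_space \<Rightarrow> complex"
  assumes "integrable lborel u"
  shows "cmod (\<F> u \<xi>) \<le>
    (2 * pi) powr (- (real DIM('a) / 2)) * (LINT x|lborel. cmod (u x))"
proof -
  have "cmod (LINT x|lborel. u x * exp (- (\<i> * complex_of_real (x \<bullet> \<xi>)))) \<le> (LINT x|lborel. cmod (u x))"
    by (rule order_trans [OF integral_norm_bound]) (simp add: norm_mult)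
  then show ?thesis
    by (simp add: fourier_integral_def norm_mult mult_left_mono)
qed

lemma fourier_integral_linear:
  assumes "integrable lborel u" "integrable lborel v"
  shows "\<F> (\<lambda>x. u x + c * v x) \<xi> = \<F> u \<xi> + c * \<F> v \<xi>"
proof -
  have "(LINT x|lborel. (u x + c * v x) * exp (- (\<i> * complex_of_real (x \<bullet> \<xi>)))) =
     (LINT x|lborel. u x * exp (- (\<i> * complex_of_real (x \<bullet> \<xi>))) + c * (v x * exp (- (\<i> * complex_of_real (x \<bullet> \<xi>)))))"
    by (simp add: algebra_simps)
  also have "\<dots> = (LINT x|lborel. u x * exp (- (\<i> * complex_of_real (x \<bullet> \<xi>)))) + c * (LINT x|lborel. v x * exp (- (\<i> * complex_of_real (x \<bullet> \<xi>))))"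
    by (subst Bochner_Integration.integral_add) (auto intro!: integrable_mult_right fourier_kernel_integrable assms)
  finally show ?thesis
    by (simp add: fourier_integral_def algebra_simps)
qed

lemma fourier_integral_diff:
  assumes "integrable lborel u" "integrable lborel v"
  shows "\<F> (\<lambda>x. u x - v x) \<xi> = \<F> u \<xi> - \<F> v \<xi>"
  using fourier_integral_linear [OF assms, of "-1"] by simp

lemma fourier_integral_cong_AE:
  fixes u :: "'a::euclidean_space \<Rightarrow> complex"
  assumes [measurable]: "u \<in> borel_measurable lborel" "v \<in> borel_measurable lborel"
    and "AE x in lborel. u x = v x"
  shows "\<F> u = \<F> v"
proof -
  have "(LINT x|lborel. u x * exp (- (\<i> * complex_of_real (x \<bullet> \<xi>)))) =
     (LINT x|lborel. v x * exp (- (\<i> * complex_of_real (x \<bullet> \<xi>))))" for \<xi>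
    by (rule integral_cong_AE) (use assms(3) in auto)
  then show ?thesis
    by (simp add: fun_eq_iff fourier_integral_def)
qed

section \<open>Gaussians and the heat kernel\<close>

text \<open>
  The characteristic function of the standard normal distribution, rescaled.
\<close>

lemma gaussian_fourier_real:
  assumes "0 < t"
  shows "integrable lborel (\<lambda>k::real. complex_of_real (exp (- t * k\<^sup>2 / 2)) * exp (- (\<i> * complex_of_real (z * k))))" (is ?I)
    and "(LINT k|lborel. complex_of_real (exp (- t * k\<^sup>2 / 2)) * exp (- (\<i> * complex_of_real (z * k)))) =
      complex_of_real (sqrt (2 * pi / t) * exp (- z\<^sup>2 / (2 * t)))" (is "?X = _")
proof -
  define h where "h x = complex_of_real (std_normal_density x) * exp (- (\<i> * complex_of_real (z / sqrt t * x)))" for x :: real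
  have h_scaled: "h (0 + sqrt t * k) =
     complex_of_real (1 / sqrt (2 * pi)) * (complex_of_real (exp (- t * k\<^sup>2 / 2)) * exp (- (\<i> * complex_of_real (z * k))))" for k
    using assms by (simp add: h_def std_normal_density_def power_mult_distrib)
  have int: "integrable lborel h"
  proof (rule Bochner_Integration.integrable_bound)
    show "integrable lborel (\<lambda>x. std_normal_density x)"
      by simp
    show "AE x in lborel. cmod (h x) \<le> norm (std_normal_density x)"
      by (auto simp: h_def norm_mult)
    show "h \<in> borel_measurable lborel"
      unfolding h_def [abs_def] by measurable
  qed
  have "(LINT x|lborel. h x) = char std_normal_distribution (- (z / sqrt t))"
    unfolding char_def
    by (subst integral_density) (auto simp: h_def [abs_def] normal_density_nonneg scaleR_conv_of_real)
  also have "\<dots> = complex_of_real (exp (- z\<^sup>2 / (2 * t)))"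
    using assms by (simp add: char_std_normal_distribution power_divide)
  finally have val: "(LINT x|lborel. h x) = complex_of_real (exp (- z\<^sup>2 / (2 * t)))" .
  have "integrable lborel (\<lambda>k. h (0 + sqrt t * k))"
    using int assms by (intro lborel_integrable_real_affine) auto
  moreover have unscale: "complex_of_real (sqrt (2 * pi)) * h (0 + sqrt t * k) =
      complex_of_real (exp (- t * k\<^sup>2 / 2)) * exp (- (\<i> * complex_of_real (z * k)))" for k
    unfolding h_scaled by (simp add: field_simps)
  ultimately have "integrable lborel (\<lambda>k. complex_of_real (sqrt (2 * pi)) * h (0 + sqrt t * k))"
    by (intro integrable_mult_right)
  then show ?I
    unfolding unscale .
  have "complex_of_real (exp (- z\<^sup>2 / (2 * t))) = sqrt t *\<^sub>R (LINT k|lborel. h (0 + sqrt t * k))"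
    using lborel_integral_real_affine [of "sqrt t" h 0] assms val by simp
  also have "\<dots> = complex_of_real (sqrt t / sqrt (2 * pi)) *
      ?X"
    unfolding h_scaled by (simp add: scaleR_conv_of_real)
  finally show "?X =
      complex_of_real (sqrt (2 * pi / t) * exp (- z\<^sup>2 / (2 * t)))"
    using assms by (simp add: real_sqrt_divide field_simps)
qed

text \<open>
  The density of the centred normal distribution with variance \<open>t\<close> in each coordinate, that is,
  the kernel of \<open>exp (t \<Delta> / 2)\<close>.
\<close>

definition heat_kernel :: "real \<Rightarrow> 'a::euclidean_space \<Rightarrow> real" where
  "heat_kernel t z = (2 * pi * t) powr (- (real DIM('a) / 2)) * exp (- (norm z)\<^sup>2 / (2 * t))"

lemma heat_kernel_nonneg [simp]: "0 \<le> heat_kernel t z"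
  by (simp add: heat_kernel_def)

lemma heat_kernel_measurable [measurable]: "heat_kernel t \<in> borel_measurable borel"
  unfolding heat_kernel_def [abs_def] by measurable

lemma lborel_integral_prod_Basis:
  fixes f :: "'a::euclidean_space \<Rightarrow> real \<Rightarrow> complex"
  assumes "\<And>b. b \<in> Basis \<Longrightarrow> integrable lborel (f b)"
  shows "integrable lborel (\<lambda>x. \<Prod>b\<in>Basis. f b (x \<bullet> b))" (is ?P1)
    and "(LINT x|lborel. (\<Prod>b\<in>Basis. f b (x \<bullet> b))) = (\<Prod>b\<in>Basis. LINT s|lborel. f b s)" (is ?P2)
proof -
  interpret product_sigma_finite "\<lambda>_::'a. lborel :: real measure" ..
  have [measurable]: "f b \<in> borel_measurable borel" if "b \<in> Basis" for b
    using borel_measurable_integrable [OF assms [OF that]] by simp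
  have [measurable]: "(\<lambda>x::'a. \<Prod>b\<in>Basis. f b (x \<bullet> b)) \<in> borel_measurable borel"
    by (intro borel_measurable_prod) measurable
  have eq: "(\<Prod>b\<in>Basis. f b ((\<Sum>b\<in>Basis. g b *\<^sub>R b) \<bullet> b)) = (\<Prod>b\<in>Basis. f b (g b))" for g :: "'a \<Rightarrow> real"
    by (intro prod.cong) auto
  show ?P1
    by (subst lborel_eq, subst integrable_distr_eq)
       (simp_all add: eq product_integrable_prod assms)
  show ?P2
    by (subst lborel_eq, subst integral_distr)
       (simp_all add: eq product_integral_prod assms)
qed

lemma norm_squared_sum_Basis: "(norm (x::'a::euclidean_space))\<^sup>2 = (\<Sum>b\<in>Basis. (x \<bullet> b)\<^sup>2)"
  unfolding power2_norm_eq_inner by (subst euclidean_inner) (simp add: power2_eq_square)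

lemma gaussian_kernel_prod:
  fixes z \<xi> :: "'a::euclidean_space"
  shows "complex_of_real (exp (- t * (norm \<xi>)\<^sup>2 / 2)) * exp (- (\<i> * complex_of_real (z \<bullet> \<xi>))) =
    (\<Prod>b\<in>Basis. complex_of_real (exp (- t * (\<xi> \<bullet> b)\<^sup>2 / 2)) * exp (- (\<i> * complex_of_real ((z \<bullet> b) * (\<xi> \<bullet> b)))))"
proof -
  have "- t * (norm \<xi>)\<^sup>2 / 2 = (\<Sum>b\<in>Basis. - t * (\<xi> \<bullet> b)\<^sup>2 / 2)"
    by (simp add: norm_squared_sum_Basis sum_distrib_left sum_divide_distrib sum_negf)
  moreover have "- (\<i> * complex_of_real (z \<bullet> \<xi>)) = (\<Sum>b\<in>Basis. - (\<i> * complex_of_real ((z \<bullet> b) * (\<xi> \<bullet> b))))"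
    by (subst euclidean_inner) (simp add: sum_distrib_left sum_negf)
  ultimately show ?thesis
    by (simp only: prod.distrib exp_sum finite_Basis of_real_prod)
qed

lemma gaussian_fourier:
  fixes z :: "'a::euclidean_space"
  assumes "0 < t"
  shows "integrable lborel (\<lambda>\<xi>::'a. complex_of_real (exp (- t * (norm \<xi>)\<^sup>2 / 2)) * exp (- (\<i> * complex_of_real (z \<bullet> \<xi>))))" (is ?I)
    and "(LINT \<xi>|lborel. complex_of_real (exp (- t * (norm \<xi>)\<^sup>2 / 2)) * exp (- (\<i> * complex_of_real (z \<bullet> \<xi>)))) =
      complex_of_real ((2 * pi) powr (real DIM('a)) * heat_kernel t z)" (is "?X = _")
proof -
  show ?I
    unfolding gaussian_kernel_prod
    by (intro lborel_integral_prod_Basis(1) gaussian_fourier_real assms)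
  have "?X =
      (\<Prod>b\<in>(Basis::'a set). complex_of_real (sqrt (2 * pi / t) * exp (- (z \<bullet> b)\<^sup>2 / (2 * t))))"
    unfolding gaussian_kernel_prod
    by (subst lborel_integral_prod_Basis(2)) (intro gaussian_fourier_real assms prod.cong refl)+
  also have "\<dots> = complex_of_real (sqrt (2 * pi / t) ^ DIM('a) * exp (- (norm z)\<^sup>2 / (2 * t)))"
    by (simp add: norm_squared_sum_Basis sum_divide_distrib prod.distrib exp_sum
        flip: of_real_prod of_real_mult of_real_power sum_negf)
  also have "sqrt (2 * pi / t) ^ DIM('a) = (2 * pi) powr (real DIM('a)) * (2 * pi * t) powr (- (real DIM('a) / 2))"
  proof -
    have "sqrt (2 * pi / t) ^ DIM('a) = (2 * pi / t) powr (real DIM('a) / 2)"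
      using assms by (simp add: powr_half_sqrt [symmetric] powr_powr flip: powr_realpow)
    also have "\<dots> = (2 * pi) powr (real DIM('a) / 2) * t powr (- (real DIM('a) / 2))"
      using assms by (simp add: powr_divide powr_minus_divide)
    also have "(2 * pi) powr (real DIM('a) / 2) = (2 * pi) powr (real DIM('a)) * (2 * pi) powr (- (real DIM('a) / 2))"
      by (simp flip: powr_add)
    finally show ?thesis
      using assms by (simp add: powr_mult)
  qed
  finally show "?X =
      complex_of_real ((2 * pi) powr (real DIM('a)) * heat_kernel t z)"
    by (simp add: heat_kernel_def)
qed

lemma gaussian_integral:
  assumes "0 < t"
  shows "integrable lborel (\<lambda>\<xi>::'a::euclidean_space. exp (- t * (norm \<xi>)\<^sup>2 / 2))"
    and "(LINT \<xi>|lborel. exp (- t * (norm (\<xi>::'a::euclidean_space))\<^sup>2 / 2)) = (2 * pi / t) powr (real DIM('a) / 2)" (is ?P1)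
proof -
  have *: "integrable lborel (\<lambda>\<xi>::'a. complex_of_real (exp (- t * (norm \<xi>)\<^sup>2 / 2)))"
    using gaussian_fourier(1) [OF assms, of 0] by simp
  then show "integrable lborel (\<lambda>\<xi>::'a. exp (- t * (norm \<xi>)\<^sup>2 / 2))"
    using integrable_Re [OF *] by simp
  have "(LINT \<xi>|lborel. exp (- t * (norm (\<xi>::'a))\<^sup>2 / 2)) = (2 * pi) powr (real DIM('a)) * heat_kernel t (0::'a)"
    using gaussian_fourier(2) [OF assms, of "0::'a"]
    by (simp only: inner_zero_left of_real_0 mult_zero_right minus_zero exp_zero mult_1_right
        integral_complex_of_real of_real_eq_iff)
  also have "\<dots> = (2 * pi) powr (real DIM('a)) * (2 * pi) powr (- (real DIM('a) / 2)) * t powr (- (real DIM('a) / 2))"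
    using assms by (simp add: heat_kernel_def powr_mult)
  also have "(2 * pi) powr (real DIM('a)) * (2 * pi) powr (- (real DIM('a) / 2)) = (2 * pi) powr (real DIM('a) / 2)"
    by (simp flip: powr_add)
  also have "(2 * pi) powr (real DIM('a) / 2) * t powr (- (real DIM('a) / 2)) = (2 * pi / t) powr (real DIM('a) / 2)"
    using assms by (simp add: powr_divide powr_minus_divide)
  finally show ?P1 .
qed

lemma heat_kernel_integral:
  assumes "0 < t"
  shows "integrable lborel (heat_kernel t :: 'a::euclidean_space \<Rightarrow> real)"
    and "(LINT z|lborel. heat_kernel t (z::'a)) = 1"
proof -
  have e: "- (norm z)\<^sup>2 / (2 * t) = - (1 / t) * (norm z)\<^sup>2 / 2" for z :: 'a
    by simp
  note g = gaussian_integral [of "1 / t", where 'a = 'a]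
  show "integrable lborel (heat_kernel t :: 'a \<Rightarrow> real)"
    using g(1) assms unfolding heat_kernel_def [abs_def] e by (intro integrable_mult_right) simp
  have "(LINT z|lborel. heat_kernel t (z::'a)) = (2 * pi * t) powr (- (real DIM('a) / 2)) * (2 * pi / (1 / t)) powr (real DIM('a) / 2)"
    unfolding heat_kernel_def e integral_mult_right_zero using g(2) assms by simp
  then show "(LINT z|lborel. heat_kernel t (z::'a)) = 1"
    using assms by (simp flip: powr_add)
qed

section \<open>Autocorrelations and Plancherel's theorem\<close>

lemma lborel_integral_translate:
  fixes f :: "'a::euclidean_space \<Rightarrow> 'b::{banach, second_countable_topology}"
  assumes [measurable]: "f \<in> borel_measurable borel"
  shows "(LINT z|lborel. f (x + z)) = (LINT z|lborel. f z)" (is ?P1)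
    and "integrable lborel (\<lambda>z. f (x + z)) \<longleftrightarrow> integrable lborel f" (is ?P2)
proof -
  show ?P1
    by (subst (2) lborel_distr_plus [of x, symmetric], subst integral_distr) simp_all
  show ?P2
    by (subst (2) lborel_distr_plus [of x, symmetric], subst integrable_distr_eq) simp_all
qed

lemma fourier_integral_multiplication:
  fixes u h :: "'a::euclidean_space \<Rightarrow> complex"
  assumes u: "integrable lborel u" and h: "integrable lborel h"
  shows "(LINT \<xi>|lborel. \<F> u \<xi> * h \<xi>) = (LINT x|lborel. u x * \<F> h x)"
proof -
  have [measurable]: "u \<in> borel_measurable borel" "h \<in> borel_measurable borel"
    using u h by auto
  define f where "f x \<xi> = u x * h \<xi> * exp (- (\<i> * complex_of_real (x \<bullet> \<xi>)))" for x \<xi>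
  have norm_f: "cmod (f x \<xi>) = cmod (u x) * cmod (h \<xi>)" for x \<xi>
    by (simp add: f_def norm_mult)
  have "integrable (lborel \<Otimes>\<^sub>M lborel) (case_prod f)"
  proof (rule lborel_pair.Fubini_integrable)
    show "case_prod f \<in> borel_measurable (lborel \<Otimes>\<^sub>M lborel)"
      unfolding f_def by measurable
    show "integrable lborel (\<lambda>x. LINT y|lborel. norm (case_prod f (x, y)))"
      using u h by (simp add: norm_f)
    show "AE x in lborel. integrable lborel (\<lambda>y. case_prod f (x, y))"
      using fourier_kernel_integrable [OF h] unfolding f_def
      by (auto simp: inner_commute mult.assoc)
  qed
  note fub = lborel_pair.Fubini_integral [OF this]
  define c where "c = complex_of_real ((2 * pi) powr (- (real DIM('a) / 2)))"
  have "\<F> u \<xi> * h \<xi> = c * (LINT x|lborel. f x \<xi>)" for \<xi>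
  proof -
    have "(LINT x|lborel. f x \<xi>) = (LINT x|lborel. u x * exp (- (\<i> * complex_of_real (x \<bullet> \<xi>)))) * h \<xi>"
      unfolding integral_mult_left_zero [symmetric] f_def by (simp add: mult_ac)
    then show ?thesis
      by (simp add: fourier_integral_def c_def)
  qed
  moreover have "u x * \<F> h x = c * (LINT \<xi>|lborel. f x \<xi>)" for x
  proof -
    have "(LINT \<xi>|lborel. f x \<xi>) = u x * (LINT \<xi>|lborel. h \<xi> * exp (- (\<i> * complex_of_real (\<xi> \<bullet> x))))"
      unfolding integral_mult_right_zero [symmetric] f_def by (simp add: mult_ac inner_commute)
    then show ?thesis
      by (simp add: fourier_integral_def c_def)
  qed
  ultimately show ?thesis
    using fub by simp
qed

definition autocorrelation :: "('a::euclidean_space \<Rightarrow> complex) \<Rightarrow> 'a \<Rightarrow> complex" where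
  "autocorrelation u z = (LINT x|lborel. u (x + z) * cnj (u x))"

text \<open>
  Substituting \<open>x + z\<close> for the argument splits the phase \<open>z \<bullet> \<xi>\<close> into those of the two factors, so the
  double integral is the product of the Fourier integral and its conjugate.
\<close>

lemma autocorrelation_fourier:
  fixes u :: "'a::euclidean_space \<Rightarrow> complex"
  assumes u: "integrable lborel u"
  shows "integrable lborel (autocorrelation u)"
    and "\<F> (autocorrelation u) \<xi> =
      complex_of_real ((2 * pi) powr (real DIM('a) / 2) * (cmod (\<F> u \<xi>))\<^sup>2)" (is ?P1)
proof -
  have [measurable]: "u \<in> borel_measurable borel"
    using u by auto
  define E where "E x = exp (- (\<i> * complex_of_real (x \<bullet> \<xi>)))" for x
  have [measurable]: "E \<in> borel_measurable borel"
    unfolding E_def by measurable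
  have E_norm: "cmod (E x) = 1" for x
    by (simp add: E_def)
  have E_add: "E (x + z) = E x * E z" for x z
    by (simp add: E_def inner_add_left exp_add [symmetric] algebra_simps)
  have E_cnj: "E x * cnj (E x) = 1" for x
    by (metis E_norm complex_norm_square of_real_1 power_one)
  have int0: "integrable (lborel \<Otimes>\<^sub>M lborel) (\<lambda>(x, z). u (x + z) * cnj (u x))"
  proof (rule lborel_pair.Fubini_integrable)
    have "(LINT z|lborel. norm (u (x + z) * cnj (u x))) = (LINT z|lborel. cmod (u z)) * cmod (u x)" for x
      using lborel_integral_translate(1) [of "\<lambda>z. cmod (u z)" x] by (simp add: norm_mult)
    then show "integrable lborel (\<lambda>x. LINT z|lborel. norm (case (x, z) of (x, z) \<Rightarrow> u (x + z) * cnj (u x)))"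
      using u by simp
    show "AE x in lborel. integrable lborel (\<lambda>z. case (x, z) of (x, z) \<Rightarrow> u (x + z) * cnj (u x))"
      using u lborel_integral_translate(2) [of u] by simp
  qed measurable
  show "integrable lborel (autocorrelation u)"
    unfolding autocorrelation_def [abs_def]
    using lborel_pair.integrable_snd [OF int0] by simp
  have int1: "integrable (lborel \<Otimes>\<^sub>M lborel) (\<lambda>(x, z). u (x + z) * cnj (u x) * E z)"
    by (rule Bochner_Integration.integrable_bound [OF int0]) (auto simp: norm_mult E_norm)
  have uE: "(LINT x|lborel. cnj (u x * E x)) = cnj (LINT x|lborel. u x * E x)"
    by (rule Bochner_Integration.integral_cnj)
  have "(LINT z|lborel. autocorrelation u z * E z) = (LINT z|lborel. (LINT x|lborel. u (x + z) * cnj (u x) * E z))"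
    by (simp add: autocorrelation_def)
  also have "\<dots> = (LINT x|lborel. (LINT z|lborel. u (x + z) * cnj (u x) * E z))"
    by (rule lborel_pair.Fubini_integral [OF int1])
  also have "\<dots> = (LINT x|lborel. (LINT z|lborel. u (x + z) * E (x + z)) * cnj (u x * E x))"
  proof -
    have "u (x + z) * cnj (u x) * E z = (u (x + z) * E (x + z)) * cnj (u x * E x)" for x z
      using E_cnj [of x] by (simp add: E_add algebra_simps)
    then show ?thesis by (simp only: integral_mult_left_zero)
  qed
  also have "\<dots> = (LINT x|lborel. u x * E x) * cnj (LINT x|lborel. u x * E x)"
    by (subst lborel_integral_translate(1) [of "\<lambda>z. u z * E z"])
       (simp_all only: integral_mult_right_zero uE, measurable)
  also have "\<dots> = complex_of_real ((cmod (LINT x|lborel. u x * E x))\<^sup>2)"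
    by (rule complex_norm_square [symmetric])
  finally have "\<F> (autocorrelation u) \<xi> =
     complex_of_real ((2 * pi) powr (- (real DIM('a) / 2)) * (cmod (LINT x|lborel. u x * E x))\<^sup>2)"
    by (simp add: fourier_integral_def E_def)
  also have "(cmod (LINT x|lborel. u x * E x))\<^sup>2 = (2 * pi) powr (real DIM('a)) * (cmod (\<F> u \<xi>))\<^sup>2"
    by (simp add: fourier_integral_def E_def norm_mult power_mult_distrib power2_eq_square
        flip: powr_add mult.assoc)
  also have "(2 * pi) powr (- (real DIM('a) / 2)) * ((2 * pi) powr (real DIM('a)) * (cmod (\<F> u \<xi>))\<^sup>2)
    = (2 * pi) powr (real DIM('a) / 2) * (cmod (\<F> u \<xi>))\<^sup>2"
    by (simp flip: powr_add mult.assoc)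
  finally show ?P1 .
qed

text \<open>
  The multiplication formula \<open>\<integral> \<F> A \<cdot> g = \<integral> A \<cdot> \<F> g\<close> for the autocorrelation \<open>A\<close> and a Gaussian \<open>g\<close>.  Plancherel's
  theorem is the limit \<open>t \<rightarrow> 0\<close>, in which the heat kernel tends to a point mass and the right-hand side to
  \<open>A 0 = \<parallel>u\<parallel>\<^sup>2\<close>; the formula for Riesz potentials arises by integrating over \<open>t\<close>.
\<close>

lemma gaussian_parseval:
  fixes u :: "'a::euclidean_space \<Rightarrow> complex"
  assumes u: "integrable lborel u" and t: "0 < t"
  shows "integrable lborel (\<lambda>\<xi>. exp (- t * (norm \<xi>)\<^sup>2 / 2) * (cmod (\<F> u \<xi>))\<^sup>2)" (is ?I)
    and "complex_of_real (LINT \<xi>|lborel. exp (- t * (norm \<xi>)\<^sup>2 / 2) * (cmod (\<F> u \<xi>))\<^sup>2) =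
      (LINT z|lborel. complex_of_real (heat_kernel t z) * autocorrelation u z)" (is "complex_of_real ?X = ?Y")
proof -
  have [measurable]: "u \<in> borel_measurable borel"
    using u by auto
  define M where "M = (2 * pi) powr (- (real DIM('a) / 2)) * (LINT x|lborel. cmod (u x))"
  show ?I
  proof (rule Bochner_Integration.integrable_bound)
    show "integrable lborel (\<lambda>\<xi>::'a. exp (- t * (norm \<xi>)\<^sup>2 / 2) * M\<^sup>2)"
      by (intro integrable_mult_left gaussian_integral t)
    have "(cmod (\<F> u \<xi>))\<^sup>2 \<le> M\<^sup>2" for \<xi>
      unfolding M_def by (intro power_mono fourier_integral_bound u) auto
    then show "AE \<xi> in lborel. norm (exp (- t * (norm \<xi>)\<^sup>2 / 2) * (cmod (\<F> u \<xi>))\<^sup>2) \<le> norm (exp (- t * (norm \<xi>)\<^sup>2 / 2) * M\<^sup>2)"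
      by (auto intro!: mult_left_mono)
  qed measurable
  define g where "g \<xi> = complex_of_real (exp (- t * (norm \<xi>)\<^sup>2 / 2))" for \<xi> :: 'a
  have g: "integrable lborel g"
    using gaussian_fourier(1) [OF t, of "0::'a"] by (simp add: g_def [abs_def])
  have F_g: "\<F> g z = complex_of_real ((2 * pi) powr (real DIM('a) / 2) * heat_kernel t z)" for z
  proof -
    have "\<F> g z = complex_of_real ((2 * pi) powr (- (real DIM('a) / 2)) * ((2 * pi) powr (real DIM('a)) * heat_kernel t z))"
      using gaussian_fourier(2) [OF t, of z] by (simp add: fourier_integral_def g_def inner_commute)
    also have "(2 * pi) powr (- (real DIM('a) / 2)) * ((2 * pi) powr (real DIM('a)) * heat_kernel t z) = (2 * pi) powr (real DIM('a) / 2) * heat_kernel t z"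
      by (simp flip: powr_add mult.assoc)
    finally show ?thesis .
  qed
  have "complex_of_real ((2 * pi) powr (real DIM('a) / 2)) *
      complex_of_real ?X =
     (LINT \<xi>|lborel. complex_of_real ((2 * pi) powr (real DIM('a) / 2)) * complex_of_real (exp (- t * (norm \<xi>)\<^sup>2 / 2) * (cmod (\<F> u \<xi>))\<^sup>2))"
    by (simp only: integral_complex_of_real integral_mult_right_zero)
  also have "\<dots> = (LINT \<xi>|lborel. \<F> (autocorrelation u) \<xi> * g \<xi>)"
    by (simp add: autocorrelation_fourier(2) [OF u] g_def mult_ac)
  also have "\<dots> = (LINT z|lborel. autocorrelation u z * \<F> g z)"
    by (intro fourier_integral_multiplication autocorrelation_fourier u g)
  also have "\<dots> = (LINT z|lborel. complex_of_real ((2 * pi) powr (real DIM('a) / 2)) * (complex_of_real (heat_kernel t z) * autocorrelation u z))"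
    by (simp add: F_g mult_ac)
  finally show "complex_of_real ?X =
      ?Y"
    by (simp only: integral_mult_right_zero) simp
qed

lemma square_integrable_translate:
  fixes u :: "'a::euclidean_space \<Rightarrow> complex"
  assumes "square_integrable u"
  shows "square_integrable (\<lambda>x. u (x + z))" "l2_norm (\<lambda>x. u (x + z)) = l2_norm u"
proof -
  note [measurable] = square_integrable_borel [OF assms]
  have eq: "(\<lambda>x. u (x + z)) = (\<lambda>x. u (z + x))"
    by (simp add: add.commute)
  show "square_integrable (\<lambda>x. u (x + z))" "l2_norm (\<lambda>x. u (x + z)) = l2_norm u"
    using assms lborel_integral_translate [of "\<lambda>x. (cmod (u x))\<^sup>2" z]
    unfolding eq square_integrable_def l2_norm_def by auto
qed

lemma autocorrelation_bound:
  assumes "square_integrable u"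
  shows "cmod (autocorrelation u z) \<le> (l2_norm u)\<^sup>2"
  using l2_cauchy_schwarz [OF square_integrable_translate(1) [OF assms, of z] assms]
    square_integrable_translate(2) [OF assms, of z]
  by (simp add: autocorrelation_def power2_eq_square)

lemma autocorrelation_zero: "autocorrelation u 0 = complex_of_real ((l2_norm u)\<^sup>2)"
  unfolding autocorrelation_def l2_norm_squared
  by (simp add: complex_norm_square [symmetric] integral_complex_of_real flip: of_real_power)

lemma gaussian_parseval_le:
  fixes u :: "'a::euclidean_space \<Rightarrow> complex"
  assumes u: "integrable lborel u" "square_integrable u" and t: "0 < t"
  shows "(LINT \<xi>|lborel. exp (- t * (norm \<xi>)\<^sup>2 / 2) * (cmod (\<F> u \<xi>))\<^sup>2) \<le> (l2_norm u)\<^sup>2"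
proof -
  have bound: "cmod (complex_of_real (heat_kernel t z) * autocorrelation u z) \<le> (l2_norm u)\<^sup>2 * heat_kernel t z" for z
    using mult_right_mono [OF autocorrelation_bound [OF u(2)] heat_kernel_nonneg, of z t z]
    by (simp add: norm_mult mult.commute)
  have int: "integrable lborel (\<lambda>z::'a. (l2_norm u)\<^sup>2 * heat_kernel t z)"
    by (intro integrable_mult_right heat_kernel_integral t)
  have [measurable]: "autocorrelation u \<in> borel_measurable lborel"
    using autocorrelation_fourier(1) [OF u(1)] by auto
  have "integrable lborel (\<lambda>z. complex_of_real (heat_kernel t z) * autocorrelation u z)"
    by (rule Bochner_Integration.integrable_bound [OF int])
       (use bound in \<open>auto intro!: AE_I2 order_trans [OF bound]\<close>)
  then have "cmod (LINT z|lborel. complex_of_real (heat_kernel t z) * autocorrelation u z) \<le>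
      (LINT z|lborel. (l2_norm u)\<^sup>2 * heat_kernel t (z::'a))"
    by (intro order_trans [OF integral_norm_bound] integral_mono integrable_norm int bound)
  also have "\<dots> = (l2_norm u)\<^sup>2"
    using heat_kernel_integral(2) [OF t, where 'a = 'a] by simp
  finally show ?thesis
    unfolding gaussian_parseval(2) [OF u(1) t, symmetric] by simp
qed


text \<open>
  The Gaussian factors increase to \<open>1\<close>, so monotone convergence turns the uniform bound
  \<open>gaussian_parseval_le\<close> into Bessel's inequality.  The convergence statement is kept because for
  continuous functions the same limit can be evaluated on the other side.
\<close>

lemma fourier_integral_square_integrable:
  fixes u :: "'a::euclidean_space \<Rightarrow> complex"
  assumes u: "integrable lborel u" "square_integrable u"
  shows "square_integrable (\<F> u)"
    and "l2_norm (\<F> u) \<le> l2_norm u"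
    and "(\<lambda>n. LINT \<xi>|lborel. exp (- (1 / real (Suc n)) * (norm \<xi>)\<^sup>2 / 2) * (cmod (\<F> u \<xi>))\<^sup>2)
      \<longlonglongrightarrow> (l2_norm (\<F> u))\<^sup>2" (is ?P1)
proof -
  have [measurable]: "u \<in> borel_measurable borel"
    using u by auto
  define f where "f n \<xi> = exp (- (1 / real (Suc n)) * (norm \<xi>)\<^sup>2 / 2) * (cmod (\<F> u \<xi>))\<^sup>2" for n and \<xi> :: 'a
  have f_int: "integrable lborel (f n)" for n
    unfolding f_def by (intro gaussian_parseval u) simp
  have f_mono: "mono (\<lambda>n. f n \<xi>)" for \<xi>
    unfolding f_def
    by (intro monoI mult_right_mono) (auto simp: divide_simps intro!: mult_left_mono)
  have f_nonneg: "0 \<le> f n \<xi>" for n \<xi>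
    by (simp add: f_def)
  have f_lim: "(\<lambda>n. f n \<xi>) \<longlonglongrightarrow> (cmod (\<F> u \<xi>))\<^sup>2" for \<xi>
  proof -
    have "(\<lambda>n. exp (- (1 / real (Suc n)) * (norm \<xi>)\<^sup>2 / 2) * (cmod (\<F> u \<xi>))\<^sup>2)
       \<longlonglongrightarrow> exp (- 0 * (norm \<xi>)\<^sup>2 / 2) * (cmod (\<F> u \<xi>))\<^sup>2"
      by (intro tendsto_intros LIMSEQ_inverse_real_of_nat [unfolded inverse_eq_divide]) auto
    then show ?thesis by (simp add: f_def)
  qed
  have "mono (\<lambda>n. integral\<^sup>L lborel (f n))"
    by (intro monoI integral_mono f_int) (use f_mono in \<open>auto simp: mono_def\<close>)
  moreover have bound: "integral\<^sup>L lborel (f n) \<le> (l2_norm u)\<^sup>2" for n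
    unfolding f_def by (intro gaussian_parseval_le u) simp
  ultimately obtain L where L: "(\<lambda>n. integral\<^sup>L lborel (f n)) \<longlonglongrightarrow> L"
    using incseq_convergent by blast
  note * = integral_monotone_convergence_nonneg [OF f_int AE_I2 AE_I2 AE_I2 L, of "\<lambda>\<xi>. (cmod (\<F> u \<xi>))\<^sup>2"]
  have int: "integrable lborel (\<lambda>\<xi>. (cmod (\<F> u \<xi>))\<^sup>2)"
    and val: "(LINT \<xi>|lborel. (cmod (\<F> u \<xi>))\<^sup>2) = L"
    by (rule *; use f_mono f_nonneg f_lim in simp)+
  show "square_integrable (\<F> u)"
    using int by (simp add: square_integrable_def)
  show ?P1
    using L unfolding l2_norm_squared val f_def .
  have "L \<le> (l2_norm u)\<^sup>2"
    by (rule LIMSEQ_le_const2 [OF L]) (use bound in auto)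
  then show "l2_norm (\<F> u) \<le> l2_norm u"
    unfolding val [symmetric] l2_norm_squared [symmetric] by (rule power2_le_imp_le) simp
qed

text \<open>
  Rescaling by \<open>\<surd>t\<close> turns the heat kernel into a fixed probability density and moves \<open>t\<close> into the argument of the
  autocorrelation, which is continuous at \<open>0\<close> by dominated convergence.
\<close>

lemma plancherel_continuous:
  fixes u :: "'a::euclidean_space \<Rightarrow> complex"
  assumes u: "integrable lborel u" "square_integrable u"
    and cont: "continuous_on UNIV u" and bound: "\<And>x. cmod (u x) \<le> M"
  shows "l2_norm (\<F> u) = l2_norm u"
proof -
  have [measurable]: "u \<in> borel_measurable borel"
    using u by auto
  have [measurable]: "autocorrelation u \<in> borel_measurable borel"
    using autocorrelation_fourier(1) [OF u(1)] by auto
  define t where "t n = 1 / real (Suc n)" for n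
  have t: "0 < t n" for n
    by (simp add: t_def)
  have t_lim: "t \<longlonglongrightarrow> 0"
    using LIMSEQ_inverse_real_of_nat by (simp add: t_def [abs_def] inverse_eq_divide)
  have scale: "(LINT z|lborel. complex_of_real (heat_kernel (t n) z) * autocorrelation u z) =
     (LINT w|lborel. complex_of_real (heat_kernel 1 w) * autocorrelation u (sqrt (t n) *\<^sub>R w))" for n
  proof -
    have *: "sqrt (t n) ^ DIM('a) * heat_kernel (t n) (sqrt (t n) *\<^sub>R w) = heat_kernel 1 w" for w :: 'a
    proof -
      have "sqrt (t n) ^ DIM('a) = t n powr (real DIM('a) / 2)"
        using t [of n] by (simp add: powr_half_sqrt [symmetric] powr_powr flip: powr_realpow)
      then show ?thesis
        using t [of n] by (simp add: heat_kernel_def power_mult_distrib powr_mult powr_minus)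
    qed
    have "(LINT z|lborel. complex_of_real (heat_kernel (t n) z) * autocorrelation u z) =
      (LINT w|lborel. (sqrt (t n) ^ DIM('a)) *\<^sub>R (complex_of_real (heat_kernel (t n) (sqrt (t n) *\<^sub>R w)) * autocorrelation u (sqrt (t n) *\<^sub>R w)))"
      using t [of n]
      by (subst lborel_affine [of "sqrt (t n)" 0])
         (auto simp: integral_density integral_distr)
    then show ?thesis
      by (simp add: scaleR_conv_of_real mult.assoc [symmetric] * flip: of_real_mult of_real_power)
  qed
  have conv: "(\<lambda>n. autocorrelation u (sqrt (t n) *\<^sub>R w)) \<longlonglongrightarrow> autocorrelation u 0" for w
    unfolding autocorrelation_def
  proof (rule integral_dominated_convergence)
    show "integrable lborel (\<lambda>x. M * cmod (u x))"
      using u by simp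
    have "(\<lambda>n. x + sqrt (t n) *\<^sub>R w) \<longlonglongrightarrow> x + sqrt 0 *\<^sub>R w" for x
      by (intro tendsto_intros t_lim)
    then have "(\<lambda>n. x + sqrt (t n) *\<^sub>R w) \<longlonglongrightarrow> x + 0" for x
      by simp
    then have "(\<lambda>n. u (x + sqrt (t n) *\<^sub>R w)) \<longlonglongrightarrow> u (x + 0)" for x
      using cont continuous_on_tendsto_compose [of UNIV u] by auto
    then show "AE x in lborel. (\<lambda>n. u (x + sqrt (t n) *\<^sub>R w) * cnj (u x)) \<longlonglongrightarrow> u (x + 0) * cnj (u x)"
      by (intro AE_I2 tendsto_intros)
    show "AE x in lborel. cmod (u (x + sqrt (t n) *\<^sub>R w) * cnj (u x)) \<le> M * cmod (u x)" for n
      by (auto simp: norm_mult intro!: AE_I2 mult_right_mono bound)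
  qed measurable
  have "(\<lambda>n. LINT w|lborel. complex_of_real (heat_kernel 1 w) * autocorrelation u (sqrt (t n) *\<^sub>R w))
     \<longlonglongrightarrow> (LINT w|lborel. complex_of_real (heat_kernel 1 (w::'a)) * autocorrelation u 0)"
  proof (rule integral_dominated_convergence)
    show "integrable lborel (\<lambda>w::'a. heat_kernel 1 w * (l2_norm u)\<^sup>2)"
      by (intro integrable_mult_left heat_kernel_integral) simp
    show "AE w in lborel. cmod (complex_of_real (heat_kernel 1 w) * autocorrelation u (sqrt (t n) *\<^sub>R w)) \<le> heat_kernel 1 w * (l2_norm u)\<^sup>2" for n
      by (auto simp: norm_mult intro!: AE_I2 mult_left_mono autocorrelation_bound u)
    show "AE w in lborel. (\<lambda>n. complex_of_real (heat_kernel 1 w) * autocorrelation u (sqrt (t n) *\<^sub>R w)) \<longlonglongrightarrow> complex_of_real (heat_kernel 1 w) * autocorrelation u 0"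
      by (intro AE_I2 tendsto_intros conv)
  qed measurable
  also have "(LINT w|lborel. complex_of_real (heat_kernel 1 (w::'a)) * autocorrelation u 0) = complex_of_real ((l2_norm u)\<^sup>2)"
    using heat_kernel_integral(2) [of 1, where 'a = 'a] by (simp add: autocorrelation_zero integral_complex_of_real)
  finally have "(\<lambda>n. complex_of_real (LINT \<xi>|lborel. exp (- t n * (norm \<xi>)\<^sup>2 / 2) * (cmod (\<F> u \<xi>))\<^sup>2)) \<longlonglongrightarrow> complex_of_real ((l2_norm u)\<^sup>2)"
    by (simp only: scale gaussian_parseval(2) [OF u(1) t])
  then have "(\<lambda>n. LINT \<xi>|lborel. exp (- t n * (norm \<xi>)\<^sup>2 / 2) * (cmod (\<F> u \<xi>))\<^sup>2) \<longlonglongrightarrow> (l2_norm u)\<^sup>2"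
    by (simp only: tendsto_of_real_iff)
  then have "(l2_norm u)\<^sup>2 = (l2_norm (\<F> u))\<^sup>2"
    using fourier_integral_square_integrable(3) [OF u] unfolding t_def by (rule LIMSEQ_unique)
  then show ?thesis
    by simp
qed

text \<open>
  Bessel's inequality makes the Fourier integral a contraction, so the functions on which it is
  isometric form a closed set.
\<close>

lemma plancherel_limit:
  fixes u :: "'a::euclidean_space \<Rightarrow> complex"
  assumes u: "integrable lborel u" "square_integrable u"
    and v: "\<And>n. integrable lborel (v n)" "\<And>n. square_integrable (v n)"
    and eq: "\<And>n. l2_norm (\<F> (v n)) = l2_norm (v n)"
    and lim: "(\<lambda>n. l2_norm (\<lambda>x. v n x - u x)) \<longlonglongrightarrow> 0"
  shows "l2_norm (\<F> u) = l2_norm u"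
proof -
  have "\<bar>l2_norm (\<F> (v n)) - l2_norm (\<F> u)\<bar> \<le> l2_norm (\<lambda>x. v n x - u x)" for n
  proof -
    have "\<F> (\<lambda>x. v n x - u x) = (\<lambda>\<xi>. \<F> (v n) \<xi> - \<F> u \<xi>)"
      by (intro ext fourier_integral_diff v u)
    then show ?thesis
      using l2_norm_reverse_triangle [OF fourier_integral_square_integrable(1) [OF v] fourier_integral_square_integrable(1) [OF u], of n]
        fourier_integral_square_integrable(2) [of "\<lambda>x. v n x - u x"] square_integrable_diff [OF v(2) u(2)] v(1) [of n] u(1)
      by fastforce
  qed
  then have "(\<lambda>n. l2_norm (\<F> (v n)) - l2_norm (\<F> u)) \<longlonglongrightarrow> 0"
    using lim by (intro Lim_null_comparison [OF always_eventually lim]) auto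
  then have 1: "(\<lambda>n. l2_norm (v n)) \<longlonglongrightarrow> l2_norm (\<F> u)"
    unfolding eq by (simp only: LIM_zero_iff)
  have "(\<lambda>n. l2_norm (v n) - l2_norm u) \<longlonglongrightarrow> 0"
    using l2_norm_reverse_triangle [OF v(2) u(2)]
    by (intro Lim_null_comparison [OF always_eventually lim]) auto
  then have "(\<lambda>n. l2_norm (v n)) \<longlonglongrightarrow> l2_norm u"
    by (simp only: LIM_zero_iff)
  with 1 show ?thesis
    by (rule LIMSEQ_unique)
qed

lemma l2_norm_tendsto_zero:
  fixes u :: "'a::euclidean_space \<Rightarrow> complex"
  assumes [measurable]: "\<And>n. v n \<in> borel_measurable borel" "u \<in> borel_measurable borel"
    and "integrable lborel f" "\<And>n x. (cmod (v n x - u x))\<^sup>2 \<le> f x"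
    and "AE x in lborel. (\<lambda>n. v n x) \<longlonglongrightarrow> u x"
  shows "(\<lambda>n. l2_norm (\<lambda>x. v n x - u x)) \<longlonglongrightarrow> 0"
proof -
  have "(\<lambda>n. LINT x|lborel. (cmod (v n x - u x))\<^sup>2) \<longlonglongrightarrow> (LINT x|(lborel :: 'a measure). 0)"
  proof (rule integral_dominated_convergence)
    show "AE x in lborel. (\<lambda>n. (cmod (v n x - u x))\<^sup>2) \<longlonglongrightarrow> 0"
      using assms(5)
    proof eventually_elim
      case (elim x)
      then have "(\<lambda>n. (cmod (v n x - u x))\<^sup>2) \<longlonglongrightarrow> (cmod (u x - u x))\<^sup>2"
        by (intro tendsto_intros)
      then show ?case by simp
    qed
  qed (use assms in auto)
  then have "(\<lambda>n. sqrt (LINT x|lborel. (cmod (v n x - u x))\<^sup>2)) \<longlonglongrightarrow> sqrt 0"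
    by (intro tendsto_intros) simp
  then show ?thesis
    by (simp add: l2_norm_def)
qed

text \<open>
  Every measurable function is an almost everywhere limit of continuous ones.  Projecting the
  values of these to a disk and cutting off outside a larger ball gives a dominated sequence, to
  which \<open>plancherel_continuous\<close> and \<open>plancherel_limit\<close> apply.
\<close>

lemma plancherel_bounded:
  fixes u :: "'a::euclidean_space \<Rightarrow> complex"
  assumes [measurable]: "u \<in> borel_measurable borel"
    and bound: "\<And>x. cmod (u x) \<le> M" and supp: "\<And>x. x \<notin> cball 0 R \<Longrightarrow> u x = 0"
  shows "l2_norm (\<F> u) = l2_norm u"
proof -
  have M: "0 \<le> M"
    using bound [of 0] norm_ge_zero order_trans by blast
  have "u measurable_on UNIV"
    by (rule lebesgue_measurable_imp_measurable_on)
       (auto intro: measurable_completion)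
  then obtain N g where N: "negligible N" and g: "\<And>n. continuous_on UNIV (g n)"
    and lim: "\<And>x. x \<notin> N \<Longrightarrow> (\<lambda>n. g n x) \<longlonglongrightarrow> u x"
    unfolding measurable_on_def by auto
  define clip where "clip = closest_point (cball (0::complex) M)"
  define cut :: "'a \<Rightarrow> real" where "cut x = max 0 (min 1 (R + 1 - norm x))" for x
  have clip_cont: "continuous_on UNIV clip"
    unfolding clip_def using M by (intro continuous_on_closest_point) auto
  have clip_bound: "cmod (clip z) \<le> M" for z
    using closest_point_in_set [of "cball (0::complex) M" z] M by (auto simp: clip_def)
  have clip_u: "clip (u x) = u x" for x
    unfolding clip_def by (rule closest_point_self) (simp add: bound)
  have cut: "0 \<le> cut x" "cut x \<le> 1" "x \<notin> cball 0 (R + 1) \<Longrightarrow> cut x = 0" "x \<in> cball 0 R \<Longrightarrow> cut x = 1" for x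
    by (auto simp: cut_def)
  define v where "v n x = cut x *\<^sub>R clip (g n x)" for n x
  have v_cont: "continuous_on UNIV (v n)" for n
    unfolding v_def cut_def using clip_cont g [of n]
    by (intro continuous_intros continuous_on_compose2 [OF clip_cont]) auto
  then have [measurable]: "v n \<in> borel_measurable borel" for n
    by (rule borel_measurable_continuous_onI)
  have v_bound: "cmod (v n x) \<le> M" for n x
    using mult_mono [OF cut(2) [of x] clip_bound [of "g n x"]] cut(1) [of x] by (simp add: v_def)
  have v_supp: "v n x = 0" if "x \<notin> cball 0 (R + 1)" for n x
    using cut(3) [OF that] by (simp add: v_def)
  have v_int: "integrable lborel (v n)" for n
    by (rule integrable_bounded_support [of _ M "R + 1"]) (use v_bound v_supp in auto)
  have v_sq: "square_integrable (v n)" for n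
    by (rule square_integrable_bounded_support [of _ M "R + 1"]) (use v_bound v_supp in auto)
  have u_int: "integrable lborel u"
    by (rule integrable_bounded_support [of _ M R]) (use bound supp in auto)
  have u_sq: "square_integrable u"
    by (rule square_integrable_bounded_support [of _ M R]) (use bound supp in auto)
  show ?thesis
  proof (rule plancherel_limit [OF u_int u_sq v_int v_sq])
    show "l2_norm (\<F> (v n)) = l2_norm (v n)" for n
      by (rule plancherel_continuous [OF v_int v_sq v_cont v_bound])
    show "(\<lambda>n. l2_norm (\<lambda>x. v n x - u x)) \<longlonglongrightarrow> 0"
    proof (rule l2_norm_tendsto_zero)
      show "integrable lborel (\<lambda>x::'a. (2 * M)\<^sup>2 * indicator (cball 0 (R + 1)) x :: real)"
        by (rule integrable_indicator_cball)
      show "(cmod (v n x - u x))\<^sup>2 \<le> (2 * M)\<^sup>2 * indicator (cball 0 (R + 1)) x" for n x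
      proof (cases "x \<in> cball 0 (R + 1)")
        case True
        have "cmod (v n x - u x) \<le> 2 * M"
          using norm_triangle_ineq4 [of "v n x" "u x"] v_bound [of n x] bound [of x] by linarith
        then have "(cmod (v n x - u x))\<^sup>2 \<le> (2 * M)\<^sup>2"
          by (intro power_mono) auto
        then show ?thesis
          using True by simp
      next
        case False
        then have "x \<notin> cball 0 R"
          by auto
        then show ?thesis
          using v_supp [OF False] supp [of x] by simp
      qed
      have "AE x in lebesgue. (\<lambda>n. v n x) \<longlonglongrightarrow> u x"
      proof -
        have "AE x in lebesgue. x \<notin> N"
          using N by (simp add: negligible_iff_null_sets AE_not_in)
        then show ?thesis
        proof eventually_elim
          case (elim x)
          have "(\<lambda>n. cut x *\<^sub>R clip (g n x)) \<longlonglongrightarrow> cut x *\<^sub>R clip (u x)"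
            using clip_cont lim [OF elim]
            by (intro tendsto_intros continuous_on_tendsto_compose [OF clip_cont]) auto
          moreover have "cut x *\<^sub>R clip (u x) = u x"
            using clip_u [of x] cut(4) [of x] supp [of x] by (cases "x \<in> cball 0 R") auto
          ultimately show ?case
            by (simp add: v_def)
        qed
      qed
      then show "AE x in lborel. (\<lambda>n. v n x) \<longlonglongrightarrow> u x"
        by (subst (asm) AE_completion_iff) auto
    qed auto
  qed
qed

text \<open>
  This is why the Fourier transform of the functions considered here is an honest integral:
  the truncated integrals are eventually constant.
\<close>

lemma square_integrable_bounded_support_integrable:
  fixes u :: "'a::euclidean_space \<Rightarrow> complex"
  assumes u: "square_integrable u" and supp: "AE x in lborel. x \<notin> cball 0 R \<longrightarrow> u x = 0"
  shows "integrable lborel u"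
proof (rule Bochner_Integration.integrable_bound)
  show "integrable lborel (\<lambda>x. (cmod (u x))\<^sup>2 + indicator (cball 0 R) x)"
    using u integrable_indicator_cball [of 1 R]
    by (auto simp: square_integrable_def intro!: Bochner_Integration.integrable_add)
  show "u \<in> borel_measurable lborel"
    using u by (simp add: square_integrable_def)
  show "AE x in lborel. cmod (u x) \<le> norm ((cmod (u x))\<^sup>2 + indicator (cball 0 R) x)"
    using supp
  proof eventually_elim
    case (elim x)
    have "cmod (u x) \<le> (cmod (u x))\<^sup>2 + 1"
      using sum_squares_bound [of "cmod (u x)" 1, unfolded power_one mult_1_right]
        norm_ge_zero [of "u x"] by linarith
    with elim show ?case
      by (cases "x \<in> cball 0 R") auto
  qed
qed

text \<open>
  An unbounded function is approximated by its restrictions to the sets on which it is bounded.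
\<close>

theorem plancherel:
  fixes u :: "'a::euclidean_space \<Rightarrow> complex"
  assumes u: "square_integrable u" and supp: "AE x in lborel. x \<notin> cball 0 R \<longrightarrow> u x = 0"
  shows "l2_norm (\<F> u) = l2_norm u"
proof -
  note [measurable] = square_integrable_borel [OF u]
  have u_int: "integrable lborel u"
    by (rule square_integrable_bounded_support_integrable [OF u supp])
  define v where "v n x = (if cmod (u x) \<le> real n \<and> norm x \<le> R then u x else 0)" for n x
  have [measurable]: "v n \<in> borel_measurable borel" for n
    unfolding v_def by measurable
  have v_int: "integrable lborel (v n)" for n
    by (rule integrable_bounded_support [of _ "real n" R]) (auto simp: v_def)
  have v_sq: "square_integrable (v n)" for n
    by (rule square_integrable_bounded_support [of _ "real n" R]) (auto simp: v_def)
  show ?thesis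
  proof (rule plancherel_limit [OF u_int u v_int v_sq])
    show "l2_norm (\<F> (v n)) = l2_norm (v n)" for n
      by (rule plancherel_bounded [of _ "real n" R]) (auto simp: v_def)
    show "(\<lambda>n. l2_norm (\<lambda>x. v n x - u x)) \<longlonglongrightarrow> 0"
    proof (rule l2_norm_tendsto_zero)
      show "integrable lborel (\<lambda>x. (cmod (u x))\<^sup>2)"
        using u by (simp add: square_integrable_def)
      show "(cmod (v n x - u x))\<^sup>2 \<le> (cmod (u x))\<^sup>2" for n x
        by (auto simp: v_def)
      show "AE x in lborel. (\<lambda>n. v n x) \<longlonglongrightarrow> u x"
        using supp
      proof eventually_elim
        case (elim x)
        obtain n0 where "cmod (u x) \<le> real n0"
          using real_arch_simple by blast
        then have "v n x = u x" if "n \<ge> n0" for n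
          using elim that by (auto simp: v_def intro: order_trans)
        then show ?case
          by (auto intro!: tendsto_eventually exI [of _ n0] simp: eventually_sequentially)
      qed
    qed auto
  qed
qed

section \<open>Completeness of \<open>L\<^sup>2\<close>\<close>

lemma square_integrable_nn_integral:
  assumes "square_integrable u"
  shows "(\<integral>\<^sup>+x. ennreal ((cmod (u x))\<^sup>2) \<partial>lborel) = ennreal ((l2_norm u)\<^sup>2)"
  using assms unfolding square_integrable_def l2_norm_squared
  by (intro nn_integral_eq_integral) auto

lemma square_integrableI_nn_integral:
  fixes u :: "'a::euclidean_space \<Rightarrow> complex"
  assumes [measurable]: "u \<in> borel_measurable lborel"
    and C: "(\<integral>\<^sup>+x. ennreal ((cmod (u x))\<^sup>2) \<partial>lborel) \<le> ennreal (C\<^sup>2)" "0 \<le> C"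
  shows "square_integrable u" and "l2_norm u \<le> C"
proof -
  have "integrable lborel (\<lambda>x. (cmod (u x))\<^sup>2)"
  proof (rule integrableI_bounded)
    show "(\<integral>\<^sup>+x. ennreal (norm ((cmod (u x))\<^sup>2)) \<partial>lborel) < \<infinity>"
      using C(1) by (simp add: le_less_trans)
  qed simp
  then show u: "square_integrable u"
    by (simp add: square_integrable_def)
  have "(l2_norm u)\<^sup>2 \<le> C\<^sup>2"
    using C(1) unfolding square_integrable_nn_integral [OF u] by simp
  then show "l2_norm u \<le> C"
    using C(2) by (rule power2_le_imp_le)
qed

lemma l2_norm_fatou:
  fixes v :: "nat \<Rightarrow> 'a::euclidean_space \<Rightarrow> complex"
  assumes v: "\<And>k. square_integrable (v k)" and w [measurable]: "w \<in> borel_measurable lborel"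
    and lim: "AE x in lborel. (\<lambda>k. v k x) \<longlonglongrightarrow> w x"
    and bound: "\<And>k. l2_norm (v k) \<le> C"
  shows "square_integrable w" and "l2_norm w \<le> C"
proof -
  have C: "0 \<le> C"
    using bound [of 0] l2_norm_nonneg order_trans by blast
  note [measurable] = square_integrable_borel [OF v]
  have "(\<integral>\<^sup>+x. ennreal ((cmod (w x))\<^sup>2) \<partial>lborel) = (\<integral>\<^sup>+x. liminf (\<lambda>k. ennreal ((cmod (v k x))\<^sup>2)) \<partial>lborel)"
  proof (rule nn_integral_cong_AE)
    show "AE x in lborel. ennreal ((cmod (w x))\<^sup>2) = liminf (\<lambda>k. ennreal ((cmod (v k x))\<^sup>2))"
      using lim
    proof eventually_elim
      case (elim x)
      then have "(\<lambda>k. ennreal ((cmod (v k x))\<^sup>2)) \<longlonglongrightarrow> ennreal ((cmod (w x))\<^sup>2)"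
        by (intro tendsto_intros)
      then show ?case
        by (intro lim_imp_Liminf [symmetric]) auto
    qed
  qed
  also have "\<dots> \<le> liminf (\<lambda>k. \<integral>\<^sup>+x. ennreal ((cmod (v k x))\<^sup>2) \<partial>lborel)"
    by (rule nn_integral_liminf) measurable
  also have "\<dots> \<le> liminf (\<lambda>k. ennreal (C\<^sup>2))"
    unfolding square_integrable_nn_integral [OF v]
    by (intro Liminf_mono always_eventually allI ennreal_leI power_mono bound) simp
  also have "\<dots> = ennreal (C\<^sup>2)"
    by (simp add: Liminf_const)
  finally show "square_integrable w" "l2_norm w \<le> C"
    using C by (auto intro: square_integrableI_nn_integral w)
qed

text \<open>
  The sum of \<open>2\<^sup>k |v (k + 1) - v k|\<^sup>2\<close> has a finite integral, so it is finite almost everywhere; its bounded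
  terms then force the increments to decay geometrically.
\<close>

lemma AE_convergent_if_fast_cauchy:
  fixes v :: "nat \<Rightarrow> 'a::euclidean_space \<Rightarrow> complex"
  assumes v: "\<And>k. square_integrable (v k)"
    and fast: "\<And>k. l2_norm (\<lambda>x. v (Suc k) x - v k x) \<le> (1 / 2) ^ k"
  shows "AE x in lborel. convergent (\<lambda>k. v k x)"
proof -
  define d where "d k x = v (Suc k) x - v k x" for k x
  have d: "square_integrable (d k)" for k
    unfolding d_def by (intro square_integrable_diff v)
  then have [measurable]: "d k \<in> borel_measurable lborel" for k
    by (simp add: square_integrable_def)
  have "(\<integral>\<^sup>+x. (\<Sum>k. ennreal (2 ^ k * (cmod (d k x))\<^sup>2)) \<partial>lborel) = (\<Sum>k. \<integral>\<^sup>+x. ennreal (2 ^ k * (cmod (d k x))\<^sup>2) \<partial>lborel)"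
    by (rule nn_integral_suminf) measurable
  also have "\<dots> \<le> (\<Sum>k. ennreal ((1 / 2) ^ k))"
  proof (intro suminf_le allI)
    fix k
    have "(\<integral>\<^sup>+x. ennreal (2 ^ k * (cmod (d k x))\<^sup>2) \<partial>lborel) = ennreal (2 ^ k * (l2_norm (d k))\<^sup>2)"
      by (simp add: ennreal_mult nn_integral_cmult square_integrable_nn_integral [OF d])
    also have "2 ^ k * (l2_norm (d k))\<^sup>2 \<le> 2 ^ k * ((1 / 2) ^ k)\<^sup>2"
      using fast [of k] by (intro mult_left_mono power_mono) (auto simp: d_def [abs_def])
    also have "\<dots> = (1 / 2 :: real) ^ k"
      by (simp add: power2_eq_square power_divide)
    finally show "(\<integral>\<^sup>+x. ennreal (2 ^ k * (cmod (d k x))\<^sup>2) \<partial>lborel) \<le> ennreal ((1 / 2) ^ k)"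
      by (simp add: ennreal_leI)
  qed auto
  also have "(\<Sum>k. ennreal ((1 / 2) ^ k)) = ennreal (\<Sum>k. (1 / 2) ^ k)"
    by (intro suminf_ennreal2) (auto simp: summable_geometric)
  finally have "(\<integral>\<^sup>+x. (\<Sum>k. ennreal (2 ^ k * (cmod (d k x))\<^sup>2)) \<partial>lborel) \<noteq> \<infinity>"
    by (auto simp: top_unique)
  then have "AE x in lborel. (\<Sum>k. ennreal (2 ^ k * (cmod (d k x))\<^sup>2)) \<noteq> \<infinity>"
    by (intro nn_integral_noteq_infinite) measurable
  then show ?thesis
  proof eventually_elim
    case (elim x)
    have "summable (\<lambda>k. 2 ^ k * (cmod (d k x))\<^sup>2)"
      by (rule summable_suminf_not_top) (use elim in auto)
    then have "(\<lambda>k. 2 ^ k * (cmod (d k x))\<^sup>2) \<longlonglongrightarrow> 0"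
      by (rule summable_LIMSEQ_zero)
    from convergent_imp_Bseq [OF convergentI [OF this]]
    obtain C where "\<forall>k. norm (2 ^ k * (cmod (d k x))\<^sup>2) \<le> C"
      by (auto simp: Bseq_def)
    then have C: "norm (2 ^ k * (cmod (d k x))\<^sup>2) \<le> C" for k
      by blast
    have "cmod (d k x) \<le> sqrt C * (1 / sqrt 2) ^ k" for k
    proof (rule power2_le_imp_le)
      have "(sqrt C * (1 / sqrt 2) ^ k)\<^sup>2 = C / 2 ^ k"
        using C [of 0] order_trans [OF norm_ge_zero C]
        by (simp add: power_mult_distrib power_divide flip: power_mult power_even_eq)
           (simp add: power_mult mult.commute [of k])
      moreover have "(cmod (d k x))\<^sup>2 \<le> C / 2 ^ k"
        using C [of k] by (simp add: field_simps)
      ultimately show "(cmod (d k x))\<^sup>2 \<le> (sqrt C * (1 / sqrt 2) ^ k)\<^sup>2"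
        by simp
      show "0 \<le> sqrt C * (1 / sqrt 2) ^ k"
        using order_trans [OF norm_ge_zero C] by simp
    qed
    moreover have "summable (\<lambda>k. sqrt C * (1 / sqrt 2) ^ k)"
      by (rule summable_mult, rule summable_geometric) (simp add: real_less_rsqrt)
    ultimately have "summable (\<lambda>k. d k x)"
      by (rule summable_comparison_test' [where N = 0, rotated])
    then have "convergent (\<lambda>n. \<Sum>k<n. d k x)"
      by (simp add: summable_iff_convergent)
    moreover have "(\<Sum>k<n. d k x) = v n x - v 0 x" for n
      unfolding d_def by (rule sum_lessThan_telescope)
    ultimately have "convergent (\<lambda>n. (v n x - v 0 x) + v 0 x)"
      by (intro convergent_add convergent_const) simp
    then show ?case
      by simp
  qed
qed

text \<open>
  The almost everywhere convergent subsequence is part of the conclusion because it transports the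
  exterior condition to the limit.
\<close>

theorem l2_complete:
  fixes u :: "nat \<Rightarrow> 'a::euclidean_space \<Rightarrow> complex"
  assumes u: "\<And>n. square_integrable (u n)"
    and cauchy: "\<forall>e>0. \<exists>N. \<forall>m\<ge>N. \<forall>n\<ge>N. l2_norm (\<lambda>x. u m x - u n x) \<le> e"
  shows "\<exists>w r. square_integrable w \<and> (\<lambda>n. l2_norm (\<lambda>x. u n x - w x)) \<longlonglongrightarrow> 0 \<and>
    (AE x in lborel. (\<lambda>k. u (r k) x) \<longlonglongrightarrow> w x)"
proof -
  have "\<exists>N. \<forall>k. \<forall>m\<ge>N k. \<forall>n\<ge>N k. l2_norm (\<lambda>x. u m x - u n x) \<le> (1 / 2) ^ k"
    using cauchy by (intro choice allI) simp
  then obtain N where N: "\<And>k m n. N k \<le> m \<Longrightarrow> N k \<le> n \<Longrightarrow> l2_norm (\<lambda>x. u m x - u n x) \<le> (1 / 2) ^ k"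
    by blast
  \<comment> \<open>Past the index from which the norms of the differences stay below \<open>(1/2)\<^sup>k\<close>, and unbounded.\<close>
  define r where "r k = k + (\<Sum>j\<le>k. N j)" for k
  have r: "N k \<le> r k" "k \<le> r k" "r k \<le> r (Suc k)" for k
    using member_le_sum [of k "{..k}" N] by (auto simp: r_def)
  note [measurable] = square_integrable_borel [OF u]
  define w where "w x = lim (\<lambda>k. u (r k) x)" for x
  have w [measurable]: "w \<in> borel_measurable lborel"
    unfolding w_def by measurable
  have "AE x in lborel. convergent (\<lambda>k. u (r k) x)"
  proof (rule AE_convergent_if_fast_cauchy [OF u])
    show "l2_norm (\<lambda>x. u (r (Suc k)) x - u (r k) x) \<le> (1 / 2) ^ k" for k
      using r [of k] by (intro N) auto
  qed
  then have AE_lim: "AE x in lborel. (\<lambda>k. u (r k) x) \<longlonglongrightarrow> w x"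
    by (simp add: w_def convergent_LIMSEQ_iff)
  have tail: "square_integrable (\<lambda>x. u n x - w x) \<and> l2_norm (\<lambda>x. u n x - w x) \<le> e"
    if M: "\<And>m n. M \<le> m \<Longrightarrow> M \<le> n \<Longrightarrow> l2_norm (\<lambda>x. u m x - u n x) \<le> e" and "M \<le> n" for M n e
  proof -
    have *: "AE x in lborel. (\<lambda>k. u n x - u (r (k + M)) x) \<longlonglongrightarrow> u n x - w x"
      using AE_lim
    proof eventually_elim
      case (elim x)
      then have "(\<lambda>k. u (r (k + M)) x) \<longlonglongrightarrow> w x"
        by (rule LIMSEQ_ignore_initial_segment)
      then show ?case
        by (intro tendsto_intros)
    qed
    have "l2_norm (\<lambda>x. u n x - u (r (k + M)) x) \<le> e" for k
      using r(2) [of "k + M"] \<open>M \<le> n\<close> by (intro M) auto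
    then show ?thesis
      using l2_norm_fatou [OF square_integrable_diff [OF u u] _ *] by auto
  qed
  have "square_integrable (\<lambda>x. u (N 0) x - w x)"
    using tail [of "N 0" 1 "N 0"] N [of 0] by auto
  from square_integrable_diff [OF u [of "N 0"] this] have "square_integrable w"
    by simp
  moreover have "(\<lambda>n. l2_norm (\<lambda>x. u n x - w x)) \<longlonglongrightarrow> 0"
  proof (rule LIMSEQ_I)
    fix e :: real
    assume "0 < e"
    then obtain M where M: "\<And>m n. M \<le> m \<Longrightarrow> M \<le> n \<Longrightarrow> l2_norm (\<lambda>x. u m x - u n x) \<le> e / 2"
      using cauchy [rule_format, of "e / 2"] by auto
    have "norm (l2_norm (\<lambda>x. u n x - w x) - 0) < e" if "M \<le> n" for n
      using tail [OF M that] \<open>0 < e\<close> by auto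
    then show "\<exists>no. \<forall>n\<ge>no. norm (l2_norm (\<lambda>x. u n x - w x) - 0) < e"
      by blast
  qed
  ultimately show ?thesis
    using AE_lim by blast
qed

section \<open>Rellich compactness\<close>

lemma l1_le_l2:
  fixes u :: "'a::euclidean_space \<Rightarrow> complex"
  assumes u: "square_integrable u" and supp: "AE x in lborel. x \<notin> cball 0 R \<longrightarrow> u x = 0"
  shows "(LINT x|lborel. cmod (u x)) \<le> l2_norm u * l2_norm (indicator (cball (0::'a) R))"
proof -
  note [measurable] = square_integrable_borel [OF u]
  have ind: "square_integrable (indicator (cball (0::'a) R))"
    by (rule square_integrable_bounded_support [of _ 1 R]) (auto simp: indicator_def [abs_def])
  have abs: "square_integrable (\<lambda>x. complex_of_real (cmod (u x)))"
    using u by (simp add: square_integrable_def)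
  have "complex_of_real (LINT x|lborel. cmod (u x)) = (LINT x|lborel. complex_of_real (cmod (u x)))"
    by simp
  also have "\<dots> = (LINT x|lborel. complex_of_real (cmod (u x)) * cnj (indicator (cball 0 R) x))"
    by (rule integral_cong_AE) (use supp in \<open>auto simp: indicator_def\<close>)
  finally have "\<bar>LINT x|lborel. cmod (u x)\<bar> = cmod (LINT x|lborel. complex_of_real (cmod (u x)) * cnj (indicator (cball 0 R) x))"
    by (metis norm_of_real)
  also have "\<dots> \<le> l2_norm (\<lambda>x. complex_of_real (cmod (u x))) * l2_norm (indicator (cball (0::'a) R))"
    by (rule l2_cauchy_schwarz [OF abs ind])
  also have "l2_norm (\<lambda>x. complex_of_real (cmod (u x))) = l2_norm u"
    by (simp add: l2_norm_def)
  finally show ?thesis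
    by simp
qed

lemma fourier_integral_l2_bound:
  fixes u :: "'a::euclidean_space \<Rightarrow> complex"
  assumes u: "square_integrable u" and supp: "AE x in lborel. x \<notin> cball 0 R \<longrightarrow> u x = 0"
  shows "cmod (\<F> u \<xi>) \<le>
    (2 * pi) powr (- (real DIM('a) / 2)) * (l2_norm u * l2_norm (indicator (cball (0::'a) R)))"
  by (rule order_trans [OF fourier_integral_bound])
     (auto intro!: mult_left_mono l1_le_l2 square_integrable_bounded_support_integrable assms)

text \<open>
  On the support \<open>|x| \<le> R\<close> the phases \<open>exp (- i x \<bullet> \<xi>)\<close> are \<open>R\<close>-Lipschitz in \<open>\<xi>\<close>.
\<close>

lemma fourier_integral_lipschitz:
  fixes u :: "'a::euclidean_space \<Rightarrow> complex"
  assumes u: "square_integrable u" and supp: "AE x in lborel. x \<notin> cball 0 R \<longrightarrow> u x = 0"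
  shows "cmod (\<F> u \<xi> - \<F> u \<eta>) \<le>
    (2 * pi) powr (- (real DIM('a) / 2)) * (l2_norm u * l2_norm (indicator (cball (0::'a) R))) * \<bar>R\<bar> * norm (\<xi> - \<eta>)"
proof -
  define E where "E \<xi> x = exp (- (\<i> * complex_of_real (x \<bullet> \<xi>)))" for \<xi> x :: 'a
  have int: "integrable lborel u"
    by (rule square_integrable_bounded_support_integrable [OF u supp])
  note [measurable] = square_integrable_borel [OF u]
  have E: "cmod (E \<xi> x - E \<eta> x) \<le> norm x * norm (\<xi> - \<eta>)" for x
  proof -
    have "cmod (E \<xi> x - E \<eta> x) = cmod (exp (\<i> * complex_of_real (x \<bullet> (\<eta> - \<xi>))) - 1)"
    proof -
      have "E \<xi> x - E \<eta> x = E \<eta> x * (exp (\<i> * complex_of_real (x \<bullet> (\<eta> - \<xi>))) - 1)"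
        by (simp add: E_def algebra_simps inner_diff_right flip: exp_add)
      then show ?thesis
        by (simp add: norm_mult E_def)
    qed
    also have "\<dots> \<le> \<bar>x \<bullet> (\<eta> - \<xi>)\<bar>"
      using iexp_approx1 [of "x \<bullet> (\<eta> - \<xi>)" 0] by simp
    also have "\<dots> \<le> norm x * norm (\<eta> - \<xi>)"
      by (rule Cauchy_Schwarz_ineq2)
    finally show ?thesis
      by (simp add: norm_minus_commute)
  qed
  have "cmod ((LINT x|lborel. u x * E \<xi> x) - (LINT x|lborel. u x * E \<eta> x)) = cmod (LINT x|lborel. u x * E \<xi> x - u x * E \<eta> x)"
    by (subst Bochner_Integration.integral_diff) (auto simp: E_def intro!: fourier_kernel_integrable int)
  also have "\<dots> \<le> (LINT x|lborel. cmod (u x * E \<xi> x - u x * E \<eta> x))"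
    by (rule integral_norm_bound)
  also have "\<dots> \<le> (LINT x|lborel. cmod (u x) * (\<bar>R\<bar> * norm (\<xi> - \<eta>)))"
  proof (rule integral_mono_AE)
    show "integrable lborel (\<lambda>x. cmod (u x * E \<xi> x - u x * E \<eta> x))"
      by (intro integrable_norm Bochner_Integration.integrable_diff) (auto simp: E_def intro!: fourier_kernel_integrable int)
    show "integrable lborel (\<lambda>x. cmod (u x) * (\<bar>R\<bar> * norm (\<xi> - \<eta>)))"
      using int by simp
    show "AE x in lborel. cmod (u x * E \<xi> x - u x * E \<eta> x) \<le> cmod (u x) * (\<bar>R\<bar> * norm (\<xi> - \<eta>))"
      using supp
    proof eventually_elim
      case (elim x)
      show ?case
      proof (cases "x \<in> cball 0 R")
        case True
        then have "cmod (E \<xi> x - E \<eta> x) \<le> \<bar>R\<bar> * norm (\<xi> - \<eta>)"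
          by (intro order_trans [OF E] mult_right_mono) auto
        then have "cmod (u x * (E \<xi> x - E \<eta> x)) \<le> cmod (u x) * (\<bar>R\<bar> * norm (\<xi> - \<eta>))"
          by (simp add: norm_mult mult_left_mono)
        then show ?thesis
          by (simp add: right_diff_distrib)
      qed (use elim in auto)
    qed
  qed
  also have "\<dots> = (LINT x|lborel. cmod (u x)) * (\<bar>R\<bar> * norm (\<xi> - \<eta>))"
    by simp
  also have "\<dots> \<le> (l2_norm u * l2_norm (indicator (cball (0::'a) R))) * (\<bar>R\<bar> * norm (\<xi> - \<eta>))"
    by (intro mult_right_mono l1_le_l2 u supp) auto
  finally show ?thesis
    unfolding fourier_integral_def E_def
    by (simp add: norm_mult mult.assoc mult_left_mono flip: right_diff_distrib)
qed

text \<open>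
  A diagonal sequence converges on a countable dense set; equicontinuity does the rest.
\<close>

lemma pointwise_convergent_subsequence:
  fixes f :: "nat \<Rightarrow> 'a::euclidean_space \<Rightarrow> complex"
  assumes bound: "\<And>n x. cmod (f n x) \<le> M"
    and lip: "\<And>n x y. cmod (f n x - f n y) \<le> L * norm (x - y)"
  obtains r where "strict_mono r" "\<And>x. convergent (\<lambda>n. f (r n) x)"
proof -
  obtain T :: "'a set" where T: "countable T" "UNIV \<subseteq> closure T"
    using separable [of UNIV] by auto
  obtain r where r: "strict_mono r" "\<And>x. x \<in> T \<Longrightarrow> \<exists>l. (\<lambda>n. f (r n) x) \<longlonglongrightarrow> l"
    using function_convergent_subsequence [OF T(1), of f M] bound by metis
  have "Cauchy (\<lambda>n. f (r n) x)" for x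
  proof (rule metric_CauchyI)
    fix e :: real
    assume e: "0 < e"
    define d where "d = e / (3 * (\<bar>L\<bar> + 1))"
    have "0 < d"
      using e by (simp add: d_def)
    then obtain y where y: "y \<in> T" "dist y x < d"
      using T(2) by (metis UNIV_I closure_approachable subsetD)
    have near: "cmod (f n x - f n y) \<le> e / 3" for n
    proof -
      have "cmod (f n x - f n y) \<le> (\<bar>L\<bar> + 1) * d"
        using y(2) by (intro order_trans [OF lip] mult_mono) (auto simp: dist_norm norm_minus_commute)
      also have "(\<bar>L\<bar> + 1) * d = e / 3"
        using abs_ge_zero [of L] by (simp add: d_def divide_simps)
      finally show ?thesis .
    qed
    have "Cauchy (\<lambda>n. f (r n) y)"
      using r(2) [OF y(1)] LIMSEQ_imp_Cauchy by blast
    then obtain N where N: "\<And>m n. N \<le> m \<Longrightarrow> N \<le> n \<Longrightarrow> dist (f (r m) y) (f (r n) y) < e / 3"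
      using e metric_CauchyD [of "\<lambda>n. f (r n) y" "e / 3"] by auto
    have "dist (f (r m) x) (f (r n) x) < e" if "N \<le> m" "N \<le> n" for m n
      using norm_triangle_ineq [of "f (r m) x - f (r m) y" "f (r m) y - f (r n) x"]
        norm_triangle_ineq [of "f (r m) y - f (r n) y" "f (r n) y - f (r n) x"]
        near [of "r m"] near [of "r n"] N [OF that]
      by (simp add: dist_norm norm_minus_commute)
    then show "\<exists>N. \<forall>m\<ge>N. \<forall>n\<ge>N. dist (f (r m) x) (f (r n) x) < e"
      by blast
  qed
  then have "convergent (\<lambda>n. f (r n) x)" for x
    by (rule Cauchy_convergent)
  with r(1) show thesis
    by (rule that)
qed

text \<open>
  The squared norm of this function is the energy of order \<open>\<alpha>\<close>.  With half of the weight attached to each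
  factor, energies and forms are norms and inner products of \<open>L\<^sup>2\<close>.
\<close>

definition weighted_fourier :: "real \<Rightarrow> ('a::euclidean_space \<Rightarrow> complex) \<Rightarrow> 'a \<Rightarrow> complex" ("\<W>") where
  "\<W> \<alpha> u \<xi> = complex_of_real (norm \<xi> powr (\<alpha> / 2)) * \<F> u \<xi>"

lemma weighted_fourier_measurable [measurable]:
  assumes [measurable]: "u \<in> borel_measurable borel"
  shows "\<W> \<alpha> u \<in> borel_measurable borel"
  unfolding weighted_fourier_def by measurable

lemma weighted_fourier_linear:
  assumes "integrable lborel u" "integrable lborel v"
  shows "\<W> \<alpha> (\<lambda>x. u x + c * v x) \<xi> = \<W> \<alpha> u \<xi> + c * \<W> \<alpha> v \<xi>"
  by (simp add: weighted_fourier_def fourier_integral_linear [OF assms] algebra_simps)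

lemma weighted_fourier_diff:
  assumes "integrable lborel u" "integrable lborel v"
  shows "\<W> \<alpha> (\<lambda>x. u x - v x) \<xi> = \<W> \<alpha> u \<xi> - \<W> \<alpha> v \<xi>"
  using weighted_fourier_linear [OF assms, of \<alpha> "-1"] by simp

text \<open>
  Low frequencies converge by dominated convergence, high frequencies are controlled by the energy:
  beyond the radius \<open>\<rho>\<close>, the weight \<open>|\<xi>|\<^sup>\<alpha>\<close> is at least \<open>\<rho>\<^sup>\<alpha>\<close>.  Plancherel's theorem transfers the Cauchy property
  from the Fourier integrals back to the functions.
\<close>

theorem rellich:
  fixes u :: "nat \<Rightarrow> 'a::euclidean_space \<Rightarrow> complex"
  assumes u: "\<And>n. square_integrable (u n)" and supp: "\<And>n. AE x in lborel. x \<notin> cball 0 R \<longrightarrow> u n x = 0"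
    and \<alpha>: "0 < \<alpha>" and w: "\<And>n. square_integrable (\<W> \<alpha> (u n))"
    and bound: "\<And>n. l2_norm (u n) \<le> C" and K: "\<And>n. l2_norm (\<W> \<alpha> (u n)) \<le> K"
  shows "\<exists>r::nat \<Rightarrow> nat. strict_mono r \<and>
    (\<forall>e>0. \<exists>N. \<forall>m\<ge>N. \<forall>n\<ge>N. l2_norm (\<lambda>x. u (r m) x - u (r n) x) \<le> e)"
proof -
  define M where "M = (2 * pi) powr (- (real DIM('a) / 2)) * (C * l2_norm (indicator (cball (0::'a) R)))"
  have int: "integrable lborel (u n)" for n
    by (rule square_integrable_bounded_support_integrable [OF u supp])
  note [measurable] = square_integrable_borel [OF u]
  have F_bound: "cmod (\<F> (u n) \<xi>) \<le> M" for n \<xi>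
    unfolding M_def
    by (intro order_trans [OF fourier_integral_l2_bound [OF u supp]] mult_left_mono mult_right_mono bound) auto
  have F_lip: "cmod (\<F> (u n) \<xi> - \<F> (u n) \<eta>) \<le> M * \<bar>R\<bar> * norm (\<xi> - \<eta>)" for n \<xi> \<eta>
    unfolding M_def
    by (intro order_trans [OF fourier_integral_lipschitz [OF u supp]] mult_left_mono mult_right_mono bound) auto
  obtain r where r: "strict_mono r" "\<And>\<xi>. convergent (\<lambda>n. \<F> (u (r n)) \<xi>)"
    by (rule pointwise_convergent_subsequence [of "\<lambda>n. \<F> (u n)", OF F_bound F_lip], rule that)
  define g where "g \<xi> = lim (\<lambda>n. \<F> (u (r n)) \<xi>)" for \<xi>
  have g_lim: "(\<lambda>n. \<F> (u (r n)) \<xi>) \<longlonglongrightarrow> g \<xi>" for \<xi>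
    using r(2) by (simp add: g_def convergent_LIMSEQ_iff)
  have g_bound: "cmod (g \<xi>) \<le> M" for \<xi>
    by (rule Lim_norm_ubound [OF _ g_lim]) (auto simp: F_bound)
  have [measurable]: "g \<in> borel_measurable borel"
    unfolding g_def by measurable
  have "\<exists>N. \<forall>m\<ge>N. \<forall>n\<ge>N. l2_norm (\<lambda>x. u (r m) x - u (r n) x) \<le> e" if e: "0 < e" for e
  proof -
    obtain \<rho> where \<rho>: "0 < \<rho>" "\<rho> powr (- \<alpha>) * (2 * K)\<^sup>2 \<le> e\<^sup>2 / 2"
    proof -
      have "((\<lambda>\<rho>. \<rho> powr (- \<alpha>) * (2 * K)\<^sup>2) \<longlongrightarrow> 0 * (2 * K)\<^sup>2) at_top"
        using \<alpha> by (intro tendsto_intros tendsto_neg_powr) (auto simp: filterlim_ident)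
      then have "\<forall>\<^sub>F \<rho> in at_top. \<rho> powr (- \<alpha>) * (2 * K)\<^sup>2 < e\<^sup>2 / 2"
        using e by (intro order_tendstoD) auto
      then have "\<forall>\<^sub>F \<rho> in at_top. \<rho> powr (- \<alpha>) * (2 * K)\<^sup>2 < e\<^sup>2 / 2 \<and> 0 < \<rho>"
        by (intro eventually_conj eventually_gt_at_top)
      then show thesis
        using that by (metis (no_types, lifting) eventually_happens' less_imp_le trivial_limit_at_top_linorder)
    qed
    \<comment> \<open>The low frequency parts and their pointwise limit.\<close>
    define G where "G n \<xi> = indicator (cball 0 \<rho>) \<xi> * \<F> (u (r n)) \<xi>" for n \<xi>
    define G' where "G' \<xi> = indicator (cball 0 \<rho>) \<xi> * g \<xi>" for \<xi>
    have [measurable]: "cball (0::'a) \<rho> \<in> sets borel"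
      by simp
    have [measurable]: "G n \<in> borel_measurable borel" "G' \<in> borel_measurable borel" for n
      unfolding G_def [abs_def] G'_def [abs_def] by measurable
    have M: "0 \<le> M"
      using F_bound norm_ge_zero order_trans by blast
    have G_sq: "square_integrable (G n)" "square_integrable G'" for n
      by (rule square_integrable_bounded_support [of _ M \<rho>];
          use F_bound g_bound M in \<open>auto simp: G_def G'_def indicator_def norm_mult\<close>)+
    have "(\<lambda>n. l2_norm (\<lambda>\<xi>. G n \<xi> - G' \<xi>)) \<longlonglongrightarrow> 0"
    proof (rule l2_norm_tendsto_zero)
      show "integrable lborel (\<lambda>x::'a. (2 * M)\<^sup>2 * indicator (cball 0 \<rho>) x :: real)"
        by (rule integrable_indicator_cball)
      have "cmod (\<F> (u (r n)) \<xi> - g \<xi>) \<le> 2 * M" for n \<xi>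
        using norm_triangle_ineq4 [of "\<F> (u (r n)) \<xi>" "g \<xi>"] F_bound [of "r n" \<xi>] g_bound [of \<xi>]
        by linarith
      from power_mono [OF this norm_ge_zero, of _ _ 2]
      show "(cmod (G n \<xi> - G' \<xi>))\<^sup>2 \<le> (2 * M)\<^sup>2 * indicator (cball 0 \<rho>) \<xi>" for n \<xi>
        by (cases "\<xi> \<in> cball 0 \<rho>") (auto simp: G_def G'_def simp del: mem_cball)
      show "AE \<xi> in lborel. (\<lambda>n. G n \<xi>) \<longlonglongrightarrow> G' \<xi>"
        unfolding G_def G'_def by (intro AE_I2 tendsto_intros g_lim)
    qed auto
    then have "\<forall>\<^sub>F n in sequentially. l2_norm (\<lambda>\<xi>. G n \<xi> - G' \<xi>) < e / 4"
      using e by (intro order_tendstoD) auto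
    then obtain N where N: "\<And>n. N \<le> n \<Longrightarrow> l2_norm (\<lambda>\<xi>. G n \<xi> - G' \<xi>) < e / 4"
      by (auto simp: eventually_sequentially)
    have "l2_norm (\<lambda>x. u (r m) x - u (r n) x) \<le> e" if "N \<le> m" "N \<le> n" for m n
    proof (rule power2_le_imp_le)
      define v where "v x = u (r m) x - u (r n) x" for x
      have v: "square_integrable v"
        unfolding v_def by (intro square_integrable_diff u)
      have v_supp: "AE x in lborel. x \<notin> cball 0 R \<longrightarrow> v x = 0"
        using supp [of "r m"] supp [of "r n"] by eventually_elim (auto simp: v_def)
      have F_v: "\<F> v \<xi> = \<F> (u (r m)) \<xi> - \<F> (u (r n)) \<xi>" for \<xi>
        unfolding v_def by (intro fourier_integral_diff int)
      have W_v: "\<W> \<alpha> v = (\<lambda>\<xi>. \<W> \<alpha> (u (r m)) \<xi> - \<W> \<alpha> (u (r n)) \<xi>)"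
        unfolding v_def by (intro ext weighted_fourier_diff int)
      have W_sq: "square_integrable (\<W> \<alpha> v)"
        unfolding W_v by (intro square_integrable_diff w)
      have "l2_norm (\<W> \<alpha> v) \<le> 2 * K"
        using l2_norm_triangle [OF w [of "r m"] square_integrable_cmult [OF w [of "r n"], of "-1"]] K [of "r m"] K [of "r n"]
        unfolding W_v by (simp add: l2_norm_def)
      then have W_le: "(l2_norm (\<W> \<alpha> v))\<^sup>2 \<le> (2 * K)\<^sup>2"
        by (intro power_mono) auto
      have G_eq: "G m \<xi> - G n \<xi> = indicator (cball 0 \<rho>) \<xi> * \<F> v \<xi>" for \<xi>
        by (simp add: G_def F_v algebra_simps)
      have "l2_norm (\<lambda>\<xi>. G m \<xi> - G n \<xi>) \<le> l2_norm (\<lambda>\<xi>. G m \<xi> - G' \<xi>) + l2_norm (\<lambda>\<xi>. G' \<xi> - G n \<xi>)"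
        using l2_norm_triangle [OF square_integrable_diff [OF G_sq(1) G_sq(2), of m] square_integrable_diff [OF G_sq(2) G_sq(1), of n]]
        by simp
      then have "l2_norm (\<lambda>\<xi>. G m \<xi> - G n \<xi>) \<le> e / 2"
        using N [of m] N [of n] that l2_norm_diff_commute [of G' "G n"] by simp
      then have G_le: "(l2_norm (\<lambda>\<xi>. G m \<xi> - G n \<xi>))\<^sup>2 \<le> (e / 2)\<^sup>2"
        by (intro power_mono) auto
      have split: "(cmod (\<F> v \<xi>))\<^sup>2 \<le> (cmod (G m \<xi> - G n \<xi>))\<^sup>2 + \<rho> powr (- \<alpha>) * (cmod (\<W> \<alpha> v \<xi>))\<^sup>2" for \<xi>
      proof (cases "\<xi> \<in> cball 0 \<rho>")
        case True
        then show ?thesis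
          by (simp add: G_eq del: mem_cball)
      next
        case False
        have "1 = \<rho> powr (- \<alpha>) * \<rho> powr \<alpha>"
          using \<rho>(1) by (simp flip: powr_add)
        also have "\<dots> \<le> \<rho> powr (- \<alpha>) * norm \<xi> powr \<alpha>"
          using False \<rho>(1) \<alpha> by (intro mult_left_mono powr_mono2) auto
        also have "norm \<xi> powr \<alpha> = (norm \<xi> powr (\<alpha> / 2))\<^sup>2"
          by (simp add: power2_eq_square flip: powr_add)
        finally have "1 * (cmod (\<F> v \<xi>))\<^sup>2 \<le> \<rho> powr (- \<alpha>) * (norm \<xi> powr (\<alpha> / 2))\<^sup>2 * (cmod (\<F> v \<xi>))\<^sup>2"
          by (intro mult_right_mono) auto
        also have "\<dots> = \<rho> powr (- \<alpha>) * (cmod (\<W> \<alpha> v \<xi>))\<^sup>2"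
          by (simp add: weighted_fourier_def norm_mult power_mult_distrib)
        finally show ?thesis
          by (simp add: add_increasing)
      qed
      have "(l2_norm v)\<^sup>2 = (l2_norm (\<F> v))\<^sup>2"
        by (simp add: plancherel [OF v v_supp])
      also have "\<dots> = (LINT \<xi>|lborel. (cmod (\<F> v \<xi>))\<^sup>2)"
        by (rule l2_norm_squared)
      also have "\<dots> \<le> (LINT \<xi>|lborel. (cmod (G m \<xi> - G n \<xi>))\<^sup>2 + \<rho> powr (- \<alpha>) * (cmod (\<W> \<alpha> v \<xi>))\<^sup>2)"
      proof (rule integral_mono)
        show "integrable lborel (\<lambda>\<xi>. (cmod (\<F> v \<xi>))\<^sup>2)"
          using fourier_integral_square_integrable(1) [OF square_integrable_bounded_support_integrable [OF v v_supp] v]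
          by (simp add: square_integrable_def)
        show "integrable lborel (\<lambda>\<xi>. (cmod (G m \<xi> - G n \<xi>))\<^sup>2 + \<rho> powr (- \<alpha>) * (cmod (\<W> \<alpha> v \<xi>))\<^sup>2)"
          using square_integrable_diff [OF G_sq(1) G_sq(1), of m n] W_sq by (simp add: square_integrable_def)
      qed (rule split)
      also have "\<dots> = (l2_norm (\<lambda>\<xi>. G m \<xi> - G n \<xi>))\<^sup>2 + \<rho> powr (- \<alpha>) * (l2_norm (\<W> \<alpha> v))\<^sup>2"
        using square_integrable_diff [OF G_sq(1) G_sq(1), of m n] W_sq
        by (simp add: square_integrable_def l2_norm_squared)
      also have "\<dots> \<le> (e / 2)\<^sup>2 + \<rho> powr (- \<alpha>) * (2 * K)\<^sup>2"
        by (intro add_mono G_le mult_left_mono W_le) auto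
      also have "\<dots> \<le> (e / 2)\<^sup>2 + e\<^sup>2 / 2"
        using \<rho>(2) by simp
      also have "\<dots> \<le> e\<^sup>2"
        by (simp add: power2_eq_square)
      finally show "(l2_norm (\<lambda>x. u (r m) x - u (r n) x))\<^sup>2 \<le> e\<^sup>2"
        by (simp add: v_def [abs_def])
    qed (use e in simp)
    then show ?thesis
      by blast
  qed
  with r(1) show ?thesis
    by blast
qed

section \<open>The form domain\<close>

text \<open>
  Truncation to a ball that contains the support changes nothing, so the mean square limit is that
  of a constant family, and any two limits agree almost everywhere.
\<close>

lemma fourier_transform_bounded_support:
  fixes u :: "'a::euclidean_space \<Rightarrow> complex"
  assumes u: "square_integrable u" and supp: "AE x in lborel. x \<notin> cball 0 R \<longrightarrow> u x = 0"
  shows "fourier_transform u \<in> borel_measurable lborel"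
    and "AE \<xi> in lborel. fourier_transform u \<xi> = \<F> u \<xi>" (is ?P1)
proof -
  note [measurable] = square_integrable_borel [OF u]
  have cut: "\<F> (\<lambda>x. indicator (cball 0 S) x *\<^sub>R u x) = \<F> u" if "R \<le> S" for S
  proof (rule fourier_integral_cong_AE)
    have [measurable]: "cball (0::'a) S \<in> sets borel"
      by simp
    show "(\<lambda>x. indicator (cball 0 S) x *\<^sub>R u x) \<in> borel_measurable lborel"
      by measurable
    show "AE x in lborel. indicator (cball 0 S) x *\<^sub>R u x = u x"
      using supp by eventually_elim (use that in \<open>auto simp: indicator_def\<close>)
  qed simp
  have ev: "\<forall>\<^sub>F S in at_top. (\<integral>\<^sup>+ \<xi>. ennreal ((cmod (\<F> (\<lambda>x. indicator (cball 0 S) x *\<^sub>R u x) \<xi> - g \<xi>))\<^sup>2) \<partial>lborel)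
      = (\<integral>\<^sup>+ \<xi>. ennreal ((cmod (\<F> u \<xi> - g \<xi>))\<^sup>2) \<partial>lborel)" for g
    using eventually_ge_at_top [of R] by eventually_elim (simp add: cut)
  have has_iff: "has_fourier_transform u g \<longleftrightarrow>
      square_integrable g \<and> (\<integral>\<^sup>+ \<xi>. ennreal ((cmod (\<F> u \<xi> - g \<xi>))\<^sup>2) \<partial>lborel) = 0" for g
    unfolding has_fourier_transform_def tendsto_cong [OF ev] by (simp add: tendsto_const_iff)
  have "has_fourier_transform u (\<F> u)"
    unfolding has_iff
    using fourier_integral_square_integrable(1) [OF square_integrable_bounded_support_integrable [OF u supp] u]
    by simp
  then have "has_fourier_transform u (fourier_transform u)"
    unfolding fourier_transform_def by (rule someI [of "has_fourier_transform u"])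
  then have sq: "square_integrable (fourier_transform u)"
    and zero: "(\<integral>\<^sup>+ \<xi>. ennreal ((cmod (\<F> u \<xi> - fourier_transform u \<xi>))\<^sup>2) \<partial>lborel) = 0"
    by (simp_all add: has_iff)
  from sq show [measurable]: "fourier_transform u \<in> borel_measurable lborel"
    by (simp add: square_integrable_def)
  have "AE \<xi> in lborel. ennreal ((cmod (\<F> u \<xi> - fourier_transform u \<xi>))\<^sup>2) = 0"
    using zero by (subst (asm) nn_integral_0_iff_AE) auto
  then show ?P1
    by eventually_elim simp
qed

lemma powr_half_squared: "(x powr (a / 2))\<^sup>2 = (x::real) powr a"
  by (simp add: power2_eq_square flip: powr_add)

lemma cmod_weighted_fourier_squared:
  "(cmod (\<W> \<alpha> u \<xi>))\<^sup>2 = norm \<xi> powr \<alpha> * (cmod (\<F> u \<xi>))\<^sup>2"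
  by (simp add: weighted_fourier_def norm_mult power_mult_distrib powr_half_squared)

lemma one_plus_powr_le:
  fixes y s :: real
  assumes "0 \<le> y" "0 \<le> s"
  shows "(1 + y) powr s \<le> 2 powr s * (1 + y powr s)"
proof -
  have "(1 + y) powr s \<le> (2 * max 1 y) powr s"
    using assms by (intro powr_mono2) auto
  also have "\<dots> = 2 powr s * max 1 y powr s"
    by (rule powr_mult)
  also have "\<dots> \<le> 2 powr s * (1 + y powr s)"
    by (intro mult_left_mono) (auto simp: max_def)
  finally show ?thesis .
qed

text \<open>
  The Bessel weight \<open>(1 + |\<xi>|\<^sup>2)\<close> to the power \<open>\<alpha>/2\<close> is comparable to \<open>1 + |\<xi>|\<^sup>\<alpha>\<close>, and the contribution of the \<open>1\<close> is finite by
  Bessel's inequality.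
\<close>

lemma sobolev_space_0_iff:
  fixes \<Omega> :: "'a::euclidean_space set"
  assumes \<Omega>: "\<Omega> \<subseteq> cball 0 R" and \<alpha>: "0 < \<alpha>"
  shows "u \<in> sobolev_space_0 (\<alpha> / 2) \<Omega> \<longleftrightarrow>
    square_integrable u \<and> (AE x in lborel. x \<notin> \<Omega> \<longrightarrow> u x = 0) \<and> square_integrable (\<W> \<alpha> u)"
proof -
  have "integrable lborel (\<lambda>\<xi>. (1 + (norm \<xi>)\<^sup>2) powr (\<alpha> / 2) * (cmod (fourier_transform u \<xi>))\<^sup>2) \<longleftrightarrow>
      square_integrable (\<W> \<alpha> u)"
    if u: "square_integrable u" and supp: "AE x in lborel. x \<notin> \<Omega> \<longrightarrow> u x = 0"
  proof -
    note [measurable] = square_integrable_borel [OF u]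
    have supp': "AE x in lborel. x \<notin> cball 0 R \<longrightarrow> u x = 0"
      using supp by eventually_elim (use \<Omega> in auto)
    note ft = fourier_transform_bounded_support [OF u supp']
    note [measurable] = ft(1)
    have pow: "norm \<xi> powr \<alpha> = (norm \<xi>)\<^sup>2 powr (\<alpha> / 2)" for \<xi> :: 'a
      by (cases "\<xi> = 0") (auto simp: powr_powr simp flip: powr_numeral)
    have "integrable lborel (\<lambda>\<xi>. (1 + (norm \<xi>)\<^sup>2) powr (\<alpha> / 2) * (cmod (fourier_transform u \<xi>))\<^sup>2) \<longleftrightarrow>
       integrable lborel (\<lambda>\<xi>. (1 + (norm \<xi>)\<^sup>2) powr (\<alpha> / 2) * (cmod (\<F> u \<xi>))\<^sup>2)"
      by (rule integrable_cong_AE) (use ft(2) in auto)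
    also have "\<dots> \<longleftrightarrow> integrable lborel (\<lambda>\<xi>. (cmod (\<W> \<alpha> u \<xi>))\<^sup>2)"
    proof
      assume "integrable lborel (\<lambda>\<xi>. (1 + (norm \<xi>)\<^sup>2) powr (\<alpha> / 2) * (cmod (\<F> u \<xi>))\<^sup>2)"
      then show "integrable lborel (\<lambda>\<xi>. (cmod (\<W> \<alpha> u \<xi>))\<^sup>2)"
        by (rule Bochner_Integration.integrable_bound)
           (use \<alpha> in \<open>auto simp: cmod_weighted_fourier_squared pow intro!: AE_I2 mult_right_mono powr_mono2\<close>)
    next
      assume 1: "integrable lborel (\<lambda>\<xi>. (cmod (\<W> \<alpha> u \<xi>))\<^sup>2)"
      have 2: "integrable lborel (\<lambda>\<xi>. (cmod (\<F> u \<xi>))\<^sup>2)"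
        using fourier_integral_square_integrable(1) [OF square_integrable_bounded_support_integrable [OF u supp'] u]
        by (simp add: square_integrable_def)
      have "integrable lborel (\<lambda>\<xi>. 2 powr (\<alpha> / 2) * ((cmod (\<F> u \<xi>))\<^sup>2 + (cmod (\<W> \<alpha> u \<xi>))\<^sup>2))"
        by (intro integrable_mult_right Bochner_Integration.integrable_add 1 2)
      then show "integrable lborel (\<lambda>\<xi>. (1 + (norm \<xi>)\<^sup>2) powr (\<alpha> / 2) * (cmod (\<F> u \<xi>))\<^sup>2)"
      proof (rule Bochner_Integration.integrable_bound)
        have "(1 + (norm \<xi>)\<^sup>2) powr (\<alpha> / 2) * (cmod (\<F> u \<xi>))\<^sup>2 \<le>
           2 powr (\<alpha> / 2) * (1 + (norm \<xi>)\<^sup>2 powr (\<alpha> / 2)) * (cmod (\<F> u \<xi>))\<^sup>2" for \<xi>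
          using \<alpha> by (intro mult_right_mono one_plus_powr_le) auto
        then show "AE \<xi> in lborel. norm ((1 + (norm \<xi>)\<^sup>2) powr (\<alpha> / 2) * (cmod (\<F> u \<xi>))\<^sup>2) \<le>
          norm (2 powr (\<alpha> / 2) * ((cmod (\<F> u \<xi>))\<^sup>2 + (cmod (\<W> \<alpha> u \<xi>))\<^sup>2))"
          by (auto simp: cmod_weighted_fourier_squared pow algebra_simps intro!: AE_I2)
      qed measurable
    qed
    finally show ?thesis
      by (simp add: square_integrable_def)
  qed
  then show ?thesis
    by (auto simp: sobolev_space_0_def sobolev_space_def)
qed

lemma frac_laplacian_form_eq:
  fixes \<Omega> :: "'a::euclidean_space set"
  assumes \<Omega>: "\<Omega> \<subseteq> cball 0 R" and \<alpha>: "0 < \<alpha>"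
    and u: "u \<in> sobolev_space_0 (\<alpha> / 2) \<Omega>" and v: "v \<in> sobolev_space_0 (\<alpha> / 2) \<Omega>"
  shows "frac_laplacian_form \<alpha> u v = (LINT \<xi>|lborel. \<W> \<alpha> u \<xi> * cnj (\<W> \<alpha> v \<xi>))"
proof -
  have supp: "AE x in lborel. x \<notin> cball 0 R \<longrightarrow> f x = 0" "square_integrable f" if "f \<in> sobolev_space_0 (\<alpha> / 2) \<Omega>" for f
  proof -
    have "AE x in lborel. x \<notin> \<Omega> \<longrightarrow> f x = 0"
      using that by (simp add: sobolev_space_0_def)
    then show "AE x in lborel. x \<notin> cball 0 R \<longrightarrow> f x = 0"
      by eventually_elim (use \<Omega> in auto)
    show "square_integrable f"
      using that by (simp add: sobolev_space_0_def sobolev_space_def)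
  qed
  note ft_u = fourier_transform_bounded_support [OF supp(2,1) [OF u]]
  note ft_v = fourier_transform_bounded_support [OF supp(2,1) [OF v]]
  note [measurable] = ft_u(1) ft_v(1)
  have [measurable]: "u \<in> borel_measurable borel" "v \<in> borel_measurable borel"
    using supp(2) [OF u] supp(2) [OF v] by (auto simp: square_integrable_def)
  have pow: "complex_of_real (norm \<xi> powr \<alpha>) = complex_of_real (norm \<xi> powr (\<alpha> / 2)) * complex_of_real (norm \<xi> powr (\<alpha> / 2))" for \<xi> :: 'a
    unfolding of_real_mult [symmetric] powr_half_squared [of "norm \<xi>" \<alpha>, symmetric] power2_eq_square ..
  show ?thesis
    unfolding frac_laplacian_form_def
  proof (rule integral_cong_AE)
    show "AE \<xi> in lborel. complex_of_real (norm \<xi> powr \<alpha>) * fourier_transform u \<xi> * cnj (fourier_transform v \<xi>) =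
      \<W> \<alpha> u \<xi> * cnj (\<W> \<alpha> v \<xi>)"
      using ft_u(2) ft_v(2) by eventually_elim (simp add: weighted_fourier_def pow)
  qed measurable
qed

section \<open>The variational principle for the first eigenvalue\<close>

lemma l2_norm_cmult: "l2_norm (\<lambda>x. c * u x) = cmod c * l2_norm u"
  by (simp add: l2_norm_def norm_mult power_mult_distrib real_sqrt_mult)

lemma l2_norm_eq_0_iff:
  assumes "square_integrable u"
  shows "l2_norm u = 0 \<longleftrightarrow> (AE x in lborel. u x = 0)"
  using assms integral_nonneg_eq_0_iff_AE [of lborel "\<lambda>x. (cmod (u x))\<^sup>2"]
  by (simp add: l2_norm_def square_integrable_def)

lemma inner_self_eq_l2_norm: "(LINT x|lborel. u x * cnj (u x)) = complex_of_real ((l2_norm u)\<^sup>2)"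
  using autocorrelation_zero [of u] by (simp add: autocorrelation_def)

lemma sobolev_space_0_closed:
  fixes \<Omega> :: "'a::euclidean_space set"
  assumes \<Omega>: "\<Omega> \<subseteq> cball 0 R" and \<alpha>: "0 < \<alpha>"
    and u: "u \<in> sobolev_space_0 (\<alpha> / 2) \<Omega>" and v: "v \<in> sobolev_space_0 (\<alpha> / 2) \<Omega>"
  shows "(\<lambda>x. u x + c * v x) \<in> sobolev_space_0 (\<alpha> / 2) \<Omega>" (is ?P1)
    and "\<W> \<alpha> (\<lambda>x. u x + c * v x) = (\<lambda>\<xi>. \<W> \<alpha> u \<xi> + c * \<W> \<alpha> v \<xi>)"
proof -
  note iff = sobolev_space_0_iff [OF \<Omega> \<alpha>]
  have int: "integrable lborel f" if "f \<in> sobolev_space_0 (\<alpha> / 2) \<Omega>" for f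
  proof (rule square_integrable_bounded_support_integrable)
    have "AE x in lborel. x \<notin> \<Omega> \<longrightarrow> f x = 0"
      using that by (simp add: iff)
    then show "AE x in lborel. x \<notin> cball 0 R \<longrightarrow> f x = 0"
      by eventually_elim (use \<Omega> in auto)
  qed (use that iff in auto)
  show W: "\<W> \<alpha> (\<lambda>x. u x + c * v x) = (\<lambda>\<xi>. \<W> \<alpha> u \<xi> + c * \<W> \<alpha> v \<xi>)"
    by (intro ext weighted_fourier_linear int u v)
  have "AE x in lborel. x \<notin> \<Omega> \<longrightarrow> u x = 0" "AE x in lborel. x \<notin> \<Omega> \<longrightarrow> v x = 0"
    using u v by (auto simp: iff)
  then have "AE x in lborel. x \<notin> \<Omega> \<longrightarrow> u x + c * v x = 0"
    by eventually_elim auto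
  then show ?P1
    using u v unfolding iff W by (auto intro!: square_integrable_add square_integrable_cmult)
qed

text \<open>
  The direct method.  By \<open>rellich\<close> a minimizing sequence of normalized functions has a subsequence
  converging in \<open>L\<^sup>2\<close>, so the limit is again normalized.  Its support stays bounded, hence its Fourier
  integral is the pointwise limit, and Fatou's lemma bounds the energy.
\<close>

theorem rayleigh_minimizer:
  fixes \<Omega> :: "'a::euclidean_space set"
  assumes \<Omega>: "\<Omega> \<subseteq> cball 0 R" and \<alpha>: "0 < \<alpha>"
    and w: "w \<in> sobolev_space_0 (\<alpha> / 2) \<Omega>" "l2_norm w \<noteq> 0"
  obtains u where "u \<in> sobolev_space_0 (\<alpha> / 2) \<Omega>" "l2_norm u = 1"
    "\<And>v. v \<in> sobolev_space_0 (\<alpha> / 2) \<Omega> \<Longrightarrow>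
       l2_norm (\<W> \<alpha> u) * l2_norm v \<le> l2_norm (\<W> \<alpha> v)"
proof -
  define H where "H = sobolev_space_0 (\<alpha> / 2) \<Omega>"
  note iff = sobolev_space_0_iff [OF \<Omega> \<alpha>, folded H_def]
  define S where "S = {l2_norm (\<W> \<alpha> u) |u. u \<in> H \<and> l2_norm u = 1}"
  define m where "m = Inf S"
  have zero: "(\<lambda>_. 0) \<in> H"
    by (auto simp: iff square_integrable_def weighted_fourier_def [abs_def] fourier_integral_def)
  have scale: "(\<lambda>x. c * v x) \<in> H \<and> \<W> \<alpha> (\<lambda>x. c * v x) = (\<lambda>\<xi>. c * \<W> \<alpha> v \<xi>)" if "v \<in> H" for c v
    using sobolev_space_0_closed [OF \<Omega> \<alpha>, folded H_def, OF zero that, of c]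
    by (auto simp: weighted_fourier_def [abs_def] fourier_integral_def)
  have normalize: "l2_norm (\<W> \<alpha> v) / l2_norm v \<in> S" if "v \<in> H" "l2_norm v \<noteq> 0" for v
  proof -
    define c where "c = complex_of_real (1 / l2_norm v)"
    have "l2_norm (\<lambda>x. c * v x) = 1"
      "l2_norm (\<W> \<alpha> (\<lambda>x. c * v x)) = l2_norm (\<W> \<alpha> v) / l2_norm v"
      using that(2) unfolding scale [OF that(1), of c, THEN conjunct2] l2_norm_cmult
      by (simp_all add: c_def norm_divide)
    then show ?thesis
      unfolding S_def using scale [OF that(1), of c] by force
  qed
  have S: "S \<noteq> {}"
    using normalize [of w] w by (auto simp: H_def)
  have S_bdd: "bdd_below S"
    by (rule bdd_belowI [of _ 0]) (auto simp: S_def)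
  have m_le: "m * l2_norm v \<le> l2_norm (\<W> \<alpha> v)" if "v \<in> H" for v
  proof (cases "l2_norm v = 0")
    case False
    have "m \<le> l2_norm (\<W> \<alpha> v) / l2_norm v"
      unfolding m_def by (intro cInf_lower S_bdd normalize that False)
    then show ?thesis
      using False by (simp add: pos_le_divide_eq less_le)
  qed simp
  have "\<exists>u. u \<in> H \<and> l2_norm u = 1 \<and> l2_norm (\<W> \<alpha> u) < m + 1 / real (Suc n)" for n
  proof -
    have "\<exists>s\<in>S. s < m + 1 / real (Suc n)"
      unfolding m_def by (subst cInf_less_iff [symmetric]) (auto simp: S S_bdd)
    then show ?thesis
      by (auto simp: S_def)
  qed
  then obtain u where u: "u n \<in> H" "l2_norm (u n) = 1" "l2_norm (\<W> \<alpha> (u n)) < m + 1 / real (Suc n)" for n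
    by metis
  have supp: "AE x in lborel. x \<notin> cball 0 R \<longrightarrow> f x = 0" if "AE x in lborel. x \<notin> \<Omega> \<longrightarrow> f x = (0::complex)" for f
    using that by eventually_elim (use \<Omega> in auto)
  have u_iff: "square_integrable (u n)" "AE x in lborel. x \<notin> \<Omega> \<longrightarrow> u n x = 0" "square_integrable (\<W> \<alpha> (u n))" for n
    using u(1) [of n] by (auto simp: iff)
  have K: "l2_norm (\<W> \<alpha> (u n)) \<le> m + 1" for n
    using less_imp_le [OF u(3) [of n]] by (rule order_trans) simp
  obtain r :: "nat \<Rightarrow> nat" where r: "strict_mono r"
    and cauchy: "\<forall>e>0. \<exists>N. \<forall>m\<ge>N. \<forall>n\<ge>N. l2_norm (\<lambda>x. u (r m) x - u (r n) x) \<le> e"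
    using rellich [of u, OF u_iff(1) supp [OF u_iff(2)] \<alpha> u_iff(3) eq_refl [OF u(2)] K] by blast
  obtain f s where f: "square_integrable f" and lim: "(\<lambda>n. l2_norm (\<lambda>x. u (r n) x - f x)) \<longlonglongrightarrow> 0"
    and AE_lim: "AE x in lborel. (\<lambda>k. u (r (s k)) x) \<longlonglongrightarrow> f x"
    using l2_complete [of "\<lambda>n. u (r n)", OF u_iff(1) cauchy] by blast
  have "AE x in lborel. \<forall>n. x \<notin> \<Omega> \<longrightarrow> u n x = 0"
    unfolding AE_all_countable using u_iff(2) by blast
  with AE_lim have f_supp: "AE x in lborel. x \<notin> \<Omega> \<longrightarrow> f x = 0"
  proof eventually_elim
    case (elim x)
    show ?case
    proof
      assume "x \<notin> \<Omega>"
      \<comment> \<open>Almost everywhere outside \<open>\<Omega>\<close> the limit is one of zeros.\<close>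
      with elim have "(\<lambda>k. u (r (s k)) x) = (\<lambda>k. 0)" "(\<lambda>k. u (r (s k)) x) \<longlonglongrightarrow> f x"
        by auto
      then show "f x = 0"
        by (simp only: LIMSEQ_const_iff)
    qed
  qed
  have "\<bar>1 - l2_norm f\<bar> \<le> l2_norm (\<lambda>x. u (r n) x - f x)" for n
    using l2_norm_reverse_triangle [OF u_iff(1) f, of "r n"] by (simp add: u(2))
  then have "\<bar>1 - l2_norm f\<bar> \<le> 0"
    by (intro LIMSEQ_le_const [OF lim]) auto
  then have f_norm: "l2_norm f = 1"
    by simp
  note [measurable] = square_integrable_borel [OF f]
  have F_lim: "(\<lambda>n. \<F> (u (r n)) \<xi>) \<longlonglongrightarrow> \<F> f \<xi>" for \<xi>
  proof -
    define C where "C = l2_norm (indicator (cball (0::'a) R))"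
    have bnd: "cmod (\<F> (u (r n)) \<xi> - \<F> f \<xi>) \<le>
      (2 * pi) powr (- (real DIM('a) / 2)) * (l2_norm (\<lambda>x. u (r n) x - f x) * C)" for n
    proof -
      have "AE x in lborel. x \<notin> \<Omega> \<longrightarrow> u (r n) x - f x = 0"
        using u_iff(2) [of "r n"] f_supp by eventually_elim auto
      then show ?thesis
        using fourier_integral_l2_bound [OF square_integrable_diff [OF u_iff(1) f] supp, of "r n" \<xi>]
        by (subst fourier_integral_diff [symmetric])
           (auto simp: C_def intro: square_integrable_bounded_support_integrable u_iff f supp f_supp)
    qed
    have "(\<lambda>n. (2 * pi) powr (- (real DIM('a) / 2)) * (l2_norm (\<lambda>x. u (r n) x - f x) * C)) \<longlonglongrightarrow> (2 * pi) powr (- (real DIM('a) / 2)) * (0 * C)"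
      by (intro tendsto_intros lim)
    then have lim0: "(\<lambda>n. (2 * pi) powr (- (real DIM('a) / 2)) * (l2_norm (\<lambda>x. u (r n) x - f x) * C)) \<longlonglongrightarrow> 0"
      by simp
    have "(\<lambda>n. \<F> (u (r n)) \<xi> - \<F> f \<xi>) \<longlonglongrightarrow> 0"
      by (rule Lim_null_comparison [OF always_eventually lim0]) (intro allI bnd)
    then show ?thesis
      by (simp only: LIM_zero_iff)
  qed
  have W: "square_integrable (\<W> \<alpha> f) \<and> l2_norm (\<W> \<alpha> f) \<le> m + 1 / real (Suc n)" for n
  proof -
    have le: "l2_norm (\<W> \<alpha> (u (r (k + n)))) \<le> m + 1 / real (Suc n)" for k
    proof -
      have "n \<le> r (k + n)"
        using seq_suble [OF r, of "k + n"] by simp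
      then have "1 / real (Suc (r (k + n))) \<le> 1 / real (Suc n)"
        by (intro divide_left_mono) auto
      then have "m + 1 / real (Suc (r (k + n))) \<le> m + 1 / real (Suc n)"
        by (rule add_left_mono)
      with less_imp_le [OF u(3)] show ?thesis
        by (rule order_trans)
    qed
    have conv: "AE \<xi> in lborel. (\<lambda>k. \<W> \<alpha> (u (r (k + n))) \<xi>) \<longlonglongrightarrow> \<W> \<alpha> f \<xi>"
      unfolding weighted_fourier_def
      by (rule AE_I2, rule tendsto_mult [OF tendsto_const LIMSEQ_ignore_initial_segment [OF F_lim]])
    have meas: "\<W> \<alpha> f \<in> borel_measurable lborel"
      by measurable
    show ?thesis
      using l2_norm_fatou [of "\<lambda>k. \<W> \<alpha> (u (r (k + n)))", OF u_iff(3) meas conv le]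
      by (rule conjI)
  qed
  have "l2_norm (\<W> \<alpha> f) \<le> m"
  proof (rule LIMSEQ_le_const)
    have "(\<lambda>n. m + 1 / real (Suc n)) \<longlonglongrightarrow> m + 0"
      by (intro tendsto_intros LIMSEQ_inverse_real_of_nat [unfolded inverse_eq_divide])
    then show "(\<lambda>n. m + 1 / real (Suc n)) \<longlonglongrightarrow> m"
      by simp
  qed (use W in auto)
  moreover have "f \<in> H"
    using W f f_supp by (simp add: iff)
  ultimately have f_min: "l2_norm (\<W> \<alpha> f) * l2_norm v \<le> l2_norm (\<W> \<alpha> v)" if "v \<in> H" for v
    using m_le [OF that] mult_right_mono [of "l2_norm (\<W> \<alpha> f)" m "l2_norm v"] by simp
  show thesis
    using \<open>f \<in> H\<close> f_norm f_min unfolding H_def by (rule that)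
qed

text \<open>
  The form \<open>E - \<mu> \<langle>\<cdot>,\<cdot>\<rangle>\<close> is nonnegative and vanishes at a minimizer \<open>u\<close>; here \<open>B\<close> is its value at \<open>(u, v)\<close>, \<open>q\<close> its
  value at \<open>(v, v)\<close>, and the hypothesis is its value at \<open>u + c v\<close>.
\<close>

lemma hermitian_null:
  fixes B :: complex and q :: real
  assumes "\<And>c. 0 \<le> 2 * Re (cnj c * B) + (cmod c)\<^sup>2 * q"
  shows "B = 0"
proof (rule ccontr)
  assume "B \<noteq> 0"
  define e where "e = 1 / (\<bar>q\<bar> + 1)"
  have e: "0 < e" "e * q < 2"
    by (auto simp: e_def divide_simps)
  have "Re (cnj (- (of_real e * B)) * B) = - e * (cmod B)\<^sup>2"
    unfolding cmod_power2 by (simp add: power2_eq_square algebra_simps)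
  moreover have "(cmod (- (of_real e * B)))\<^sup>2 = e\<^sup>2 * (cmod B)\<^sup>2"
    by (simp add: norm_mult power_mult_distrib)
  ultimately have "0 \<le> 2 * (- e * (cmod B)\<^sup>2) + e\<^sup>2 * (cmod B)\<^sup>2 * q"
    using assms [of "- (of_real e * B)"] by (simp only:)
  also have "\<dots> = (e * (cmod B)\<^sup>2) * (e * q - 2)"
    by (simp add: power2_eq_square algebra_simps)
  also have "\<dots> < 0"
    using e \<open>B \<noteq> 0\<close> by (intro mult_pos_neg) auto
  finally show False
    by simp
qed

text \<open>
  A minimizer of the Rayleigh quotient is a weak eigenfunction by \<open>hermitian_null\<close>.  Its eigenvalue \<open>\<mu>\<close> is
  the smallest one: testing the equation of any other eigenfunction with that function itself
  shows that its eigenvalue is a Rayleigh quotient.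
\<close>

theorem first_eigenvalue_le_rayleigh_quotient:
  fixes \<Omega> :: "'a::euclidean_space set"
  assumes "bounded \<Omega>" and \<alpha>: "0 < \<alpha>"
    and w: "w \<in> sobolev_space_0 (\<alpha> / 2) \<Omega>" "l2_norm w \<noteq> 0"
  shows "first_eigenvalue \<alpha> \<Omega> * (l2_norm w)\<^sup>2 \<le> (l2_norm (\<W> \<alpha> w))\<^sup>2"
proof -
  obtain R where "\<forall>x\<in>\<Omega>. norm x \<le> R"
    using \<open>bounded \<Omega>\<close> unfolding bounded_iff by blast
  then have \<Omega>: "\<Omega> \<subseteq> cball 0 R"
    by auto
  define H where "H = sobolev_space_0 (\<alpha> / 2) \<Omega>"
  note iff = sobolev_space_0_iff [OF \<Omega> \<alpha>, folded H_def]
  note form = frac_laplacian_form_eq [OF \<Omega> \<alpha>, folded H_def]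
  obtain u where u: "u \<in> H" "l2_norm u = 1"
    and min: "\<And>v. v \<in> H \<Longrightarrow> l2_norm (\<W> \<alpha> u) * l2_norm v \<le> l2_norm (\<W> \<alpha> v)"
    by (rule rayleigh_minimizer [OF \<Omega> \<alpha> w, folded H_def], rule that)
  define \<mu> where "\<mu> = (l2_norm (\<W> \<alpha> u))\<^sup>2"
  have min2: "\<mu> * (l2_norm v)\<^sup>2 \<le> (l2_norm (\<W> \<alpha> v))\<^sup>2" if "v \<in> H" for v
    using power_mono [OF min [OF that], of 2] by (simp add: \<mu>_def power_mult_distrib)
  have "frac_laplacian_form \<alpha> u v = complex_of_real \<mu> * (LINT x|lborel. u x * cnj (v x))" if v: "v \<in> H" for v
  proof -
    define B where "B = (LINT \<xi>|lborel. \<W> \<alpha> u \<xi> * cnj (\<W> \<alpha> v \<xi>)) - complex_of_real \<mu> * (LINT x|lborel. u x * cnj (v x))"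
    have "0 \<le> 2 * Re (cnj c * B) + (cmod c)\<^sup>2 * ((l2_norm (\<W> \<alpha> v))\<^sup>2 - \<mu> * (l2_norm v)\<^sup>2)" for c
    proof -
      note * = sobolev_space_0_closed [OF \<Omega> \<alpha>, folded H_def, OF u(1) v, of c]
      have sq: "square_integrable u" "square_integrable v"
        "square_integrable (\<W> \<alpha> u)" "square_integrable (\<W> \<alpha> v)"
        using u(1) v by (auto simp: iff)
      have re: "Re (cnj c * B) = Re (cnj c * (LINT \<xi>|lborel. \<W> \<alpha> u \<xi> * cnj (\<W> \<alpha> v \<xi>))) - \<mu> * Re (cnj c * (LINT x|lborel. u x * cnj (v x)))"
        by (simp add: B_def algebra_simps)
      show ?thesis
        using min2 [OF *(1)] unfolding *(2) l2_norm_expand [OF sq(1,2)] l2_norm_expand [OF sq(3,4)] re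
        by (simp add: u(2) \<mu>_def [symmetric] algebra_simps)
    qed
    then have "B = 0"
      by (rule hermitian_null)
    then show ?thesis
      by (simp add: B_def form [OF u(1) v])
  qed
  moreover have "\<not> (AE x in lborel. u x = 0)"
    using u l2_norm_eq_0_iff [of u] by (simp add: iff)
  ultimately have \<mu>: "dirichlet_eigenvalue \<alpha> \<Omega> \<mu>"
    unfolding dirichlet_eigenvalue_def weak_eigenfunction_def H_def [symmetric] using u(1) by blast
  have least: "\<mu> \<le> \<nu>" if nu: "dirichlet_eigenvalue \<alpha> \<Omega> \<nu>" for \<nu>
  proof -
    obtain v where v: "v \<in> H" "\<not> (AE x in lborel. v x = 0)"
      and "frac_laplacian_form \<alpha> v v = complex_of_real \<nu> * (LINT x|lborel. v x * cnj (v x))"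
      using nu unfolding dirichlet_eigenvalue_def weak_eigenfunction_def H_def [symmetric] by blast
    then have "complex_of_real ((l2_norm (\<W> \<alpha> v))\<^sup>2) = complex_of_real (\<nu> * (l2_norm v)\<^sup>2)"
      by (simp only: form [OF v(1) v(1)] inner_self_eq_l2_norm of_real_mult)
    then have "(l2_norm (\<W> \<alpha> v))\<^sup>2 = \<nu> * (l2_norm v)\<^sup>2"
      by (simp only: of_real_eq_iff)
    moreover have "0 < (l2_norm v)\<^sup>2"
      using v l2_norm_eq_0_iff [of v] by (simp add: iff)
    ultimately show ?thesis
      using min2 [OF v(1)] by simp
  qed
  have "first_eigenvalue \<alpha> \<Omega> = \<mu>"
    unfolding first_eigenvalue_def using \<mu> least by (rule Least_equality)
  then show ?thesis
    using min2 w(1) by (simp add: H_def)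
qed

section \<open>Riesz potentials on the Fourier side\<close>

lemma nn_integral_powr_exp:
  fixes s a :: real
  assumes "0 < s" "0 < a"
  shows "(\<integral>\<^sup>+t. ennreal (indicator {0<..} t * t powr (s - 1) * exp (- a * t)) \<partial>lborel) = ennreal (Gamma s * a powr (- s))"
proof -
  define f :: "real \<Rightarrow> ennreal" where "f t = ennreal (indicator {0..} t * t powr (s - 1) / exp t)" for t
  have [measurable]: "f \<in> borel_measurable borel"
    unfolding f_def by measurable
  have f_scaled: "ennreal (indicator {0<..} t * t powr (s - 1) * exp (- a * t)) = ennreal (a powr (1 - s)) * f (0 + a * t)" for t
  proof (cases "0 < t")
    case True
    have "a powr (1 - s) * (a * t) powr (s - 1) = t powr (s - 1)"
      using assms True by (simp add: powr_mult flip: powr_add mult.assoc)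
    then have "t powr (s - 1) * exp (- a * t) = a powr (1 - s) * ((a * t) powr (s - 1) / exp (a * t))"
      by (simp add: exp_minus field_simps)
    then show ?thesis
      using assms True by (simp add: f_def flip: ennreal_mult)
  next
    case False
    then have "t = 0 \<or> a * t < 0"
      using assms by (auto simp: mult_less_0_iff)
    then show ?thesis
      using False by (auto simp: f_def)
  qed
  have "ennreal (Gamma s) = a * (\<integral>\<^sup>+t. f (0 + a * t) \<partial>lborel)"
    using nn_integral_real_affine [of f a 0] Gamma_conv_nn_integral_real [OF assms(1)] assms(2)
    by (simp add: f_def [abs_def])
  then have "ennreal (1 / a) * ennreal (Gamma s) = (\<integral>\<^sup>+t. f (0 + a * t) \<partial>lborel)"
    using assms(2) by (simp add: mult.assoc [symmetric] flip: ennreal_mult)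
  then have "(\<integral>\<^sup>+t. ennreal (indicator {0<..} t * t powr (s - 1) * exp (- a * t)) \<partial>lborel) =
     ennreal (a powr (1 - s)) * (ennreal (1 / a) * ennreal (Gamma s))"
    unfolding f_scaled by (subst nn_integral_cmult) auto
  also have "\<dots> = ennreal (a powr (1 - s) * (1 / a * Gamma s))"
    using assms by (simp only: ennreal_mult [symmetric] Gamma_real_nonneg powr_ge_zero
        mult_nonneg_nonneg zero_le_divide_1_iff less_imp_le)
  also have "a powr (1 - s) * (1 / a * Gamma s) = Gamma s * a powr (- s)"
    using assms by (simp add: powr_diff powr_minus field_simps)
  finally show ?thesis .
qed

text \<open>
  The Gamma integral under the substitution \<open>t \<mapsto> 1 / t\<close>, rescaled.
\<close>

lemma nn_integral_powr_exp_inverse: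
  fixes s b :: real
  assumes s: "0 < s" and b: "0 < b"
  shows "(\<integral>\<^sup>+t. ennreal (indicator {0<..} t * t powr (- s - 1) * exp (- b / t)) \<partial>lborel) = ennreal (Gamma s * b powr (- s))" (is "?X = _")
proof -
  have "((\<lambda>t. t powr (s - 1) / exp t) has_integral Gamma s) {0..} \<longleftrightarrow>
      ((\<lambda>t. t powr (s - 1) / exp t) has_integral Gamma s) {0<..}"
    by (rule has_integral_spike_set_eq; rule negligible_subset [of "{0}"]; force)
  with Gamma_integral_real [OF s] have G: "((\<lambda>t. t powr (s - 1) / exp t) has_integral Gamma s) {0<..}"
    by simp
  define f where "f t = t powr (- s - 1) * exp (- 1 / t)" for t :: real
  have eq: "\<bar>- (inverse t ^ 2)\<bar> * f (inverse t) = t powr (s - 1) / exp t" if "t \<in> {0<..}" for t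
  proof -
    have "inverse t powr (- s - 1) = t powr (- (- s - 1))"
      using that unfolding powr_minus [of t] by (simp add: inverse_powr)
    also have "\<dots> = t powr (s - 1) * t powr 2"
      by (simp flip: powr_add)
    finally show ?thesis
      using that by (simp add: f_def power_inverse exp_minus field_simps)
  qed
  have inv: "inverse ` {0<..} = {(0::real)<..}"
    by (auto intro!: image_eqI [of _ _ "inverse _"])
  have "((\<lambda>t. \<bar>- (inverse t ^ 2)\<bar> * f (inverse t)) has_integral Gamma s) {0<..}"
    by (rule has_integral_eq [OF _ G]) (simp only: eq)
  then have 2: "(\<lambda>t. \<bar>- (inverse t ^ 2)\<bar> * f (inverse t)) absolutely_integrable_on {0<..} \<and>
      integral {0<..} (\<lambda>t. \<bar>- (inverse t ^ 2)\<bar> * f (inverse t)) = Gamma s"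
    by (auto simp: has_integral_integrable_integral f_def intro!: nonnegative_absolutely_integrable_1)
  have "(f absolutely_integrable_on inverse ` {0<..}) \<and> integral (inverse ` {0<..}) f = Gamma s"
    by (rule has_absolute_integral_change_of_variables_1'
        [where g = inverse and g' = "\<lambda>t. - (inverse t ^ 2)" and S = "{0<..}", THEN iffD1, OF _ _ _ 2])
       (auto intro!: derivative_eq_intros simp: power2_eq_square inj_on_def)
  then have "(f has_integral Gamma s) {0<..}"
    unfolding inv by (auto simp: has_integral_integrable_integral set_lebesgue_integral_eq_integral)
  moreover have "0 \<le> f t" for t
    by (simp add: f_def)
  ultimately have "(\<integral>\<^sup>+t. ennreal (indicator {0<..} t * f t) \<partial>lborel) = ennreal (Gamma s)"
    by (intro nn_integral_has_integral_lebesgue)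
  moreover have "(\<integral>\<^sup>+t. ennreal (indicator {0<..} t * f t) \<partial>lborel) =
     ennreal \<bar>1 / b\<bar> * (\<integral>\<^sup>+t. ennreal (indicator {0<..} (0 + (1 / b) * t) * f (0 + (1 / b) * t)) \<partial>lborel)"
    using b unfolding f_def by (intro nn_integral_real_affine) auto
  moreover have "ennreal (indicator {0<..} (0 + (1 / b) * t) * f (0 + (1 / b) * t)) =
      ennreal (b powr (s + 1)) * ennreal (indicator {0<..} t * t powr (- s - 1) * exp (- b / t))" for t
  proof (cases "0 < t")
    case True
    have "(t / b) powr (- s - 1) = b powr (s + 1) * t powr (- s - 1)"
      using True b by (simp add: powr_divide powr_minus_divide flip: powr_minus) (simp add: powr_diff powr_minus powr_add field_simps)
    then show ?thesis
      using True b by (simp add: f_def field_simps flip: ennreal_mult)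
  next
    case False
    then have "\<not> 0 < t / b"
      using b by (simp add: zero_less_divide_iff)
    then show ?thesis
      using False by simp
  qed
  ultimately have "ennreal (Gamma s) = ennreal (1 / b) * (ennreal (b powr (s + 1)) *
      ?X)"
    using b by (simp add: nn_integral_cmult)
  also have "\<dots> = ennreal (b powr s) * ?X"
    using b by (simp add: powr_add flip: mult.assoc ennreal_mult)
  finally have eq: "ennreal (Gamma s) = ennreal (b powr s) *
      ?X" .
  have "ennreal (Gamma s * b powr (- s)) = ennreal (b powr (- s)) * ennreal (Gamma s)"
    unfolding mult.commute [of "Gamma s"] by (rule ennreal_mult) (use s in \<open>simp_all add: Gamma_real_nonneg\<close>)
  also have "\<dots> = ennreal (b powr (- s) * b powr s) *
      ?X"
    unfolding eq by (simp only: mult.assoc ennreal_mult powr_ge_zero)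
  also have "b powr (- s) * b powr s = 1"
    using b by (simp flip: powr_add)
  finally show ?thesis
    by simp
qed

text \<open>
  Both powers are superpositions of Gaussians, up to factors: \<open>|\<xi>|\<close> to the power \<open>- 2 \<gamma>\<close> is the integral of
  \<open>t\<^bsup>\<gamma> - 1\<^esup> exp (- t |\<xi>|\<^sup>2)\<close> over \<open>t > 0\<close>, and \<open>|z|\<close> to the power \<open>2 \<gamma> - d\<close> is that of the heat kernels \<open>t\<^bsup>\<gamma> - 1\<^esup> K (2 t) z\<close>.  So the
  identity is \<open>gaussian_parseval\<close>, integrated over \<open>t\<close>.  The left-hand side is an integral of
  nonnegative functions; on the right-hand side the autocorrelation may change sign, which is why its
  absolute integrability is assumed.
\<close>

theorem riesz_potential_parseval:
  fixes u :: "'a::euclidean_space \<Rightarrow> complex" and \<gamma> :: real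
  assumes u: "integrable lborel u" and \<gamma>: "0 < \<gamma>" "\<gamma> < real DIM('a) / 2"
    and A: "integrable lborel (\<lambda>z. complex_of_real (norm z powr (2 * \<gamma> - real DIM('a))) * autocorrelation u z)"
  shows "(\<integral>\<^sup>+\<xi>. ennreal (norm \<xi> powr (- (2 * \<gamma>)) * (cmod (\<F> u \<xi>))\<^sup>2) \<partial>lborel) =
    ennreal ((4 * pi) powr (- (real DIM('a) / 2)) * 2 powr (real DIM('a) - 2 * \<gamma>) * Gamma (real DIM('a) / 2 - \<gamma>) / Gamma \<gamma> *
      Re (LINT z|lborel. complex_of_real (norm z powr (2 * \<gamma> - real DIM('a))) * autocorrelation u z))" (is "?X = _")
proof -
  define d where "d = real DIM('a)"
  let ?Y = "LINT z|lborel. complex_of_real (norm z powr (2 * \<gamma> - d)) * autocorrelation u z"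
  define c where "c = (4 * pi) powr (- (d / 2)) * 2 powr (d - 2 * \<gamma>) * Gamma (d / 2 - \<gamma>)"
  have \<gamma>': "0 < d / 2 - \<gamma>"
    using \<gamma> by (simp add: d_def)
  have [measurable]: "u \<in> borel_measurable borel"
    using u by auto
  have [measurable]: "autocorrelation u \<in> borel_measurable borel"
    using autocorrelation_fourier(1) [OF u] by auto
  define k where "k t = indicator {0<..} t * t powr (\<gamma> - 1)" for t :: real
  have k_nonneg: "0 \<le> k t" for t
    by (simp add: k_def)
  have [measurable]: "k \<in> borel_measurable borel"
    unfolding k_def [abs_def] by measurable
  have kernel: "(\<integral>\<^sup>+t. ennreal (k t * heat_kernel (2 * t) z) \<partial>lborel) = ennreal (c * norm z powr (2 * \<gamma> - d))"
    if "z \<noteq> 0" for z :: 'a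
  proof -
    have "ennreal (k t * heat_kernel (2 * t) z) = ennreal ((4 * pi) powr (- (d / 2))) *
       ennreal (indicator {0<..} t * t powr (- (d / 2 - \<gamma>) - 1) * exp (- ((norm z)\<^sup>2 / 4) / t))" for t
    proof (cases "0 < t")
      case True
      have "t powr (\<gamma> - 1) * (4 * pi * t) powr (- (d / 2)) = (4 * pi) powr (- (d / 2)) * t powr (- (d / 2 - \<gamma>) - 1)"
        using True by (simp add: powr_mult mult.left_commute algebra_simps flip: powr_add)
      then show ?thesis
        using True by (simp add: k_def heat_kernel_def d_def mult_ac flip: ennreal_mult)
    qed (simp add: k_def)
    then have "(\<integral>\<^sup>+t. ennreal (k t * heat_kernel (2 * t) z) \<partial>lborel) =
      ennreal ((4 * pi) powr (- (d / 2))) * ennreal (Gamma (d / 2 - \<gamma>) * ((norm z)\<^sup>2 / 4) powr (- (d / 2 - \<gamma>)))"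
      using nn_integral_powr_exp_inverse [OF \<gamma>', of "(norm z)\<^sup>2 / 4"] that
      by (simp add: nn_integral_cmult)
    also have "((norm z)\<^sup>2 / 4) powr (- (d / 2 - \<gamma>)) = 2 powr (d - 2 * \<gamma>) * norm z powr (2 * \<gamma> - d)"
    proof -
      have "(norm z)\<^sup>2 / 4 = (norm z / 2) powr 2"
        using that by (simp add: power_divide)
      then have "((norm z)\<^sup>2 / 4) powr (- (d / 2 - \<gamma>)) = (norm z / 2) powr (2 * \<gamma> - d)"
        by (simp only: powr_powr) (simp add: algebra_simps)
      also have "\<dots> = norm z powr (2 * \<gamma> - d) * 2 powr (- (2 * \<gamma> - d))"
        unfolding powr_minus_divide by (simp add: powr_divide)
      finally show ?thesis
        by simp
    qed
    also have "ennreal ((4 * pi) powr (- (d / 2))) * ennreal (Gamma (d / 2 - \<gamma>) * (2 powr (d - 2 * \<gamma>) * norm z powr (2 * \<gamma> - d))) =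
       ennreal ((4 * pi) powr (- (d / 2)) * (Gamma (d / 2 - \<gamma>) * (2 powr (d - 2 * \<gamma>) * norm z powr (2 * \<gamma> - d))))"
      by (rule ennreal_mult [symmetric]) (use \<gamma>' in \<open>simp_all add: Gamma_real_nonneg\<close>)
    also have "(4 * pi) powr (- (d / 2)) * (Gamma (d / 2 - \<gamma>) * (2 powr (d - 2 * \<gamma>) * norm z powr (2 * \<gamma> - d))) = c * norm z powr (2 * \<gamma> - d)"
      by (simp add: c_def)
    finally show ?thesis .
  qed
  have c_nonneg: "0 \<le> c"
    using \<gamma>' by (simp add: c_def Gamma_real_nonneg)
  have kernel_int: "integrable lborel (\<lambda>t. k t * heat_kernel (2 * t) z)"
    "(LINT t|lborel. k t * heat_kernel (2 * t) z) = c * norm z powr (2 * \<gamma> - d)" if "z \<noteq> 0" for z :: 'a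
  proof -
    have [measurable]: "(\<lambda>t. k t * heat_kernel (2 * t) z) \<in> borel_measurable lborel"
      unfolding heat_kernel_def by measurable
    have "has_bochner_integral lborel (\<lambda>t. k t * heat_kernel (2 * t) z) (c * norm z powr (2 * \<gamma> - d))"
      by (rule has_bochner_integral_nn_integral)
         (use kernel [OF that] k_nonneg c_nonneg in auto)
    then show "integrable lborel (\<lambda>t. k t * heat_kernel (2 * t) z)"
      "(LINT t|lborel. k t * heat_kernel (2 * t) z) = c * norm z powr (2 * \<gamma> - d)"
      by (auto simp: has_bochner_integral_iff)
  qed
  define K where "K z t = complex_of_real (k t * heat_kernel (2 * t) z) * autocorrelation u z" for z t
  have nz: "AE z in lborel. z \<noteq> (0::'a)"
    by (rule AE_lborel_singleton)
  have inner: "(LINT t|lborel. K z t) = complex_of_real c * (complex_of_real (norm z powr (2 * \<gamma> - d)) * autocorrelation u z)"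
    if "z \<noteq> 0" for z
    unfolding K_def integral_mult_left_zero integral_complex_of_real kernel_int(2) [OF that] by simp
  have K_int: "integrable (lborel \<Otimes>\<^sub>M lborel) (case_prod K)"
  proof (rule lborel_pair.Fubini_integrable)
    show "case_prod K \<in> borel_measurable (lborel \<Otimes>\<^sub>M lborel)"
      unfolding K_def heat_kernel_def by measurable
    have "integrable lborel (\<lambda>z. c * norm (complex_of_real (norm z powr (2 * \<gamma> - d)) * autocorrelation u z))"
      using A unfolding d_def by (intro integrable_mult_right integrable_norm)
    moreover have "AE z in lborel. (LINT t|lborel. norm (case_prod K (z, t))) = c * norm (complex_of_real (norm z powr (2 * \<gamma> - d)) * autocorrelation u z)"
      using nz
    proof eventually_elim
      case (elim z)
      have "(LINT t|lborel. norm (case_prod K (z, t))) = (LINT t|lborel. k t * heat_kernel (2 * t) z) * cmod (autocorrelation u z)"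
        unfolding K_def by (simp add: norm_mult k_nonneg)
      then show ?case
        using elim by (simp add: kernel_int(2) norm_mult)
    qed
    ultimately show "integrable lborel (\<lambda>z. LINT t|lborel. norm (case_prod K (z, t)))"
      by (subst integrable_cong_AE) (auto simp: K_def heat_kernel_def)
    show "AE z in lborel. integrable lborel (\<lambda>t. case_prod K (z, t))"
      using nz
    proof eventually_elim
      case (elim z)
      then show ?case
        unfolding K_def prod.case by (intro integrable_mult_left integrable_of_real kernel_int(1))
    qed
  qed
  define P where "P t = (LINT \<xi>|lborel. exp (- t * (norm \<xi>)\<^sup>2) * (cmod (\<F> u \<xi>))\<^sup>2)" for t
  have P: "k t * P t = Re (LINT z|lborel. K z t)" for t
  proof (cases "0 < t")
    case True
    then have "complex_of_real (P t) = (LINT z|lborel. complex_of_real (heat_kernel (2 * t) z) * autocorrelation u z)"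
      using gaussian_parseval(2) [OF u, of "2 * t"] by (simp add: P_def)
    then have "(LINT z|lborel. K z t) = complex_of_real (k t * P t)"
      by (simp add: K_def mult.assoc)
    then show ?thesis
      by simp
  qed (simp add: K_def k_def)
  have P_int: "integrable lborel (\<lambda>t. k t * P t)"
    unfolding P by (intro integrable_Re lborel_pair.integrable_snd K_int)
  have P_nonneg: "0 \<le> P t" for t
    unfolding P_def by (intro integral_nonneg_AE) auto
  have "(LINT t|lborel. k t * P t) = Re (LINT t|lborel. (LINT z|lborel. K z t))"
    unfolding P by (intro integral_Re lborel_pair.integrable_snd K_int)
  also have "(LINT t|lborel. (LINT z|lborel. K z t)) = (LINT z|lborel. (LINT t|lborel. K z t))"
    by (rule lborel_pair.Fubini_integral [OF K_int])
  also have "\<dots> = (LINT z|lborel. complex_of_real c * (complex_of_real (norm z powr (2 * \<gamma> - d)) * autocorrelation u z))"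
    by (rule integral_cong_AE) (use nz inner in \<open>auto simp: K_def heat_kernel_def\<close>)
  finally have P_val: "(LINT t|lborel. k t * P t) = c * Re ?Y"
    by simp
  have "(\<integral>\<^sup>+\<xi>. ennreal (Gamma \<gamma>) * ennreal (norm \<xi> powr (- (2 * \<gamma>)) * (cmod (\<F> u \<xi>))\<^sup>2) \<partial>lborel) =
     (\<integral>\<^sup>+\<xi>. \<integral>\<^sup>+t. ennreal (k t * exp (- t * (norm \<xi>)\<^sup>2)) * ennreal ((cmod (\<F> u \<xi>))\<^sup>2) \<partial>lborel \<partial>lborel)"
  proof (rule nn_integral_cong_AE)
    show "AE \<xi> in lborel. ennreal (Gamma \<gamma>) * ennreal (norm \<xi> powr (- (2 * \<gamma>)) * (cmod (\<F> u \<xi>))\<^sup>2) =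
       (\<integral>\<^sup>+t. ennreal (k t * exp (- t * (norm \<xi>)\<^sup>2)) * ennreal ((cmod (\<F> u \<xi>))\<^sup>2) \<partial>lborel)"
      using nz
    proof eventually_elim
      case (elim \<xi>)
      have "(norm \<xi>)\<^sup>2 powr (- \<gamma>) = norm \<xi> powr (- (2 * \<gamma>))"
        using elim by (simp add: powr_powr flip: powr_numeral)
      then have "(\<integral>\<^sup>+t. ennreal (k t * exp (- t * (norm \<xi>)\<^sup>2)) \<partial>lborel) = ennreal (Gamma \<gamma> * norm \<xi> powr (- (2 * \<gamma>)))"
        using nn_integral_powr_exp [OF \<gamma>(1), of "(norm \<xi>)\<^sup>2"] elim by (simp add: k_def mult_ac)
      then show ?case
        using \<gamma> by (simp add: nn_integral_multc Gamma_real_nonneg mult.assoc flip: ennreal_mult)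
    qed
  qed
  also have "\<dots> = (\<integral>\<^sup>+t. \<integral>\<^sup>+\<xi>. ennreal (k t * exp (- t * (norm \<xi>)\<^sup>2)) * ennreal ((cmod (\<F> u \<xi>))\<^sup>2) \<partial>lborel \<partial>lborel)"
    by (rule lborel_pair.Fubini') measurable
  also have "\<dots> = (\<integral>\<^sup>+t. ennreal (k t * P t) \<partial>lborel)"
  proof (rule nn_integral_cong)
    fix t :: real
    show "(\<integral>\<^sup>+\<xi>. ennreal (k t * exp (- t * (norm \<xi>)\<^sup>2)) * ennreal ((cmod (\<F> u \<xi>))\<^sup>2) \<partial>lborel) = ennreal (k t * P t)"
    proof (cases "0 < t")
      case True
      have "(\<integral>\<^sup>+\<xi>. ennreal (k t * exp (- t * (norm \<xi>)\<^sup>2)) * ennreal ((cmod (\<F> u \<xi>))\<^sup>2) \<partial>lborel) =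
        (\<integral>\<^sup>+\<xi>. ennreal (k t) * ennreal (exp (- t * (norm \<xi>)\<^sup>2) * (cmod (\<F> u \<xi>))\<^sup>2) \<partial>lborel)"
        by (intro nn_integral_cong) (simp add: k_nonneg ennreal_mult mult.assoc)
      also have "\<dots> = ennreal (k t) * (\<integral>\<^sup>+\<xi>. ennreal (exp (- t * (norm \<xi>)\<^sup>2) * (cmod (\<F> u \<xi>))\<^sup>2) \<partial>lborel)"
        by (rule nn_integral_cmult) measurable
      also have "(\<integral>\<^sup>+\<xi>. ennreal (exp (- t * (norm \<xi>)\<^sup>2) * (cmod (\<F> u \<xi>))\<^sup>2) \<partial>lborel) = ennreal (P t)"
        unfolding P_def using gaussian_parseval(1) [OF u, of "2 * t"] True
        by (intro nn_integral_eq_integral) auto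
      finally show ?thesis
        by (simp add: ennreal_mult k_nonneg P_nonneg)
    qed (simp add: k_def)
  qed
  also have "\<dots> = ennreal (c * Re ?Y)"
    unfolding P_val [symmetric] by (rule nn_integral_eq_integral [OF P_int]) (simp add: k_nonneg P_nonneg)
  finally have main: "ennreal (Gamma \<gamma>) * ?X =
     ennreal (c * Re ?Y)"
    by (subst (asm) nn_integral_cmult) auto
  have "?X =
      ennreal (1 / Gamma \<gamma>) * (ennreal (Gamma \<gamma>) * ?X)"
    using Gamma_real_pos [OF \<gamma>(1)] by (simp add: mult.assoc [symmetric] flip: ennreal_mult)
  also have "\<dots> = ennreal (1 / Gamma \<gamma> * (c * Re ?Y))"
    unfolding main using Gamma_real_pos [OF \<gamma>(1)] by (intro ennreal_mult' [symmetric]) simp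
  finally show ?thesis
    by (simp add: c_def d_def field_simps)
qed

section \<open>An upper bound for a product of Gamma values\<close>

text \<open>
  Logarithmic convexity of Gamma between \<open>x\<close> and \<open>x + 1\<close>.
\<close>

lemma Gamma_add_le:
  fixes x s :: real
  assumes "0 < x" "0 \<le> s" "s \<le> 1"
  shows "Gamma (x + s) \<le> Gamma x * x powr s"
proof -
  have G: "Gamma x \<noteq> 0" "0 < Gamma x"
    using Gamma_real_pos [OF assms(1)] by auto
  have "(ln \<circ> Gamma) ((1 - s) *\<^sub>R x + s *\<^sub>R (x + 1)) \<le> (1 - s) * (ln \<circ> Gamma) x + s * (ln \<circ> Gamma) (x + 1)"
    using assms by (intro convex_onD [OF log_convex_Gamma_real]) auto
  moreover have "(1 - s) *\<^sub>R x + s *\<^sub>R (x + 1) = x + s"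
    by (simp add: algebra_simps)
  moreover have "ln (Gamma (x + 1)) = ln x + ln (Gamma x)"
    using assms G(2) by (subst Gamma_plus1) (auto simp: ln_mult_pos nonpos_Ints_def)
  ultimately have "ln (Gamma (x + s)) \<le> ln (Gamma x) + s * ln x"
    by (simp add: algebra_simps)
  also have "\<dots> = ln (Gamma x * x powr s)"
    using assms G(2) by (subst ln_mult_pos) auto
  finally show ?thesis
    using assms G by (subst (asm) ln_le_cancel_iff) auto
qed

lemma Gamma_shift:
  fixes x :: real
  assumes "0 < x"
  shows "Gamma (x + of_nat n) = pochhammer x n * Gamma x"
proof -
  have "x \<notin> \<int>\<^sub>\<le>\<^sub>0"
    using assms by (auto simp: nonpos_Ints_def)
  with pochhammer_Gamma [OF this, of n] show ?thesis
    by (simp add: Gamma_eq_zero_iff)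
qed

text \<open>
  The previous bound loses a relative error of order \<open>1 / x\<close>, too much at moderate \<open>x\<close>.  It becomes much sharper when
  \<open>y\<close> is decreased by a suitable \<open>\<delta>\<close> inside the power: the quotient of the two sides increases under \<open>y \<mapsto> y + 1\<close>, by the
  hypothesis \<open>step\<close>, and tends to \<open>1\<close>, by the previous bound.  Optimal for large \<open>y\<close> would be \<open>\<delta> = (1 - s) / 2\<close>.
\<close>

lemma Gamma_add_le_shifted:
  fixes y s \<delta> :: real
  assumes s: "0 \<le> s" "s \<le> 1" and \<delta>: "0 \<le> \<delta>" "\<delta> < y"
    and step: "\<And>x. y \<le> x \<Longrightarrow> x * (x + 1 - \<delta>) powr s \<le> (x + s) * (x - \<delta>) powr s"
  shows "Gamma (y + s) \<le> Gamma y * (y - \<delta>) powr s"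
proof -
  define h where "h n = Gamma (y + real n + s) / (Gamma (y + real n) * (y + real n - \<delta>) powr s)" for n
  have y: "0 < y"
    using \<delta> by simp
  have G: "0 < Gamma (y + real n)" "0 < Gamma (y + real n + s)" for n
    using y s by (auto intro!: Gamma_real_pos)
  have p: "0 < (y + real n - \<delta>) powr s" for n
    using \<delta> by simp
  have "h n \<le> h (Suc n)" for n
  proof -
    define x where "x = y + real n"
    have x: "0 < x" "y \<le> x"
      using y by (auto simp: x_def)
    have "Gamma (x + s + 1) = (x + s) * Gamma (x + s)" "Gamma (x + 1) = x * Gamma x"
      using x s by (auto intro!: Gamma_plus1 simp: nonpos_Ints_def)
    then have "h (Suc n) = ((x + s) * Gamma (x + s)) / (x * Gamma x * (x + 1 - \<delta>) powr s)"
      by (simp add: h_def x_def add_ac)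
    moreover have "h n = Gamma (x + s) / (Gamma x * (x - \<delta>) powr s)"
      by (simp add: h_def x_def)
    moreover have "Gamma (x + s) / (Gamma x * (x - \<delta>) powr s) \<le> ((x + s) * Gamma (x + s)) / (x * Gamma x * (x + 1 - \<delta>) powr s)"
    proof -
      have "x * (x + 1 - \<delta>) powr s * Gamma (x + s) \<le> (x + s) * (x - \<delta>) powr s * Gamma (x + s)"
        using G [of n] by (intro mult_right_mono step x) (simp add: x_def)
      moreover have "0 < (x + 1 - \<delta>) powr s" "0 < (x - \<delta>) powr s" "0 < Gamma x"
        using p [of n] p [of "Suc n"] G(1) [of n] by (simp_all add: x_def add_ac)
      moreover have "a / (b * c) \<le> (d * a) / (x * b * e)"
        if "x * e * a \<le> d * c * a" "0 < e" "0 < c" "0 < b" for a b c d e :: real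
        using that x(1) by (simp add: divide_simps mult_ac)
      ultimately show ?thesis
        by blast
    qed
    ultimately show ?thesis
      by simp
  qed
  then have "incseq h"
    by (rule incseq_SucI)
  have h_le: "h n \<le> (1 + \<delta> / (y - \<delta> + real n)) powr s" for n
  proof -
    have "h n \<le> (Gamma (y + real n) * (y + real n) powr s) / (Gamma (y + real n) * (y + real n - \<delta>) powr s)"
      unfolding h_def using y s G(1) [of n] p [of n] by (intro divide_right_mono Gamma_add_le) auto
    also have "\<dots> = ((y + real n) / (y + real n - \<delta>)) powr s"
      using G(1) [of n] by (simp add: powr_divide)
    also have "(y + real n) / (y + real n - \<delta>) = 1 + \<delta> / (y - \<delta> + real n)"
      using \<delta> by (simp add: field_simps)
    finally show ?thesis .
  qed
  have "(\<lambda>n. (1 + \<delta> / (y - \<delta> + real n)) powr s) \<longlonglongrightarrow> (1 + 0) powr s"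
    by (intro tendsto_intros) (real_asymp, simp)
  then have lim: "(\<lambda>n. (1 + \<delta> / (y - \<delta> + real n)) powr s) \<longlonglongrightarrow> 1"
    by simp
  have "h 0 \<le> 1"
  proof (rule LIMSEQ_le_const [OF lim])
    have "h 0 \<le> (1 + \<delta> / (y - \<delta> + real n)) powr s" for n
      using incseqD [OF \<open>incseq h\<close>, of 0 n] h_le [of n] by simp
    then show "\<exists>N. \<forall>n\<ge>N. h 0 \<le> (1 + \<delta> / (y - \<delta> + real n)) powr s"
      by blast
  qed
  then show ?thesis
    using G(1) [of 0] p [of 0] by (simp add: h_def divide_simps)
qed

text \<open>
  The left-hand side is about \<open>0.9963\<close> times the right-hand side.  With \<open>\<surd>\<pi> = Gamma (1/2)\<close>, shifting all arguments
  by \<open>6\<close> makes \<open>Gamma_add_le_shifted\<close> precise enough, for \<open>s = 1/2\<close>, \<open>\<delta> = 6/25\<close> and for \<open>s = 1/3\<close>, \<open>\<delta> = 8/25\<close>.  The first choice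
  makes \<open>6 - \<delta>\<close> the square of \<open>12/5\<close>.  The sixth powers of both sides of what remains are
  rational.
\<close>

lemma Gamma_ratio_bound:
  "sqrt pi * Gamma (5 / 12 :: real) * (720 / 133) < 2 powr (5 / 6) * Gamma (1 / 12)"
proof -
  have "Gamma (6 + 1 / 2 :: real) \<le> Gamma 6 * (6 - 6 / 25) powr (1 / 2)"
  proof (rule Gamma_add_le_shifted)
    fix x :: real
    assume x: "6 \<le> x"
    show "x * (x + 1 - 6 / 25) powr (1 / 2) \<le> (x + 1 / 2) * (x - 6 / 25) powr (1 / 2)"
    proof (rule power2_le_imp_le)
      have "((x + 1 / 2) * (x - 6 / 25) powr (1 / 2))\<^sup>2 - (x * (x + 1 - 6 / 25) powr (1 / 2))\<^sup>2 = (x - 6) / 100"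
        using x by (simp only: power_mult_distrib powr_half_squared powr_one_gt_zero_iff)
                   (simp add: power2_eq_square algebra_simps)
      also have "\<dots> \<ge> 0"
        using x by simp
      finally show "(x * (x + 1 - 6 / 25) powr (1 / 2))\<^sup>2 \<le> ((x + 1 / 2) * (x - 6 / 25) powr (1 / 2))\<^sup>2"
        by (simp only: diff_ge_0_iff_ge)
    qed (use x in simp)
  qed auto
  moreover have "(6 - 6 / 25) powr (1 / 2) = (12 / 5 :: real)"
    using real_sqrt_abs [of "12 / 5"] by (simp add: powr_half_sqrt power2_eq_square)
  moreover have "Gamma 6 = (120 :: real)"
    using Gamma_fact [of 5, where 'a = real] by (simp add: fact_numeral)
  ultimately have 1: "pochhammer (1 / 2) 6 * sqrt pi \<le> 288"
    using Gamma_shift [of "1 / 2" 6] by (simp add: Gamma_one_half_real)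
  have "Gamma (73 / 12 + 1 / 3 :: real) \<le> Gamma (73 / 12) * (73 / 12 - 8 / 25) powr (1 / 3)"
  proof (rule Gamma_add_le_shifted)
    fix x :: real
    assume x: "73 / 12 \<le> x"
    show "x * (x + 1 - 8 / 25) powr (1 / 3) \<le> (x + 1 / 3) * (x - 8 / 25) powr (1 / 3)"
    proof (rule power_le_imp_le_base)
      have "((x + 1 / 3) * (x - 8 / 25) powr (1 / 3)) ^ Suc 2 - (x * (x + 1 - 8 / 25) powr (1 / 3)) ^ Suc 2 =
          x\<^sup>2 / 75 - 47 / 675 * x - 8 / 675"
        using x by (simp only: power_mult_distrib powr_power) (simp add: power3_eq_cube power2_eq_square field_simps)
      also have "\<dots> = (x - 73 / 12) * (x / 75 + 31 / 2700) + 1879 / 32400"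
        by (simp add: power2_eq_square field_simps)
      also have "\<dots> \<ge> 0"
      proof -
        have "0 \<le> (x - 73 / 12) * (x / 75 + 31 / 2700)"
          using x by (intro mult_nonneg_nonneg) auto
        then show ?thesis
          by linarith
      qed
      finally show "(x * (x + 1 - 8 / 25) powr (1 / 3)) ^ Suc 2 \<le> ((x + 1 / 3) * (x - 8 / 25) powr (1 / 3)) ^ Suc 2"
        by simp
    qed (use x in simp)
  qed auto
  \<comment> \<open>\<open>1.793\<close> is slightly above the cube root of \<open>73/12 - 8/25\<close>.\<close>
  also have "(73 / 12 - 8 / 25) powr (1 / 3) \<le> (1793 / 1000 :: real)"
  proof (rule power_le_imp_le_base)
    show "((73 / 12 - 8 / 25) powr (1 / 3)) ^ Suc 2 \<le> (1793 / 1000 :: real) ^ Suc 2"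
      by (simp only: powr_power) (simp add: power3_eq_cube)
  qed simp
  finally have 2: "pochhammer (5 / 12) 6 * Gamma (5 / 12) \<le> pochhammer (1 / 12) 6 * Gamma (1 / 12) * (1793 / 1000 :: real)"
    using Gamma_shift [of "5 / 12" 6] Gamma_shift [of "1 / 12" 6] by (simp add: mult_left_mono)
  have "(pochhammer (1 / 2) 6 * sqrt pi) * (pochhammer (5 / 12) 6 * Gamma (5 / 12)) \<le>
     288 * (pochhammer (1 / 12) 6 * Gamma (1 / 12) * (1793 / 1000 :: real))"
    by (intro mult_mono 1 2) (auto intro!: mult_nonneg_nonneg less_imp_le [OF pochhammer_pos])
  then have "sqrt pi * Gamma (5 / 12) \<le> Gamma (1 / 12) *
      (288 * pochhammer (1 / 12) 6 * (1793 / 1000) / (pochhammer (1 / 2) 6 * pochhammer (5 / 12) 6) :: real)"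
    using pochhammer_pos [of "1 / 2 :: real" 6] pochhammer_pos [of "5 / 12 :: real" 6]
    by (simp add: field_simps)
  then have "sqrt pi * Gamma (5 / 12) * (720 / 133) \<le> Gamma (1 / 12) *
      (288 * pochhammer (1 / 12) 6 * (1793 / 1000) / (pochhammer (1 / 2) 6 * pochhammer (5 / 12) 6) * (720 / 133))"
    by simp
  also have "\<dots> < Gamma (1 / 12) * 2 powr (5 / 6)"
  proof (rule mult_strict_left_mono)
    have "(288 * pochhammer (1 / 12) 6 * (1793 / 1000) / (pochhammer (1 / 2) 6 * pochhammer (5 / 12) 6) * (720 / 133)) ^ 6 < (32 :: real)"
      by (simp add: pochhammer_rec' pochhammer_Suc numeral_eq_Suc)
    also have "32 = (2 powr (5 / 6) :: real) ^ 6"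
      by (simp only: powr_power) simp
    finally show "288 * pochhammer (1 / 12) 6 * (1793 / 1000) / (pochhammer (1 / 2) 6 * pochhammer (5 / 12) 6) * (720 / 133) < (2 powr (5 / 6) :: real)"
      by (rule power_less_imp_less_base) simp
  qed simp
  finally show ?thesis
    by (simp add: mult.commute)
qed

section \<open>The Fourier integral of the ramp\<close>

text \<open>
  Up to the factor \<open>-2\<close> the derivative of the parabola \<open>1 - s\<^sup>2\<close> on \<open>[-1, 1]\<close>.
\<close>

definition ramp :: "real \<Rightarrow> complex" where
  "ramp s = complex_of_real (indicator {-1..1} s * s)"

lemma ramp_measurable [measurable]: "ramp \<in> borel_measurable borel"
  unfolding ramp_def [abs_def] by measurable

lemma ramp_integrable: "integrable lborel ramp"
  by (rule integrable_bounded_support [of _ 1 1]) (auto simp: ramp_def indicator_def)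

lemma autocorrelation_ramp:
  "autocorrelation ramp z = complex_of_real (if \<bar>z\<bar> \<le> 2 then 2 / 3 - \<bar>z\<bar> + \<bar>z\<bar> ^ 3 / 6 else 0)"
proof -
  have FTC: "(LINT x|lborel. (x + z) * x * indicator {a..b} x) = (b ^ 3 / 3 + z * b\<^sup>2 / 2) - (a ^ 3 / 3 + z * a\<^sup>2 / 2)"
    if "a \<le> b" for a b :: real
    using that
    by (intro integral_FTC_Icc_real [of a b "\<lambda>x. x ^ 3 / 3 + z * x\<^sup>2 / 2"])
       (auto intro!: derivative_eq_intros simp: power2_eq_square algebra_simps)
  have eq: "autocorrelation ramp z = complex_of_real (LINT x|lborel. (x + z) * x * (indicator {-1..1} (x + z) * indicator {-1..1} x))"
    unfolding autocorrelation_def ramp_def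
    by (simp add: mult_ac flip: of_real_mult integral_complex_of_real)
  consider "2 < \<bar>z\<bar>" | "0 \<le> z" "z \<le> 2" | "-2 \<le> z" "z \<le> 0"
    by linarith
  then show ?thesis
  proof cases
    case 1
    then have "(x + z) * x * (indicator {-1..1} (x + z) * indicator {-1..1} x) = (0::real)" for x
      by (auto simp: indicator_def)
    then show ?thesis
      unfolding eq using 1 by (simp only: Bochner_Integration.integral_zero) simp
  next
    case 2
    then have "indicator {-1..1} (x + z) * indicator {-1..1} x = (indicator {-1..1 - z} x :: real)" for x
      by (auto simp: indicator_def)
    moreover have "(LINT x|lborel. (x + z) * x * indicator {-1..1 - z} x) = 2 / 3 - \<bar>z\<bar> + \<bar>z\<bar> ^ 3 / 6"
      using 2 by (subst FTC) (auto simp: power3_eq_cube power2_eq_square field_simps)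
    ultimately show ?thesis
      unfolding eq using 2 by (simp only:) simp
  next
    case 3
    then have "indicator {-1..1} (x + z) * indicator {-1..1} x = (indicator {-1 - z..1} x :: real)" for x
      by (auto simp: indicator_def)
    moreover have "(LINT x|lborel. (x + z) * x * indicator {-1 - z..1} x) = 2 / 3 - \<bar>z\<bar> + \<bar>z\<bar> ^ 3 / 6"
      using 3 by (subst FTC) (auto simp: power3_eq_cube power2_eq_square field_simps)
    ultimately show ?thesis
      unfolding eq using 3 by (simp only:) simp
  qed
qed

lemma has_bochner_integral_abs_powr:
  fixes p :: real
  assumes p: "-1 < p"
  shows "has_bochner_integral lborel (\<lambda>z::real. \<bar>z\<bar> powr p * indicator {-2..2} z) (2 * 2 powr (p + 1) / (p + 1))"
proof (rule has_bochner_integral_nn_integral)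
  define g :: "real \<Rightarrow> ennreal" where "g z = ennreal (indicator {0..2} z * z powr p)" for z
  have [measurable]: "g \<in> borel_measurable borel"
    unfolding g_def by measurable
  have half: "(\<integral>\<^sup>+z. g z \<partial>lborel) = ennreal (2 powr (p + 1) / (p + 1))"
    unfolding g_def by (rule nn_integral_has_integral_lebesgue [OF _ has_integral_powr_from_0]) (use p in auto)
  have "AE z in lborel. z \<noteq> (0::real)"
    by (rule AE_lborel_singleton)
  then have "(\<integral>\<^sup>+z. ennreal (\<bar>z\<bar> powr p * indicator {-2..2} z) \<partial>lborel) = (\<integral>\<^sup>+z. g z + g (0 + (-1) * z) \<partial>lborel)"
    by (intro nn_integral_cong_AE) (eventually_elim, auto simp: g_def indicator_def)
  also have "\<dots> = (\<integral>\<^sup>+z. g z \<partial>lborel) + (\<integral>\<^sup>+z. g (0 + (-1) * z) \<partial>lborel)"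
    by (rule nn_integral_add) measurable
  also have "(\<integral>\<^sup>+z. g (0 + (-1) * z) \<partial>lborel) = (\<integral>\<^sup>+z. g z \<partial>lborel)"
    using nn_integral_real_affine [of g "-1" 0] by simp
  finally show "(\<integral>\<^sup>+z. ennreal (\<bar>z\<bar> powr p * indicator {-2..2} z) \<partial>lborel) = ennreal (2 * 2 powr (p + 1) / (p + 1))"
    unfolding half using p by (simp flip: ennreal_plus)
qed (use p in auto)

lemma ramp_riesz_energy:
  fixes \<beta> :: real
  assumes \<beta>: "0 < \<beta>" "\<beta> < 1"
  defines "f \<equiv> (\<lambda>z. complex_of_real (\<bar>z\<bar> powr (- \<beta>)) * autocorrelation ramp z)"
  shows "integrable lborel f"
    and "(LINT z|lborel. f z) = complex_of_real (8 * \<beta> * 2 powr (- \<beta>) / ((1 - \<beta>) * (2 - \<beta>) * (4 - \<beta>)))" (is ?P1)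
proof -
  define g where "g z = 2 / 3 * (\<bar>z\<bar> powr (- \<beta>) * indicator {-2..2} z) -
      \<bar>z\<bar> powr (1 - \<beta>) * indicator {-2..2} z + 1 / 6 * (\<bar>z\<bar> powr (3 - \<beta>) * indicator {-2..2} z)" for z :: real
  define I where "I = 2 / 3 * (2 * 2 powr (- \<beta> + 1) / (- \<beta> + 1)) - 2 * 2 powr (1 - \<beta> + 1) / (1 - \<beta> + 1)
      + 1 / 6 * (2 * 2 powr (3 - \<beta> + 1) / (3 - \<beta> + 1))"
  have g: "has_bochner_integral lborel g I"
    unfolding g_def I_def
    by (intro has_bochner_integral_add has_bochner_integral_diff has_bochner_integral_mult_right has_bochner_integral_abs_powr)
       (use \<beta> in auto)
  have I: "I = 8 * \<beta> * 2 powr (- \<beta>) / ((1 - \<beta>) * (2 - \<beta>) * (4 - \<beta>))"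
  proof -
    have "2 powr (- \<beta> + 1) = 2 * 2 powr (- \<beta>)" "2 powr (1 - \<beta> + 1) = 4 * 2 powr (- \<beta>)" "2 powr (3 - \<beta> + 1) = 16 * 2 powr (- \<beta>)"
      by (simp_all add: powr_diff powr_add powr_minus field_simps)
    then show ?thesis
      unfolding I_def using \<beta> by (simp add: divide_simps) (simp add: algebra_simps)
  qed
  have AE: "AE z in lborel. complex_of_real (g z) = f z"
    using AE_lborel_singleton [of "0::real"]
  proof eventually_elim
    case (elim z)
    then have "\<bar>z\<bar> powr (1 - \<beta>) = \<bar>z\<bar> * \<bar>z\<bar> powr (- \<beta>)" "\<bar>z\<bar> powr (3 - \<beta>) = \<bar>z\<bar> ^ 3 * \<bar>z\<bar> powr (- \<beta>)"
      by (simp_all add: powr_diff powr_minus divide_inverse)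
    moreover have "indicator {-2..2} z = (if \<bar>z\<bar> \<le> 2 then 1 else 0 :: real)"
      by (auto simp: indicator_def)
    ultimately show ?case
      by (auto simp: g_def f_def autocorrelation_ramp algebra_simps)
  qed
  have [measurable]: "autocorrelation ramp \<in> borel_measurable borel"
    using autocorrelation_fourier(1) [OF ramp_integrable] by auto
  have [measurable]: "f \<in> borel_measurable borel" "g \<in> borel_measurable borel"
    unfolding f_def g_def [abs_def] by measurable
  show "integrable lborel f"
    using g by (subst integrable_cong_AE [OF _ _ AE, symmetric]) (auto simp: has_bochner_integral_iff)
  have "(LINT z|lborel. f z) = (LINT z|lborel. complex_of_real (g z))"
    by (intro integral_cong_AE) (use AE in auto)
  then show ?P1
    using g by (simp add: has_bochner_integral_iff I)
qed

lemma ramp_fourier_energy: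
  fixes \<beta> :: real
  assumes \<beta>: "0 < \<beta>" "\<beta> < 1"
  shows "(\<integral>\<^sup>+k. ennreal (\<bar>k\<bar> powr (\<beta> - 1) * (cmod (\<F> ramp k))\<^sup>2) \<partial>lborel) =
    ennreal (4 * \<beta> * Gamma (\<beta> / 2) / (sqrt pi * Gamma ((1 - \<beta>) / 2) * ((1 - \<beta>) * (2 - \<beta>) * (4 - \<beta>))))"
proof -
  have e: "2 * ((1 - \<beta>) / 2) = 1 - \<beta>" "1 / 2 - (1 - \<beta>) / 2 = \<beta> / 2" "1 - \<beta> - 1 = - \<beta>" "- (1 - \<beta>) = \<beta> - 1" "1 - (1 - \<beta>) = \<beta>"
    by (simp_all add: field_simps)
  have four_pi: "(4 * pi) powr (- (1 / 2)) = 1 / (2 * sqrt pi)"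
    unfolding powr_minus_divide by (simp add: powr_half_sqrt real_sqrt_mult)
  have helper: "1 / (2 * r) * X * G / H * (8 * b * (1 / X) / D) = 4 * b * G / (r * H * D)" if "X \<noteq> 0" for r X G H b D :: real
    using that by (simp add: mult_ac)
  have "(4 * pi) powr (- (1 / 2)) * 2 powr \<beta> * Gamma (\<beta> / 2) / Gamma ((1 - \<beta>) / 2) *
      (8 * \<beta> * 2 powr (- \<beta>) / ((1 - \<beta>) * (2 - \<beta>) * (4 - \<beta>))) =
      4 * \<beta> * Gamma (\<beta> / 2) / (sqrt pi * Gamma ((1 - \<beta>) / 2) * ((1 - \<beta>) * (2 - \<beta>) * (4 - \<beta>)))"
    unfolding four_pi powr_minus_divide [of 2 \<beta>] by (rule helper) simp
  then show ?thesis
    using riesz_potential_parseval [OF ramp_integrable, of "(1 - \<beta>) / 2"] ramp_riesz_energy [OF \<beta>] \<beta>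
    by (simp only: real_norm_def DIM_real of_nat_1 e Re_complex_of_real) simp
qed

section \<open>Rotations and polar coordinates in the plane\<close>

lemma lborel_distr_orthogonal:
  fixes T :: "real^'n::{finite,wellorder} \<Rightarrow> real^'n::_"
  assumes T: "orthogonal_transformation T"
  shows "distr lborel borel T = lborel"
proof (rule lborel_eqI [symmetric])
  fix l u :: "real^'n::_"
  assume le: "\<And>b. b \<in> Basis \<Longrightarrow> l \<bullet> b \<le> u \<bullet> b"
  obtain T' where T': "orthogonal_transformation T'" "\<And>x. T' (T x) = x" "\<And>x. T (T' x) = x"
    using orthogonal_transformation_inv [OF T] orthogonal_transformation_bij [OF T]
    by (metis bij_inv_eq_iff)
  have [measurable]: "T \<in> borel_measurable borel"
    by (intro borel_measurable_continuous_onI linear_continuous_on linear_conv_bounded_linear [THEN iffD1] orthogonal_transformation_linear T)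
  have vimage: "T -` box l u = T' ` box l u"
    using T' by (auto simp: image_iff) (metis T'(2))
  have box: "T' ` box l u \<in> lmeasurable" "measure lebesgue (T' ` box l u) = measure lebesgue (box l u)"
    by (intro measurable_orthogonal_image measure_orthogonal_image T' lmeasurable_box)+
  have "T -` box l u \<in> sets borel"
    using measurable_sets [of T borel borel "box l u"] by simp
  then have "emeasure (distr lborel borel T) (box l u) = emeasure lebesgue (T' ` box l u)"
    by (simp add: emeasure_distr vimage)
  also have "\<dots> = ennreal (measure lebesgue (T' ` box l u))"
    by (rule emeasure_eq_measure2 [OF box(1)])
  also have "\<dots> = ennreal (\<Prod>b\<in>Basis. (u - l) \<bullet> b)"
    using le by (simp add: box(2) measure_lborel_box_eq)
  finally show "emeasure (distr lborel borel T) (box l u) = (\<Prod>b\<in>Basis. (u - l) \<bullet> b)" .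
qed simp

lemma vector_2_measurable: "(\<lambda>(s, t). vector [s, t] :: real^2) \<in> borel_measurable (borel \<Otimes>\<^sub>M borel)"
proof -
  have "(\<lambda>(s, t). vector [s, t] :: real^2) = (\<lambda>p. fst p *\<^sub>R axis 1 1 + snd p *\<^sub>R axis 2 1)"
    by (auto simp: vec_eq_iff forall_2 axis_def)
  then show ?thesis
    by simp
qed

lemma lborel_real2_eq_distr_pair:
  "(lborel :: (real^2) measure) = distr (lborel \<Otimes>\<^sub>M lborel) borel (\<lambda>(s, t). vector [s, t])"
proof (rule lborel_eqI)
  have [measurable]: "(\<lambda>(s, t). vector [s, t] :: real^2) \<in> borel_measurable (borel \<Otimes>\<^sub>M borel)"
    by (rule vector_2_measurable)
  fix l u :: "real^2"
  assume le: "\<And>b. b \<in> Basis \<Longrightarrow> l \<bullet> b \<le> u \<bullet> b"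
  have prod: "(\<Prod>b\<in>Basis. (u - l) \<bullet> b) = (u $ 1 - l $ 1) * (u $ 2 - l $ 2)"
    by (simp add: Basis_vec_def prod.UNION_disjoint UNIV_2 axis_eq_axis inner_axis)
  have le': "l $ 1 \<le> u $ 1" "l $ 2 \<le> u $ 2"
    using le [of "axis 1 1"] le [of "axis 2 1"] by (auto simp: inner_axis axis_in_Basis_iff)
  have "(\<lambda>(s, t). vector [s, t]) -` box l u = {l $ 1<..<u $ 1} \<times> {l $ 2<..<u $ 2}"
    by (auto simp: mem_box_cart forall_2)
  then have "emeasure (distr (lborel \<Otimes>\<^sub>M lborel) borel (\<lambda>(s, t). vector [s, t])) (box l u) =
      emeasure (lborel \<Otimes>\<^sub>M lborel) ({l $ 1<..<u $ 1} \<times> {l $ 2<..<u $ 2})"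
    by (subst emeasure_distr) (auto simp: space_pair_measure)
  also have "\<dots> = ennreal ((u $ 1 - l $ 1) * (u $ 2 - l $ 2))"
    using le' by (subst lborel.emeasure_pair_measure_Times) (auto simp: ennreal_mult)
  finally show "emeasure (distr (lborel \<Otimes>\<^sub>M lborel) borel (\<lambda>(s, t). vector [s, t])) (box l u) = (\<Prod>b\<in>Basis. (u - l) \<bullet> b)"
    by (simp only: prod)
qed simp

text \<open>
  Polar coordinates in the plane, for radial functions: the circle of radius \<open>r\<close> has length
  \<open>2 \<pi> r\<close>.  The two measures agree on the half-lines that end at \<open>a\<close>, by the area \<open>\<pi> a\<^sup>2\<close> of a disk.
\<close>

lemma distr_norm_real2:
  "distr (lborel :: (real^2) measure) borel norm = density lborel (\<lambda>r. ennreal (indicator {0..} r * (2 * pi * r)))"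
proof (rule measure_eqI_generator_eq)
  let ?E = "range (\<lambda>a::real. {..a})"
  let ?M = "distr (lborel :: (real^2) measure) borel norm"
  have ball: "emeasure ?M {..a} = (if 0 \<le> a then ennreal (pi * a\<^sup>2) else 0)" for a
  proof -
    have "emeasure ?M {..a} = emeasure lborel (norm -` {..a} :: (real^2) set)"
      by (subst emeasure_distr) auto
    also have "norm -` {..a} = cball (0::real^2) a"
      by auto
    also have "emeasure lborel (cball (0::real^2) a) = (if 0 \<le> a then ennreal (pi * a\<^sup>2) else 0)"
      by (simp add: emeasure_cball unit_ball_vol_2)
    finally show ?thesis .
  qed
  show "Int_stable ?E"
    by (auto simp: Int_stable_def)
  show "?E \<subseteq> Pow UNIV" "sets ?M = sigma_sets UNIV ?E"
    "sets (density lborel (\<lambda>r. ennreal (indicator {0..} r * (2 * pi * r)))) = sigma_sets UNIV ?E"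
    by (auto simp: borel_eq_atMost)
  show "emeasure ?M X = emeasure (density lborel (\<lambda>r. ennreal (indicator {0..} r * (2 * pi * r)))) X" if XE: "X \<in> ?E" for X
  proof -
    obtain a where X: "X = {..a}"
      using XE by auto
    have "emeasure (density lborel (\<lambda>r. ennreal (indicator {0..} r * (2 * pi * r)))) {..a} =
       (\<integral>\<^sup>+r. ennreal (2 * pi * r) * indicator {0..a} r \<partial>lborel)"
      by (subst emeasure_density) (auto intro!: nn_integral_cong simp: indicator_def)
    also have "\<dots> = (if 0 \<le> a then ennreal (pi * a\<^sup>2) else 0)"
    proof (cases "0 \<le> a")
      case True
      have "(\<integral>\<^sup>+r. ennreal (2 * pi * r) * indicator {0..a} r \<partial>lborel) = pi * a\<^sup>2 - pi * 0\<^sup>2"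
        using True by (intro nn_integral_FTC_Icc) (auto intro!: derivative_eq_intros)
      then show ?thesis
        using True by simp
    qed simp
    finally show ?thesis
      by (simp add: X ball)
  qed
  show "range (\<lambda>n::nat. {..real n}) \<subseteq> ?E"
    by auto
  show "(\<Union>n::nat. {..real n}) = UNIV"
    by (auto simp: real_arch_simple)
  show "emeasure ?M {..real n} \<noteq> \<infinity>" for n :: nat
    by (simp add: ball)
qed

lemma nn_integral_radial_real2:
  assumes [measurable]: "f \<in> borel_measurable borel"
  shows "(\<integral>\<^sup>+x. f (norm (x::real^2)) \<partial>lborel) = (\<integral>\<^sup>+r. ennreal (indicator {0..} r * (2 * pi * r)) * f r \<partial>lborel)"
proof -
  have "(\<integral>\<^sup>+x. f (norm (x::real^2)) \<partial>lborel) = (\<integral>\<^sup>+r. f r \<partial>distr (lborel :: (real^2) measure) borel norm)"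
    by (subst nn_integral_distr) auto
  also have "\<dots> = (\<integral>\<^sup>+r. ennreal (indicator {0..} r * (2 * pi * r)) * f r \<partial>lborel)"
    unfolding distr_norm_real2 by (subst nn_integral_density) auto
  finally show ?thesis .
qed

section \<open>The hemispherical trial function\<close>

text \<open>
  The graph of this function over the unit disk is the upper unit hemisphere.
\<close>

definition cap :: "real^2 \<Rightarrow> complex" where
  "cap x = complex_of_real (sqrt (max 0 (1 - (norm x)\<^sup>2)))"

lemma cap_measurable [measurable]: "cap \<in> borel_measurable borel"
  unfolding cap_def [abs_def] by measurable

lemma cap_outside: "x \<notin> ball 0 1 \<Longrightarrow> cap x = 0"
  using power_mono [of 1 "norm x" 2] by (simp add: cap_def)

lemma cap_integrable: "integrable lborel cap"
  by (rule integrable_bounded_support [of _ 1 1]) (auto simp: cap_outside cap_def)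

lemma cap_square: "(cmod (cap x))\<^sup>2 = max 0 (1 - (norm x)\<^sup>2)"
  by (simp add: cap_def)

lemma cap_square_integrable: "square_integrable cap"
  by (rule square_integrable_bounded_support [of _ 1 1]) (auto simp: cap_outside cap_def)

lemma l2_norm_cap: "(l2_norm cap)\<^sup>2 = pi / 2"
proof -
  have "ennreal ((l2_norm cap)\<^sup>2) = (\<integral>\<^sup>+x. ennreal ((cmod (cap x))\<^sup>2) \<partial>lborel)"
    using cap_square_integrable unfolding l2_norm_squared square_integrable_def
    by (intro nn_integral_eq_integral [symmetric]) auto
  also have "\<dots> = (\<integral>\<^sup>+r. ennreal (indicator {0..} r * (2 * pi * r)) * ennreal (max 0 (1 - r\<^sup>2)) \<partial>lborel)"
    unfolding cap_square by (rule nn_integral_radial_real2) measurable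
  also have "\<dots> = (\<integral>\<^sup>+r. ennreal (2 * pi * r * (1 - r\<^sup>2)) * indicator {0..1} r \<partial>lborel)"
  proof (rule nn_integral_cong)
    fix r :: real
    consider "r < 0" | "0 \<le> r" "r \<le> 1" | "1 < r"
      by linarith
    then show "ennreal (indicator {0..} r * (2 * pi * r)) * ennreal (max 0 (1 - r\<^sup>2)) = ennreal (2 * pi * r * (1 - r\<^sup>2)) * indicator {0..1} r"
    proof cases
      case 2
      then have "r\<^sup>2 \<le> 1"
        by (simp add: power_le_one)
      then show ?thesis
        using 2 by (simp add: max_def flip: ennreal_mult)
    next
      case 3
      then have "1 \<le> r\<^sup>2"
        by (simp add: one_le_power)
      then have "max 0 (1 - r\<^sup>2) = 0"
        by (intro max_absorb1) simp
      then show ?thesis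
        using 3 by simp
    qed simp
  qed
  also have "\<dots> = ennreal ((pi * 1\<^sup>2 - pi * 1 ^ 4 / 2) - (pi * 0\<^sup>2 - pi * 0 ^ 4 / 2))"
  proof (rule nn_integral_FTC_Icc [where F = "\<lambda>r. pi * r\<^sup>2 - pi * r ^ 4 / 2"])
    show "((\<lambda>r. pi * r\<^sup>2 - pi * r ^ 4 / 2) has_real_derivative 2 * pi * r * (1 - r\<^sup>2)) (at r)" for r
      by (auto intro!: derivative_eq_intros simp: power2_eq_square power3_eq_cube algebra_simps)
    show "0 \<le> 2 * pi * r * (1 - r\<^sup>2)" if "r \<in> {0..1}" for r :: real
      using that by (simp add: power_le_one)
  qed auto
  finally show ?thesis
    by simp
qed

text \<open>
  The area under a semicircle of radius \<open>\<surd>b\<close>.  With \<open>b = 1 - s\<^sup>2\<close> it gives the projection of the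
  hemisphere onto a line.
\<close>

lemma semicircle_integral:
  "(LINT t|lborel. sqrt (max 0 (b - t\<^sup>2))) = pi / 2 * max 0 b"
proof (cases "0 < b")
  case False
  then have "max 0 (b - t\<^sup>2) = 0" for t
    using zero_le_power2 [of t] by (intro max_absorb1) linarith
  then show ?thesis
    using False by simp
next
  case True
  have "((\<lambda>t. sqrt (1 - t\<^sup>2)) has_integral (1 * sqrt (1 - 1\<^sup>2) + arcsin 1) / 2 - ((-1) * sqrt (1 - (-1)\<^sup>2) + arcsin (-1)) / 2) {-1..1}"
  proof (rule fundamental_theorem_of_calculus_interior)
    show "continuous_on {-1..1} (\<lambda>t. (t * sqrt (1 - t\<^sup>2) + arcsin t) / 2)"
      by (intro continuous_intros) auto
    fix t :: real
    assume t: "t \<in> {-1<..<1}"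
    then have p: "0 < 1 - t\<^sup>2"
      by (simp add: abs_square_less_1 abs_less_iff)
    then have sq: "sqrt (1 - t\<^sup>2) * sqrt (1 - t\<^sup>2) = 1 - t\<^sup>2" "0 < sqrt (1 - t\<^sup>2)"
      by auto
    have "((\<lambda>t. (t * sqrt (1 - t\<^sup>2) + arcsin t) / 2) has_real_derivative
        (sqrt (1 - t\<^sup>2) + t * (- (2 * t) * (inverse (sqrt (1 - t\<^sup>2)) / 2)) + inverse (sqrt (1 - t\<^sup>2))) / 2) (at t)"
      using t p by (auto intro!: derivative_eq_intros)
    also have "(sqrt (1 - t\<^sup>2) + t * (- (2 * t) * (inverse (sqrt (1 - t\<^sup>2)) / 2)) + inverse (sqrt (1 - t\<^sup>2))) / 2 = sqrt (1 - t\<^sup>2)"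
      using sq by (simp add: field_simps power2_eq_square)
    finally show "((\<lambda>t. (t * sqrt (1 - t\<^sup>2) + arcsin t) / 2) has_vector_derivative sqrt (1 - t\<^sup>2)) (at t)"
      by (simp add: has_real_derivative_iff_has_vector_derivative)
  qed simp
  then have "((\<lambda>t. sqrt (1 - t\<^sup>2)) has_integral pi / 2) {-1..1}"
    by simp
  then have "(\<integral>\<^sup>+t. ennreal (indicator {-1..1} t * sqrt (1 - t\<^sup>2)) \<partial>lborel) = ennreal (pi / 2)"
    by (intro nn_integral_has_integral_lebesgue) (auto simp: abs_square_le_1)
  moreover have ind: "indicator {-1..1} t * sqrt (1 - t\<^sup>2) = sqrt (max 0 (1 - t\<^sup>2))" for t :: real
    by (auto simp: indicator_def max_def abs_square_le_1)
  ultimately have "has_bochner_integral lborel (\<lambda>t. sqrt (max 0 (1 - t\<^sup>2))) (pi / 2)"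
    by (intro has_bochner_integral_nn_integral) auto
  then have base: "(LINT t|lborel. sqrt (max 0 (1 - t\<^sup>2))) = pi / 2"
    by (simp add: has_bochner_integral_iff)
  have "max 0 (b - (0 + sqrt b * t)\<^sup>2) = b * max 0 (1 - t\<^sup>2)" for t
    using True by (simp add: power_mult_distrib max_def algebra_simps)
  then have "(LINT t|lborel. sqrt (max 0 (b - t\<^sup>2))) = sqrt b * (LINT t|lborel. sqrt b * sqrt (max 0 (1 - t\<^sup>2)))"
    using True by (subst lborel_integral_real_affine [of "sqrt b" _ 0]) (simp_all add: real_sqrt_mult)
  then show ?thesis
    using True by (simp add: base)
qed

text \<open>
  Rotate \<open>\<xi>\<close> to the first axis and integrate over the second coordinate: this leaves the one-dimensional
  Fourier integral \<open>P\<close> of \<open>\<pi>/2 (1 - s\<^sup>2)\<close>, up to constants.  Integration by parts, without boundary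
  terms because the parabola vanishes at \<open>\<plusminus>1\<close>, relates it to the integral \<open>R\<close> for the ramp by \<open>i k P = - 2 R\<close>.
\<close>

lemma fourier_integral_cap:
  assumes "\<xi> \<noteq> 0"
  shows "(cmod (\<F> cap \<xi>))\<^sup>2 = pi / 2 * (cmod (\<F> ramp (norm \<xi>)))\<^sup>2 / (norm \<xi>)\<^sup>2"
proof -
  define k where "k = norm \<xi>"
  have k: "0 < k"
    using assms by (simp add: k_def)
  define E where "E s = exp (- (\<i> * complex_of_real (s * k)))" for s :: real
  have [measurable]: "E \<in> borel_measurable borel"
    unfolding E_def by measurable
  have E_norm: "cmod (E s) = 1" for s
    by (simp add: E_def)
  define P where "P = (LINT s|lborel. indicator {-1..1} s *\<^sub>R (complex_of_real (1 - s\<^sup>2) * E s))"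
  define R where "R = (LINT s|lborel. indicator {-1..1} s *\<^sub>R (complex_of_real s * E s))"
  obtain T :: "real^2 \<Rightarrow> real^2" where T: "orthogonal_transformation T" "T (k *\<^sub>R axis 1 1) = \<xi>"
    by (rule orthogonal_transformation_exists [of "k *\<^sub>R axis 1 1 :: real^2" \<xi>]) (auto simp: k_def)
  have T_norm: "norm (T x) = norm x" for x
    using T(1) by (simp add: orthogonal_transformation_norm)
  have T_inner: "T x \<bullet> \<xi> = x $ 1 * k" for x
    using T(1) unfolding T(2) [symmetric] orthogonal_transformation_def by (simp add: inner_axis)
  have [measurable]: "T \<in> borel_measurable borel"
    by (intro borel_measurable_continuous_onI linear_continuous_on linear_conv_bounded_linear [THEN iffD1] orthogonal_transformation_linear T)
  have [measurable]: "(\<lambda>x. x $ 1) \<in> borel_measurable (borel :: (real^2) measure)"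
    by (intro borel_measurable_continuous_onI continuous_intros)
  have [measurable]: "(\<lambda>(s, t). vector [s, t] :: real^2) \<in> borel_measurable (borel \<Otimes>\<^sub>M borel)"
    by (rule vector_2_measurable)
  have cE_int: "integrable lborel (\<lambda>x. cap x * E (x $ 1))"
    by (rule Bochner_Integration.integrable_bound [OF cap_integrable]) (auto simp: norm_mult E_norm)
  have cap_vec: "cap (vector [s, t]) = complex_of_real (sqrt (max 0 ((1 - s\<^sup>2) - t\<^sup>2)))" for s t
    by (simp add: cap_def norm_vec_def L2_set_def UNIV_2 algebra_simps)
  have "(LINT x|lborel. cap x * exp (- (\<i> * complex_of_real (x \<bullet> \<xi>)))) =
      (LINT x|lborel. cap (T x) * exp (- (\<i> * complex_of_real (T x \<bullet> \<xi>))))"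
    by (subst lborel_distr_orthogonal [OF T(1), symmetric], subst integral_distr) auto
  also have "\<dots> = (LINT x|lborel. cap x * E (x $ 1))"
    by (simp add: T_inner E_def cap_def T_norm)
  also have "\<dots> = (LINT p|(lborel \<Otimes>\<^sub>M lborel). (case p of (s, t) \<Rightarrow> cap (vector [s, t]) * E s))"
    by (subst lborel_real2_eq_distr_pair, subst integral_distr)
       (auto intro!: Bochner_Integration.integral_cong)
  also have "\<dots> = (LINT s|lborel. (LINT t|lborel. cap (vector [s, t]) * E s))"
  proof -
    have "integrable (lborel \<Otimes>\<^sub>M lborel) (\<lambda>(s, t). cap (vector [s, t]) * E s)"
      using cE_int by (subst (asm) lborel_real2_eq_distr_pair, subst (asm) integrable_distr_eq) (auto simp: case_prod_unfold)
    from lborel_pair.integral_fst' [OF this] show ?thesis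
      by simp
  qed
  also have "\<dots> = (LINT s|lborel. complex_of_real (pi / 2) * (indicator {-1..1} s *\<^sub>R (complex_of_real (1 - s\<^sup>2) * E s)))"
  proof (rule Bochner_Integration.integral_cong)
    fix s :: real
    have "(LINT t|lborel. cap (vector [s, t]) * E s) = complex_of_real (pi / 2 * max 0 (1 - s\<^sup>2)) * E s"
      by (simp only: integral_mult_left_zero cap_vec integral_complex_of_real semicircle_integral)
    moreover have "max 0 (1 - s\<^sup>2) = indicator {-1..1} s * (1 - s\<^sup>2)"
      by (auto simp: indicator_def max_def abs_square_le_1 abs_le_iff)
    ultimately show "(LINT t|lborel. cap (vector [s, t]) * E s) = complex_of_real (pi / 2) * (indicator {-1..1} s *\<^sub>R (complex_of_real (1 - s\<^sup>2) * E s))"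
      by (simp add: scaleR_conv_of_real)
  qed simp
  also have "\<dots> = complex_of_real (pi / 2) * P"
    by (simp only: P_def integral_mult_right_zero)
  finally have X: "(LINT x|lborel. cap x * exp (- (\<i> * complex_of_real (x \<bullet> \<xi>)))) = complex_of_real (pi / 2) * P" .
  have c: "(2 * pi) powr (- (real DIM(real^2) / 2)) = 1 / (2 * pi)"
    by (simp add: powr_minus_divide)
  have F_cap: "(cmod (\<F> cap \<xi>))\<^sup>2 = (1 / (2 * pi) * (pi / 2) * cmod P)\<^sup>2"
    by (simp only: fourier_integral_def X c norm_mult norm_of_real) simp
  have F_R: "(LINT s|lborel. ramp s * exp (- (\<i> * complex_of_real (s \<bullet> k)))) = R"
    unfolding R_def by (intro Bochner_Integration.integral_cong) (auto simp: ramp_def E_def indicator_def)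
  have c': "((2 * pi) powr (- (real DIM(real) / 2)))\<^sup>2 = 1 / (2 * pi)"
    by (simp add: powr_minus_divide power_divide powr_half_squared)
  have F_ramp: "(cmod (\<F> ramp k))\<^sup>2 = (cmod R)\<^sup>2 / (2 * pi)"
    by (simp only: fourier_integral_def F_R norm_mult norm_of_real power_mult_distrib power2_abs c') simp
  let ?D = "LINT s|lborel. indicator {-1..1} s *\<^sub>R ((- 2) * (complex_of_real s * E s) - \<i> * complex_of_real k * (complex_of_real (1 - s\<^sup>2) * E s))"
  have deriv: "((\<lambda>s. complex_of_real (1 - s\<^sup>2) * E s) has_vector_derivative
      (- 2) * (complex_of_real s * E s) - \<i> * complex_of_real k * (complex_of_real (1 - s\<^sup>2) * E s)) (at s within A)" for s A
    unfolding E_def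
    by (auto intro!: derivative_eq_intros has_vector_derivative_real_field simp: algebra_simps)
  have "?D =
     complex_of_real (1 - 1\<^sup>2) * E 1 - complex_of_real (1 - (-1)\<^sup>2) * E (-1)"
    by (rule integral_FTC_Icc [OF _ deriv]) (auto simp: E_def intro!: continuous_intros)
  also have "?D =
     (- 2) * R - \<i> * complex_of_real k * P"
  proof -
    have int: "integrable lborel (\<lambda>s. indicator {-1..1} s *\<^sub>R (complex_of_real s * E s))"
       "integrable lborel (\<lambda>s. indicator {-1..1} s *\<^sub>R (complex_of_real (1 - s\<^sup>2) * E s))"
      by (rule borel_integrable_compact; auto simp: E_def intro!: continuous_intros)+
    have "?D =
      (LINT s|lborel. (- 2) * (indicator {-1..1} s *\<^sub>R (complex_of_real s * E s)) - \<i> * complex_of_real k * (indicator {-1..1} s *\<^sub>R (complex_of_real (1 - s\<^sup>2) * E s)))"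
      by (intro Bochner_Integration.integral_cong) (auto simp: indicator_def)
    also have "\<dots> = (- 2) * R - \<i> * complex_of_real k * P"
      unfolding P_def R_def
      by (subst Bochner_Integration.integral_diff) (simp_all only: integral_mult_right_zero integrable_mult_right int)
    finally show ?thesis .
  qed
  finally have "\<i> * complex_of_real k * P = (- 2) * R"
    by (simp add: algebra_simps)
  then have "k * cmod P = 2 * cmod R"
    using k by (metis abs_of_pos mult_1 norm_ii norm_minus_cancel norm_mult norm_numeral norm_of_real)
  then have "cmod P = 2 * cmod R / k"
    using k by (simp add: field_simps)
  then have "(cmod P)\<^sup>2 = 4 * (cmod R)\<^sup>2 / k\<^sup>2"
    by (simp only: power_divide power_mult_distrib) simp
  then show ?thesis
    unfolding F_cap k_def [symmetric] F_ramp power_mult_distrib by (simp add: power2_eq_square)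
qed

lemma fourier_integral_ramp_minus: "cmod (\<F> ramp (- k)) = cmod (\<F> ramp k)"
proof -
  have "(LINT s|lborel. ramp s * exp (- (\<i> * complex_of_real (s \<bullet> (- k))))) =
      (LINT s|lborel. cnj (ramp s * exp (- (\<i> * complex_of_real (s \<bullet> k)))))"
    by (simp add: ramp_def exp_cnj)
  also have "\<dots> = cnj (LINT s|lborel. ramp s * exp (- (\<i> * complex_of_real (s \<bullet> k))))"
    by (rule Bochner_Integration.integral_cnj)
  finally show ?thesis
    by (simp add: fourier_integral_def norm_mult)
qed

text \<open>
  In polar coordinates the factor \<open>1 / k\<^sup>2\<close> of \<open>fourier_integral_cap\<close> and the Jacobian \<open>2 \<pi> k\<close> turn \<open>k\<^sup>\<beta>\<close> into \<open>k\<close> to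
  the power \<open>\<beta> - 1\<close>; by symmetry the integral over \<open>k > 0\<close> is half of that over the whole line.
\<close>

lemma cap_fourier_energy:
  fixes \<beta> :: real
  assumes \<beta>: "0 < \<beta>" "\<beta> < 1"
  shows "(\<integral>\<^sup>+\<xi>. ennreal (norm \<xi> powr \<beta> * (cmod (\<F> cap \<xi>))\<^sup>2) \<partial>lborel) =
    ennreal (pi\<^sup>2 / 2 * (4 * \<beta> * Gamma (\<beta> / 2) / (sqrt pi * Gamma ((1 - \<beta>) / 2) * ((1 - \<beta>) * (2 - \<beta>) * (4 - \<beta>)))))" (is "?X = _")
proof -
  define g where "g r = ennreal (indicator {0<..} r * (r powr (\<beta> - 1) * (cmod (\<F> ramp r))\<^sup>2))" for r :: real
  have [measurable]: "g \<in> borel_measurable borel"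
    unfolding g_def by measurable
  define f where "f r = ennreal (r powr \<beta> * (pi / 2 * (cmod (\<F> ramp r))\<^sup>2 / r\<^sup>2))" for r :: real
  have [measurable]: "f \<in> borel_measurable borel"
    unfolding f_def by measurable
  have "?X = (\<integral>\<^sup>+\<xi>. f (norm (\<xi>::real^2)) \<partial>lborel)"
    by (rule nn_integral_cong_AE, rule AE_mp [OF AE_lborel_singleton [of "0::real^2"]])
       (auto simp: fourier_integral_cap f_def)
  also have "\<dots> = (\<integral>\<^sup>+r. ennreal (indicator {0..} r * (2 * pi * r)) * f r \<partial>lborel)"
    by (rule nn_integral_radial_real2) measurable
  also have "\<dots> = (\<integral>\<^sup>+r. ennreal (pi\<^sup>2) * g r \<partial>lborel)"
  proof (rule nn_integral_cong)
    fix r :: real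
    show "ennreal (indicator {0..} r * (2 * pi * r)) * f r = ennreal (pi\<^sup>2) * g r"
    proof (cases "0 < r")
      case True
      have "2 * pi * r * (r powr \<beta> * (pi / 2 * X / r\<^sup>2)) = pi\<^sup>2 * (r powr (\<beta> - 1) * X)" for X
        using True by (simp add: powr_diff field_simps power2_eq_square)
      then show ?thesis
        using True by (simp add: f_def g_def flip: ennreal_mult)
    qed (auto simp: g_def indicator_def)
  qed
  also have "\<dots> = ennreal (pi\<^sup>2) * (\<integral>\<^sup>+r. g r \<partial>lborel)"
    by (rule nn_integral_cmult) measurable
  finally have 1: "?X = ennreal (pi\<^sup>2) * (\<integral>\<^sup>+r. g r \<partial>lborel)" .
  have "(\<integral>\<^sup>+k. ennreal (\<bar>k\<bar> powr (\<beta> - 1) * (cmod (\<F> ramp k))\<^sup>2) \<partial>lborel) = (\<integral>\<^sup>+k. g k + g (0 + (-1) * k) \<partial>lborel)"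
    by (rule nn_integral_cong_AE, rule AE_mp [OF AE_lborel_singleton [of "0::real"]])
       (auto simp: g_def indicator_def fourier_integral_ramp_minus)
  also have "\<dots> = (\<integral>\<^sup>+k. g k \<partial>lborel) + (\<integral>\<^sup>+k. g (0 + (-1) * k) \<partial>lborel)"
    by (rule nn_integral_add) measurable
  also have "(\<integral>\<^sup>+k. g (0 + (-1) * k) \<partial>lborel) = (\<integral>\<^sup>+k. g k \<partial>lborel)"
    using nn_integral_real_affine [of g "-1" 0] by simp
  finally have 2: "2 * (\<integral>\<^sup>+k. g k \<partial>lborel) = ennreal (4 * \<beta> * Gamma (\<beta> / 2) / (sqrt pi * Gamma ((1 - \<beta>) / 2) * ((1 - \<beta>) * (2 - \<beta>) * (4 - \<beta>))))"
    by (simp add: ramp_fourier_energy [OF \<beta>] mult_2)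
  have "ennreal (pi\<^sup>2) * (\<integral>\<^sup>+r. g r \<partial>lborel) = ennreal (pi\<^sup>2 / 2) * (2 * (\<integral>\<^sup>+r. g r \<partial>lborel))"
  proof -
    have "ennreal (pi\<^sup>2) = ennreal (pi\<^sup>2 / 2) * 2"
      using ennreal_mult [of "pi\<^sup>2 / 2" 2] by simp
    then show ?thesis
      by (simp only: mult.assoc)
  qed
  then show ?thesis
    unfolding 1 2 by (simp only:) (rule ennreal_mult' [symmetric], simp)
qed

lemma cap_fourier_energy_lt:
  obtains e where "0 \<le> e" "e < 2 powr (5 / 6) * (pi / 2)"
    "(\<integral>\<^sup>+\<xi>. ennreal (norm \<xi> powr (5 / 6) * (cmod (\<F> cap \<xi>))\<^sup>2) \<partial>lborel) = ennreal e"
proof -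
  define e where "e = pi / 2 * (sqrt pi * Gamma (5 / 12) * (720 / 133) / Gamma (1 / 12))"
  have "(\<integral>\<^sup>+\<xi>. ennreal (norm \<xi> powr (5 / 6) * (cmod (\<F> cap \<xi>))\<^sup>2) \<partial>lborel) = ennreal e"
  proof -
    have "pi\<^sup>2 / 2 * (4 * (5 / 6) * Gamma (5 / 6 / 2) / (sqrt pi * Gamma ((1 - 5 / 6) / 2) * ((1 - 5 / 6) * (2 - 5 / 6) * (4 - 5 / 6)))) =
       pi / 2 * (pi / sqrt pi * Gamma (5 / 12) * (720 / 133) / Gamma (1 / 12))"
      by (simp add: power2_eq_square)
    also have "pi / sqrt pi = sqrt pi"
      by (simp add: real_div_sqrt)
    finally show ?thesis
      using cap_fourier_energy [of "5 / 6"] by (simp add: e_def)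
  qed
  moreover have "e < 2 powr (5 / 6) * (pi / 2)"
    using Gamma_ratio_bound by (simp add: e_def pos_divide_less_eq)
  moreover have "0 \<le> e"
    by (simp add: e_def)
  ultimately show thesis
    using that by blast
qed

section \<open>The first eigenvalue of the disk\<close>

text \<open>
  Young's inequality for \<open>(x / 2)\<^sup>\<beta>\<close> and \<open>1\<close> with weights \<open>\<alpha> / \<beta>\<close> and \<open>1 - \<alpha> / \<beta>\<close>.
\<close>

lemma powr_le_weighted_powr:
  fixes x \<alpha> \<beta> :: real
  assumes "0 < \<alpha>" "\<alpha> \<le> \<beta>" "0 \<le> x"
  shows "x powr \<alpha> \<le> 2 powr \<alpha> * (\<alpha> / \<beta> * (2 powr (- \<beta>) * x powr \<beta>) + (1 - \<alpha> / \<beta>))"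
proof (cases "x = 0")
  case True
  then show ?thesis
    using assms by (simp add: divide_le_eq)
next
  case False
  define \<theta> where "\<theta> = \<alpha> / \<beta>"
  have \<theta>: "0 \<le> \<theta>" "\<theta> \<le> 1" "\<beta> * \<theta> = \<alpha>"
    using assms by (auto simp: \<theta>_def)
  have "(2 powr (- \<beta>) * x powr \<beta>) powr \<theta> * 1 powr (1 - \<theta>) \<le> \<theta> * (2 powr (- \<beta>) * x powr \<beta>) + (1 - \<theta>) * 1"
    using \<theta> assms False by (intro Youngs_inequality_0) auto
  moreover have "(2 powr (- \<beta>) * x powr \<beta>) powr \<theta> = 2 powr (- \<alpha>) * x powr \<alpha>"
    using \<theta>(3) by (simp add: powr_mult powr_powr)
  ultimately have "2 powr \<alpha> * (2 powr (- \<alpha>) * x powr \<alpha>) \<le> 2 powr \<alpha> * (\<theta> * (2 powr (- \<beta>) * x powr \<beta>) + (1 - \<theta>))"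
    by (intro mult_left_mono) auto
  moreover have "2 powr \<alpha> * (2 powr (- \<alpha>) * x powr \<alpha>) = x powr \<alpha>"
    by (simp add: powr_minus)
  ultimately show ?thesis
    by (simp add: \<theta>_def)
qed

text \<open>
  Integrating \<open>powr_le_weighted_powr\<close> with \<open>\<beta> = 5/6\<close> bounds the energy of order \<open>\<alpha>\<close> by a convex combination of the energy
  of order \<open>5/6\<close>, which is below \<open>2\<^bsup>5/6\<^esup>\<parallel>u\<parallel>\<^sup>2\<close> by \<open>cap_fourier_energy_lt\<close>, and the squared norm.
\<close>

lemma cap_rayleigh_quotient_lt:
  fixes \<alpha> :: real
  assumes \<alpha>: "0 < \<alpha>" "\<alpha> \<le> 5 / 6"
  shows "square_integrable (\<W> \<alpha> cap)"
    and "(l2_norm (\<W> \<alpha> cap))\<^sup>2 < 2 powr \<alpha> * (l2_norm cap)\<^sup>2" (is ?P1)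
proof -
  define \<theta> where "\<theta> = \<alpha> / (5 / 6)"
  have \<theta>: "0 < \<theta>" "\<theta> \<le> 1"
    using \<alpha> by (auto simp: \<theta>_def)
  obtain e where e: "0 \<le> e" "e < 2 powr (5 / 6) * (pi / 2)"
    and energy: "(\<integral>\<^sup>+\<xi>. ennreal (norm \<xi> powr (5 / 6) * (cmod (\<F> cap \<xi>))\<^sup>2) \<partial>lborel) = ennreal e"
    by (rule cap_fourier_energy_lt)
  have norm2: "(\<integral>\<^sup>+\<xi>. ennreal ((cmod (\<F> cap \<xi>))\<^sup>2) \<partial>lborel) = ennreal (pi / 2)"
  proof -
    have "l2_norm (\<F> cap) = l2_norm cap"
      by (rule plancherel [OF cap_square_integrable, of 1]) (auto simp: cap_outside)
    then show ?thesis
      using square_integrable_nn_integral [OF fourier_integral_square_integrable(1) [OF cap_integrable cap_square_integrable]]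
      by (simp add: l2_norm_cap)
  qed
  let ?a = "ennreal (2 powr \<alpha> * \<theta> * 2 powr (- (5 / 6)))"
  let ?b = "ennreal (2 powr \<alpha> * (1 - \<theta>))"
  define C where "C = 2 powr \<alpha> * (\<theta> * (2 powr (- (5 / 6)) * e) + (1 - \<theta>) * (pi / 2))"
  have C_nonneg: "0 \<le> C"
    using \<theta> e by (simp add: C_def)
  have "(\<integral>\<^sup>+\<xi>. ennreal ((cmod (\<W> \<alpha> cap \<xi>))\<^sup>2) \<partial>lborel) \<le>
      (\<integral>\<^sup>+\<xi>. ?a * ennreal (norm \<xi> powr (5 / 6) * (cmod (\<F> cap \<xi>))\<^sup>2) +
         ?b * ennreal ((cmod (\<F> cap \<xi>))\<^sup>2) \<partial>lborel)"
  proof (rule nn_integral_mono)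
    fix \<xi> :: "real^2"
    define f where "f = (cmod (\<F> cap \<xi>))\<^sup>2"
    have "norm \<xi> powr \<alpha> * f \<le> 2 powr \<alpha> * (\<theta> * (2 powr (- (5 / 6)) * norm \<xi> powr (5 / 6)) + (1 - \<theta>)) * f"
      unfolding \<theta>_def by (intro mult_right_mono powr_le_weighted_powr \<alpha>) (auto simp: f_def)
    also have "\<dots> = 2 powr \<alpha> * \<theta> * 2 powr (- (5 / 6)) * (norm \<xi> powr (5 / 6) * f) + 2 powr \<alpha> * (1 - \<theta>) * f"
      by (simp add: algebra_simps)
    finally have "ennreal (norm \<xi> powr \<alpha> * f) \<le> ennreal (2 powr \<alpha> * \<theta> * 2 powr (- (5 / 6)) * (norm \<xi> powr (5 / 6) * f) + 2 powr \<alpha> * (1 - \<theta>) * f)"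
      by (rule ennreal_leI)
    also have "\<dots> = ?a * ennreal (norm \<xi> powr (5 / 6) * f) + ?b * ennreal f"
      using \<theta> by (simp add: f_def ennreal_plus ennreal_mult)
    finally show "ennreal ((cmod (\<W> \<alpha> cap \<xi>))\<^sup>2) \<le> ?a * ennreal (norm \<xi> powr (5 / 6) * (cmod (\<F> cap \<xi>))\<^sup>2) +
         ?b * ennreal ((cmod (\<F> cap \<xi>))\<^sup>2)"
      by (simp add: cmod_weighted_fourier_squared f_def)
  qed
  also have "\<dots> = ?a * ennreal e + ?b * ennreal (pi / 2)"
    by (subst nn_integral_add) (auto simp: nn_integral_cmult energy norm2)
  also have "\<dots> = ennreal ((sqrt C)\<^sup>2)"
  proof -
    have "(sqrt C)\<^sup>2 = 2 powr \<alpha> * \<theta> * 2 powr (- (5 / 6)) * e + 2 powr \<alpha> * (1 - \<theta>) * (pi / 2)"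
      using C_nonneg by (simp add: C_def field_simps)
    moreover have "ennreal a * ennreal e + ennreal b * ennreal (pi / 2) = ennreal (a * e + b * (pi / 2))"
      if "0 \<le> a" "0 \<le> b" for a b
    proof -
      have "ennreal (a * e + b * (pi / 2)) = ennreal (a * e) + ennreal (b * (pi / 2))"
        using that e by (intro ennreal_plus) auto
      also have "ennreal (a * e) = ennreal a * ennreal e"
        using that e by (intro ennreal_mult)
      also have "ennreal (b * (pi / 2)) = ennreal b * ennreal (pi / 2)"
        using that by (intro ennreal_mult) auto
      finally show ?thesis ..
    qed
    ultimately show ?thesis
      using \<theta> by simp
  qed
  finally have *: "(\<integral>\<^sup>+\<xi>. ennreal ((cmod (\<W> \<alpha> cap \<xi>))\<^sup>2) \<partial>lborel) \<le> ennreal ((sqrt C)\<^sup>2)" .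
  show "square_integrable (\<W> \<alpha> cap)"
    by (rule square_integrableI_nn_integral [OF _ *]) (use C_nonneg in auto)
  have "l2_norm (\<W> \<alpha> cap) \<le> sqrt C"
    by (rule square_integrableI_nn_integral [OF _ *]) (use C_nonneg in auto)
  then have "(l2_norm (\<W> \<alpha> cap))\<^sup>2 \<le> (sqrt C)\<^sup>2"
    by (intro power_mono) auto
  also have "\<dots> = C"
    using C_nonneg by simp
  also have "C < 2 powr \<alpha> * (l2_norm cap)\<^sup>2"
  proof -
    have "2 powr (- (5 / 6)) * e < 2 powr (- (5 / 6)) * (2 powr (5 / 6) * (pi / 2))"
      using e by (intro mult_strict_left_mono) auto
    also have "\<dots> = pi / 2"
      by (simp add: powr_minus)
    finally have "\<theta> * (2 powr (- (5 / 6)) * e) < \<theta> * (pi / 2)"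
      using \<theta> by (intro mult_strict_left_mono)
    moreover have "(1 - \<theta>) * (pi / 2) = pi / 2 - \<theta> * (pi / 2)"
      by (simp only: left_diff_distrib mult_1)
    ultimately have "\<theta> * (2 powr (- (5 / 6)) * e) + (1 - \<theta>) * (pi / 2) < pi / 2"
      by linarith
    then show ?thesis
      by (simp add: C_def l2_norm_cap)
  qed
  finally show ?P1 .
qed

theorem theorem2:
  fixes \<alpha> :: real
  assumes "0 < \<alpha>" and "\<alpha> < 0.802"
  shows "first_eigenvalue \<alpha> (ball (0 :: real ^ 2) 1) < 2 powr \<alpha>"
proof -
  have \<alpha>: "0 < \<alpha>" "\<alpha> \<le> 5 / 6"
    using assms by auto
  have "cap \<in> sobolev_space_0 (\<alpha> / 2) (ball 0 1)"
    unfolding sobolev_space_0_iff [OF ball_subset_cball \<alpha>(1)]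
    by (intro conjI cap_square_integrable cap_rayleigh_quotient_lt(1) [OF \<alpha>] AE_I2 impI cap_outside)
  moreover have "l2_norm cap \<noteq> 0"
    using l2_norm_cap by auto
  ultimately have "first_eigenvalue \<alpha> (ball (0 :: real ^ 2) 1) * (l2_norm cap)\<^sup>2 \<le> (l2_norm (\<W> \<alpha> cap))\<^sup>2"
    by (intro first_eigenvalue_le_rayleigh_quotient \<alpha> bounded_ball)
  also have "\<dots> < 2 powr \<alpha> * (l2_norm cap)\<^sup>2"
    by (rule cap_rayleigh_quotient_lt(2) [OF \<alpha>])
  finally show ?thesis
    by (simp add: l2_norm_cap)
qed

end
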